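(* Let $d\in\mathbb{N}$, let $Z$ be a zero-mean Gaussian process on $\mathbb{R}^d$ with stationary covariance function $k_Z$ that is sub-exponential and asymptotically positive, let $T:\mathbb{R}\to\mathbb{R}$ be sub-exponential and non-decreasing, and let $Y(s)=T(Z(s))$, $s\in\mathbb{R}^d$, be assumed to have zero mean. Let $(s_i)_{i\in\mathbb{N}}$ be an asymptotically well-separated sequence in $\mathbb{R}^d$, and for $n\in\mathbb{N}$ let $y=(Y(s_1),\ldots,Y(s_n))^\top$. Let $(A_n)_{n\in\mathbb{N}}$ be a sequence of real matrices, $A_n$ of size $n\times n$; write $A=A_n$. Assume that there are constants $C<\infty$ and $c>0$, not depending on $n,i,j$, such that for all $n\in\mathbb{N}$ and $i,j=1,\ldots,n$, \[ |A_{i,j}|\le\frac{C}{1+|s_i-s_j|^{d+c}} . \] Let $V_n=\frac1n y^\top A y$ and let $\mathcal{L}_n$ be the distribution of $\sqrt{n}\,(V_n-\mathbb{E}[V_n])$. Then, as $n\to\infty$, \[ d_w\bigl(\mathcal{L}_n,\ \mathcal{N}[0,\,n\operatorname{Var}(V_n)]\bigr)\to 0 . \] In addition, the sequence $(n\operatorname{Var}(V_n))_{n\in\mathbb{N}}$ is bounded.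
   Context: $\mathbb{N}$ is the set of positive integers, and $|x|=\max_{i}|x_i|$ for a vector $x$. $d_w$ denotes a metric generating the topology of weak convergence on the set of Borel probability measures on Euclidean space; $\mathcal{N}[m,v]$ is the Gaussian distribution with mean $m$ and (possibly zero) variance $v$. A function $k:\mathbb{R}^d\to\mathbb{R}$ is called a stationary covariance function if $(x_1,x_2)\mapsto k(x_1-x_2)$ is a covariance function. A sequence $(x_i)_{i\in\mathbb{N}}$ in $\mathbb{R}^d$ is asymptotically well-separated if $\inf_{i\neq j}|x_i-x_j|>0$. A stationary covariance function $k$ on $\mathbb{R}^d$ is sub-exponential and asymptotically positive if: (i) there are constants $C<\infty$, $c>0$ with $|k(s)|\le C\exp(-c|s|)$ for all $s\in\mathbb{R}^d$; (ii) for any asymptotically well-separated sequence $(x_i)_{i\in\mathbb{N}}$, the smallest eigenvalue of the $n\times n$ matrix $(k(x_i-x_j))_{i,j=1,\ldots,n}$ is bounded below by a strictly positive constant uniformly in $n\in\mathbb{N}$. A function $F:\mathbb{R}\to\mathbb{R}$ is sub-exponential and non-decreasing if it is non-constant, continuously differentiable, non-decreasing, and there is a constant $C<\infty$ with $|F(t)|\le C\exp(C|t|)$ and $|F'(t)|\le C\exp(C|t|)$ for all $t\in\mathbb{R}$. *)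

theory Defs
  imports "HOL-Probability.Probability" "Jordan_Normal_Form.Spectral_Radius"
begin

section \<open>Weak convergence of Borel probability measures\<close>

definition borel_prob_measures :: "'b::topological_space measure set" where
  "borel_prob_measures = {\<mu>. prob_space \<mu> \<and> sets \<mu> = sets borel}"

text \<open>The coarsest topology making \<open>\<mu> \<mapsto> \<integral>f d\<mu>\<close> continuous for every bounded continuous real \<open>f\<close>.\<close>

definition weak_topology :: "'b::topological_space measure topology" where
  "weak_topology = topology_generated_by
     {{\<mu> \<in> borel_prob_measures. integral\<^sup>L \<mu> f \<in> U} | (f :: 'b \<Rightarrow> real) U.
        continuous_on UNIV f \<and> bounded (range f) \<and> open U}"

lemma topspace_weak_topology:
  "topspace (weak_topology :: 'b::topological_space measure topology) = borel_prob_measures"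
proof -
  let ?S = "{{\<mu> \<in> borel_prob_measures. integral\<^sup>L \<mu> f \<in> U} | (f :: 'b \<Rightarrow> real) U.
        continuous_on UNIV f \<and> bounded (range f) \<and> open U}"
  have "(borel_prob_measures :: 'b measure set) \<in> ?S"
    by (rule CollectI, rule exI[of _ "\<lambda>_. 0"], rule exI[of _ UNIV]) auto
  then show ?thesis
    unfolding weak_topology_def topology_generated_by_topspace by blast
qed

definition metrizes_weak_convergence ::
    "('b::topological_space measure \<Rightarrow> 'b measure \<Rightarrow> real) \<Rightarrow> bool" where
  "metrizes_weak_convergence dw \<longleftrightarrow>
     Metric_space borel_prob_measures dw \<and>
     Metric_space.mtopology borel_prob_measures dw = weak_topology"

section \<open>Gaussian processes and covariance functions\<close>

text \<open>The second argument is the variance \<open>v \<ge> 0\<close>, whereas \<^const>\<open>normal_density\<close> takes the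
  standard deviation; for \<open>v = 0\<close> the distribution is the Dirac measure at the mean.\<close>

definition gaussian :: "real \<Rightarrow> real \<Rightarrow> real measure" where
  "gaussian m v =
     (if v = 0 then return borel m else density lborel (normal_density m (sqrt v)))"

definition covariance :: "'a measure \<Rightarrow> ('a \<Rightarrow> real) \<Rightarrow> ('a \<Rightarrow> real) \<Rightarrow> real" where
  "covariance M X Y =
     integral\<^sup>L M (\<lambda>\<omega>. (X \<omega> - integral\<^sup>L M X) * (Y \<omega> - integral\<^sup>L M Y))"

text \<open>All finite-dimensional distributions are (possibly degenerate) multivariate Gaussian, i.e.
  every finite linear combination is Gaussian.\<close>

definition gaussian_process :: "'a measure \<Rightarrow> ('t \<Rightarrow> 'a \<Rightarrow> real) \<Rightarrow> bool" where
  "gaussian_process M Z \<longleftrightarrow>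
     (\<forall>t. Z t \<in> borel_measurable M) \<and>
     (\<forall>I a. finite I \<longrightarrow>
        (\<exists>m v. v \<ge> 0 \<and> distr M borel (\<lambda>\<omega>. \<Sum>t\<in>I. a t * Z t \<omega>) = gaussian m v))"

definition covariance_function :: "('t \<Rightarrow> 't \<Rightarrow> real) \<Rightarrow> bool" where
  "covariance_function K \<longleftrightarrow>
     (\<forall>s t. K s t = K t s) \<and>
     (\<forall>I a. finite I \<longrightarrow> (\<Sum>s\<in>I. \<Sum>t\<in>I. a s * a t * K s t) \<ge> 0)"

definition stationary_covariance_function :: "(real^'d \<Rightarrow> real) \<Rightarrow> bool" where
  "stationary_covariance_function k \<longleftrightarrow> covariance_function (\<lambda>x1 x2. k (x1 - x2))"

section \<open>Sub-exponential covariances and transformations\<close>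

definition asymptotically_well_separated :: "(nat \<Rightarrow> real^'d) \<Rightarrow> bool" where
  "asymptotically_well_separated x \<longleftrightarrow>
     (INF (i, j)\<in>{(i, j). i \<noteq> j}. infnorm (x i - x j)) > 0"

text \<open>Only used for symmetric matrices of positive dimension, whose real spectrum is nonempty.\<close>

definition smallest_eigenvalue :: "real mat \<Rightarrow> real" where
  "smallest_eigenvalue K = Min (spectrum K)"

definition subexponential_asymptotically_positive :: "(real^'d \<Rightarrow> real) \<Rightarrow> bool" where
  "subexponential_asymptotically_positive k \<longleftrightarrow>
     stationary_covariance_function k \<and>
     (\<exists>C c. c > 0 \<and> (\<forall>s. \<bar>k s\<bar> \<le> C * exp (- c * infnorm s))) \<and>
     (\<forall>x. asymptotically_well_separated x \<longrightarrow>
        (\<exists>\<delta>>0. \<forall>n\<ge>1. smallest_eigenvalue (mat n n (\<lambda>(i, j). k (x i - x j))) \<ge> \<delta>))"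

definition subexponential_nondecreasing :: "(real \<Rightarrow> real) \<Rightarrow> bool" where
  "subexponential_nondecreasing F \<longleftrightarrow>
     \<not> F constant_on UNIV \<and> F C1_differentiable_on UNIV \<and> mono F \<and>
     (\<exists>C. \<forall>t. \<bar>F t\<bar> \<le> C * exp (C * \<bar>t\<bar>) \<and> \<bar>deriv F t\<bar> \<le> C * exp (C * \<bar>t\<bar>))"

end

theory Submission
  imports Defs
begin

text \<open>
  Write \<open>W\<^sub>n = sqrt n * (V\<^sub>n - E V\<^sub>n)\<close> as a function of the Gaussian vector
  \<open>Z = (Z(s\<^sub>1), ..., Z(s\<^sub>n))\<close> with covariance matrix \<open>K\<close>. Because the points are well separated, the
  rows of \<open>K\<close> and the rows and columns of \<open>A\<close> are absolutely summable uniformly in \<open>n\<close>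
  (\<open>well_separated_row_sums\<close>). Hence, for a smooth and bounded transformation, every partial derivative of \<open>W\<^sub>n\<close> has size \<open>n\<^sup>-\<^sup>1\<^sup>/\<^sup>2\<close>, and so
  has every column sum of its Hessian: each coordinate matters little, and only for its neighbours.

  The engine is the Gaussian covariance identity (\<open>covariance_identity\<close>)
    \<open>Cov(F(Z), G(Z)) = \<integral> (\<Sum>i j. K i j * E[D\<^sub>i F(Z) * D\<^sub>j G(Z\<^sup>\<rho>)]) d\<rho>\<close>  over \<open>0 \<le> \<rho> \<le> 1\<close>,
  where \<open>Z\<^sup>\<rho> = \<rho> Z + sqrt(1 - \<rho>\<^sup>2) Z'\<close> is built from an independent copy \<open>Z'\<close> of \<open>Z\<close>. It is used three times.

  \<^item> With \<open>F = exp(itW)\<close> and \<open>G = W\<close> it writes \<open>E[W exp(itW)]\<close> as \<open>it\<close> times the \<open>\<rho>\<close>-average of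
    \<open>E[exp(itW(Z)) g(Z, Z\<^sup>\<rho>)]\<close>, where \<open>g(x, y) = \<Sum>i j. K i j * D\<^sub>i W(x) * D\<^sub>j W(y)\<close>
    and where the \<open>\<rho>\<close>-average of \<open>E g(Z, Z\<^sup>\<rho>)\<close> is \<open>Var W\<close>.
  \<^item> Applied to the Gaussian vector \<open>(Z, Z\<^sup>\<rho>)\<close>, it shows that \<open>exp(itW(Z))\<close> and \<open>g(Z, Z\<^sup>\<rho>)\<close> have covariance
    of order \<open>n\<^sup>-\<^sup>1\<^sup>/\<^sup>2\<close>. So the characteristic function \<open>\<phi>\<close> of \<open>W\<close> satisfies
    \<open>\<phi>'(t) = - t Var(W) \<phi>(t) + O(t\<^sup>2 n\<^sup>-\<^sup>1\<^sup>/\<^sup>2)\<close> and is close to \<open>exp(- Var(W) t\<^sup>2 / 2)\<close> (\<open>qform_clt_rate\<close>).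
  \<^item> With \<open>F = G\<close> it is a Poincare inequality. It bounds the variance of \<open>W\<^sub>n\<close>, and it bounds, uniformly
    in \<open>n\<close>, the effect on \<open>W\<^sub>n\<close> of replacing the transformation \<open>T\<close> by another one
    that is close to \<open>T\<close> together with its derivative in \<open>L\<^sup>4\<close> of the one-dimensional
    marginal law (\<open>qform_diff_variance\<close>).

  The last point allows \<open>T\<close> to be replaced by a trigonometric polynomial \<open>f\<close> (\<open>trig_poly_L4_approx\<close>), and this
  makes the identity elementary. On characters \<open>exp(i a\<cdot>z)\<close> and \<open>exp(i b\<cdot>z)\<close> it is the
  fundamental theorem of calculus for \<open>exp(- \<rho> a\<cdot>Kb)\<close> as a function of \<open>\<rho>\<close>, and both sides are bilinear and continuous
  under uniform limits of functions and gradients. The class \<open>trig_fun\<close> of such limits is closed under products and exponentials,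
  so it contains \<open>exp(itW)\<close> as soon as it contains \<open>W\<close>.

  The passage to the metric \<open>d\<^sub>w\<close> is by subsequences: the variances are bounded, so along a
  subsequence they converge, and there Levy's continuity theorem gives the same weak limit for the law
  of \<open>W\<^sub>n\<close> and for the Gaussian law with the variance of \<open>W\<^sub>n\<close>.
\<close>

section \<open>Uniform limits of trigonometric polynomials together with their gradients\<close>

text \<open>The second argument records the gradient formally, so that products, exponentials and limits never have
to be differentiated again: a pair belongs to the class when function and gradient are uniform limits of
the same trigonometric polynomials. Only the gradient components with index in \<open>I\<close> carry information.\<close>

inductive trig_fun ::
    "'i set \<Rightarrow> (('i \<Rightarrow> real) \<Rightarrow> complex) \<Rightarrow> ('i \<Rightarrow> ('i \<Rightarrow> real) \<Rightarrow> complex) \<Rightarrow> bool"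
  for I where
  character: "trig_fun I (\<lambda>z. iexp (\<Sum>i\<in>I. a i * z i))
                (\<lambda>j z. \<i> * complex_of_real (a j) * iexp (\<Sum>i\<in>I. a i * z i))"
| add: "trig_fun I F D \<Longrightarrow> trig_fun I G E \<Longrightarrow> trig_fun I (\<lambda>z. F z + G z) (\<lambda>j z. D j z + E j z)"
| scale: "trig_fun I F D \<Longrightarrow> trig_fun I (\<lambda>z. c * F z) (\<lambda>j z. c * D j z)"
| limit: "(\<And>k. trig_fun I (Fs k) (Ds k)) \<Longrightarrow> r \<longlonglongrightarrow> (0::real) \<Longrightarrow>
    (\<And>k z. norm (F z - Fs k z) \<le> r k) \<Longrightarrow> (\<And>k j z. j \<in> I \<Longrightarrow> norm (D j z - Ds k j z) \<le> r k) \<Longrightarrow>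
    trig_fun I F D"

lemma trig_fun_cong:
  assumes "trig_fun I F D" "\<And>z. F' z = F z" "\<And>j z. j \<in> I \<Longrightarrow> D' j z = D j z"
  shows "trig_fun I F' D'"
  by (rule trig_fun.limit[of I "\<lambda>_. F" "\<lambda>_. D" "\<lambda>_. 0"]) (use assms in simp_all)

lemma trig_fun_const: "trig_fun I (\<lambda>_. c) (\<lambda>_ _. 0)"
  by (rule trig_fun_cong[OF trig_fun.scale[OF trig_fun.character[of I "\<lambda>_. 0"], of c]]) simp_all

lemma trig_fun_diff:
  assumes "trig_fun I F D" "trig_fun I G E"
  shows "trig_fun I (\<lambda>z. F z - G z) (\<lambda>j z. D j z - E j z)"
  by (rule trig_fun_cong[OF trig_fun.add[OF assms(1) trig_fun.scale[OF assms(2), of "-1"]]]) simp_all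

lemma trig_fun_sum:
  assumes "\<And>k. k \<in> S \<Longrightarrow> trig_fun I (F k) (D k)"
  shows "trig_fun I (\<lambda>z. \<Sum>k\<in>S. F k z) (\<lambda>j z. \<Sum>k\<in>S. D k j z)"
  using assms
proof (induction S rule: infinite_finite_induct)
  case (insert x S)
  have "trig_fun I (\<lambda>z. F x z + (\<Sum>k\<in>S. F k z)) (\<lambda>j z. D x j z + (\<Sum>k\<in>S. D k j z))"
    by (rule trig_fun.add) (use insert in auto)
  then show ?case using insert by simp
qed (simp_all add: trig_fun_const)

lemma trig_fun_bounded:
  assumes "trig_fun I F D" "finite I"
  shows "\<exists>B. \<forall>z. norm (F z) \<le> B \<and> (\<forall>j\<in>I. norm (D j z) \<le> B)"
  using assms(1)
proof induction
  case (character a)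
  have "\<bar>a j\<bar> \<le> 1 + (\<Sum>j\<in>I. \<bar>a j\<bar>)" if "j \<in> I" for j
    using member_le_sum[OF that, of "\<lambda>j. \<bar>a j\<bar>"] \<open>finite I\<close> by simp
  then show ?case
    by (intro exI[of _ "1 + (\<Sum>j\<in>I. \<bar>a j\<bar>)"]) (auto simp: norm_mult sum_nonneg)
next
  case (add F D G E)
  then obtain B C where B: "\<And>z. norm (F z) \<le> B" "\<And>j z. j \<in> I \<Longrightarrow> norm (D j z) \<le> B"
    and C: "\<And>z. norm (G z) \<le> C" "\<And>j z. j \<in> I \<Longrightarrow> norm (E j z) \<le> C" by metis
  show ?case by (intro exI[of _ "B + C"]) (auto intro!: norm_triangle_mono B C)
next
  case (scale F D c)
  then obtain B where B: "\<And>z. norm (F z) \<le> B" "\<And>j z. j \<in> I \<Longrightarrow> norm (D j z) \<le> B" by metis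
  then show ?case by (intro exI[of _ "norm c * B"]) (auto simp: norm_mult mult_left_mono)
next
  case (limit Fs Ds r F D)
  then obtain B where B: "\<And>z. norm (Fs 0 z) \<le> B" "\<And>j z. j \<in> I \<Longrightarrow> norm (Ds 0 j z) \<le> B" by metis
  have "norm (F z) \<le> B + r 0" for z
    using B(1)[of z] limit(3)[of z 0] norm_triangle_sub[of "F z" "Fs 0 z"] by linarith
  moreover have "norm (D j z) \<le> B + r 0" if "j \<in> I" for z j
    using B(2)[of j z] limit(4)[of j z 0] that norm_triangle_sub[of "D j z" "Ds 0 j z"] by fastforce
  ultimately show ?case by blast
qed

lemma trig_fun_mult:
  assumes "trig_fun I F D" "trig_fun I G E" "finite I"
  shows "trig_fun I (\<lambda>z. F z * G z) (\<lambda>j z. D j z * G z + F z * E j z)"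
  using assms(1)
proof induction
  case (character a)
  let ?e = "\<lambda>a z. iexp (\<Sum>i\<in>I. a i * z i)"
  show ?case
    using assms(2)
  proof induction
    case (character b)
    have *: "?e (\<lambda>i. a i + b i) z = ?e a z * ?e b z" for z
      by (simp add: distrib_right sum.distrib distrib_left exp_add)
    show ?case
      by (rule trig_fun_cong[OF trig_fun.character[of I "\<lambda>i. a i + b i"]])
         (simp_all only: *, auto simp: algebra_simps)
  next
    case (add F D G E)
    show ?case
      by (rule trig_fun_cong[OF trig_fun.add[OF add.IH]]) (auto simp: algebra_simps)
  next
    case (scale F D c)
    show ?case
      by (rule trig_fun_cong[OF trig_fun.scale[OF scale.IH, of c]]) (auto simp: algebra_simps)
  next
    case (limit Fs Ds r F D)
    let ?C = "1 + (\<Sum>j\<in>I. \<bar>a j\<bar>)"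
    have le: "\<bar>a j\<bar> + 1 \<le> ?C" if "j \<in> I" for j
      using member_le_sum[of j I "\<lambda>j. \<bar>a j\<bar>"] that \<open>finite I\<close> by auto
    have r0: "r k \<ge> 0" for k using limit(3)[of undefined k] norm_ge_zero order.trans by blast
    have C1: "1 \<le> ?C" by (simp add: sum_nonneg)
    show ?case
    proof (rule trig_fun.limit[OF limit.IH])
      show "(\<lambda>k. ?C * r k) \<longlonglongrightarrow> 0" using limit(2) tendsto_mult_right_zero by blast
      fix k z
      show "norm (?e a z * F z - ?e a z * Fs k z) \<le> ?C * r k"
        unfolding right_diff_distrib[symmetric] norm_mult
        using mult_mono[OF C1 limit(3)[of z k]] C1 by simp
      fix j assume j: "j \<in> I"
      have "norm (\<i> * a j * ?e a z * F z + ?e a z * D j z - (\<i> * a j * ?e a z * Fs k z + ?e a z * Ds k j z))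
        = norm (\<i> * a j * ?e a z * (F z - Fs k z) + ?e a z * (D j z - Ds k j z))"
        by (simp add: algebra_simps)
      also have "\<dots> \<le> \<bar>a j\<bar> * r k + 1 * r k"
        by (rule norm_triangle_mono)
           (use limit(3)[of z k] limit(4)[OF j, of z k] in \<open>auto simp: norm_mult intro: mult_left_mono\<close>)
      also have "\<dots> \<le> ?C * r k"
        using mult_right_mono[OF le[OF j] r0[of k]] by (simp add: algebra_simps)
      finally show "norm (\<i> * a j * ?e a z * F z + ?e a z * D j z - (\<i> * a j * ?e a z * Fs k z + ?e a z * Ds k j z)) \<le> ?C * r k" .
    qed
  qed
next
  case (add F D F' D')
  show ?case
    by (rule trig_fun_cong[OF trig_fun.add[OF add.IH]]) (auto simp: algebra_simps)
next
  case (scale F D c)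
  show ?case
    by (rule trig_fun_cong[OF trig_fun.scale[OF scale.IH, of c]]) (auto simp: algebra_simps)
next
  case (limit Fs Ds r F D)
  obtain B where B: "\<And>z. norm (G z) \<le> B" "\<And>j z. j \<in> I \<Longrightarrow> norm (E j z) \<le> B"
    using trig_fun_bounded[OF assms(2,3)] by metis
  have B0: "B \<ge> 0" using B(1) norm_ge_zero order.trans by blast
  have r0: "r k \<ge> 0" for k using limit(3)[of undefined k] norm_ge_zero order.trans by blast
  show ?case
  proof (rule trig_fun.limit[OF limit.IH])
    show "(\<lambda>k. (2 * B) * r k) \<longlonglongrightarrow> 0" using limit(2) tendsto_mult_right_zero by blast
    fix k z
    have "norm (F z - Fs k z) * norm (G z) \<le> r k * B"
      using limit(3)[of z k] B r0 by (intro mult_mono) auto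
    also have "\<dots> \<le> (2 * B) * r k" using B0 r0[of k] by simp
    finally show "norm (F z * G z - Fs k z * G z) \<le> (2 * B) * r k"
      by (simp add: left_diff_distrib[symmetric] norm_mult)
    fix j assume j: "j \<in> I"
    have "norm (D j z * G z + F z * E j z - (Ds k j z * G z + Fs k z * E j z))
        = norm ((D j z - Ds k j z) * G z + (F z - Fs k z) * E j z)"
      by (simp add: algebra_simps)
    also have "\<dots> \<le> r k * B + r k * B"
      unfolding norm_mult[symmetric]
      by (rule norm_triangle_mono; unfold norm_mult; rule mult_mono)
         (use limit(3)[of z k] limit(4)[OF j, of z k] B(1)[of z] B(2)[OF j, of z] r0 in auto)
    finally show "norm (D j z * G z + F z * E j z - (Ds k j z * G z + Fs k z * E j z)) \<le> (2 * B) * r k"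
      by simp
  qed
qed

lemma trig_fun_power:
  assumes "trig_fun I F D" "finite I"
  shows "trig_fun I (\<lambda>z. F z ^ Suc n) (\<lambda>j z. of_nat (Suc n) * F z ^ n * D j z)"
proof (induction n)
  case 0
  show ?case using assms by simp
next
  case (Suc n)
  show ?case
    by (rule trig_fun_cong[OF trig_fun_mult[OF assms(1) Suc assms(2)]]) (auto simp: algebra_simps)
qed

text \<open>The exponential series converges uniformly because \<open>F\<close> is bounded, and the derivative of its partial
sum of order \<open>n + 1\<close> is the partial sum of order \<open>n\<close> times the gradient of \<open>F\<close>.\<close>

lemma trig_fun_exp:
  assumes F: "trig_fun I F D" and I: "finite I"
  shows "trig_fun I (\<lambda>z. exp (F z)) (\<lambda>j z. exp (F z) * D j z)"
proof -
  obtain B0 where B0: "\<And>z. norm (F z) \<le> B0" "\<And>j z. j \<in> I \<Longrightarrow> norm (D j z) \<le> B0"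
    using trig_fun_bounded[OF assms] by metis
  define B where "B = 1 + \<bar>B0\<bar>"
  have B: "norm (F z) \<le> B" "j \<in> I \<Longrightarrow> norm (D j z) \<le> B" "B \<ge> 1" for j z
    using B0(1)[of z] B0(2)[of j z] by (auto simp: B_def)
  define P where "P = (\<lambda>n w. \<Sum>k\<le>n. (w::complex) ^ k / fact k)"
  have PS: "P (Suc n) w = P n w + w ^ Suc n / fact (Suc n)" for n w by (simp add: P_def)
  have step: "trig_fun I (\<lambda>z. P (Suc n) (F z)) (\<lambda>j z. P n (F z) * D j z)" for n
  proof (induction n)
    case 0
    show ?case
      by (rule trig_fun_cong[OF trig_fun.add[OF trig_fun_const[of I 1] F]]) (auto simp: P_def)
  next
    case (Suc n)
    have f: "(fact (Suc (Suc n)) :: complex) = of_nat (Suc (Suc n)) * fact (Suc n)" by (simp only: fact_Suc)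
    have "of_nat (Suc (Suc n)) * (1 / fact (Suc (Suc n))) = (1 / fact (Suc n) :: complex)"
      unfolding f by (simp del: of_nat_Suc fact_Suc)
    moreover have "1 / c * (k * w * v) = k * (1 / c) * w * v" for c k w v :: complex
      by simp
    ultimately have *: "1 / fact (Suc (Suc n)) * (of_nat (Suc (Suc n)) * w * v) = w / fact (Suc n) * (v::complex)" for w v
      by (simp only:) simp
    show ?case
      by (rule trig_fun_cong[OF trig_fun.add[OF Suc trig_fun.scale[OF trig_fun_power[OF F I, of "Suc n"], of "1 / fact (Suc (Suc n))"]]],
          subst PS, simp del: fact_Suc, subst PS, simp only: * distrib_right)
  qed
  \<comment> \<open>\<open>B \<ge> 1\<close> lets one rate serve both for the function and for the gradient, which has an extra factor at most \<open>B\<close>.\<close>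
  define r where "r = (\<lambda>n. B * (exp B * (B * (B ^ n / fact n))))"
  have r: "r \<longlonglongrightarrow> 0"
    unfolding r_def
    by (intro tendsto_mult_right_zero) (use summable_LIMSEQ_zero[OF summable_exp[of B]] in \<open>simp add: field_simps\<close>)
  have tay: "norm (exp w - P n w) \<le> exp B * (B * (B ^ n / fact n))" if "norm w \<le> B" for n w
  proof -
    have "norm (exp w - P n w) \<le> exp \<bar>Re w\<bar> * norm w ^ Suc n / fact n"
      unfolding P_def by (rule Taylor_exp)
    also have "\<dots> \<le> exp B * B ^ Suc n / fact n"
      using that abs_Re_le_cmod[of w] by (intro divide_right_mono mult_mono power_mono) auto
    finally show ?thesis by simp
  qed
  show ?thesis
  proof (rule trig_fun.limit[OF step])
    show "(\<lambda>n. max (r (Suc n)) (r n)) \<longlonglongrightarrow> 0"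
      using tendsto_max[OF LIMSEQ_Suc[OF r] r] by simp
    fix n z
    have pos: "exp B * (B * (B ^ n / fact n)) \<ge> 0" for n using B(3) by simp
    have "norm (exp (F z) - P (Suc n) (F z)) \<le> 1 * (exp B * (B * (B ^ Suc n / fact (Suc n))))"
      using tay[OF B(1)[of z], of "Suc n"] by simp
    also have "\<dots> \<le> r (Suc n)"
      unfolding r_def using B(3) pos by (rule mult_right_mono)
    finally show "norm (exp (F z) - P (Suc n) (F z)) \<le> max (r (Suc n)) (r n)" by simp
    fix j assume j: "j \<in> I"
    have "norm (exp (F z) * D j z - P n (F z) * D j z) = norm (D j z) * norm (exp (F z) - P n (F z))"
      by (simp add: left_diff_distrib[symmetric] norm_mult)
    also have "\<dots> \<le> r n"
      unfolding r_def using B(2)[OF j, of z] tay[OF B(1)[of z], of n] B(3) by (intro mult_mono) auto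
    finally show "norm (exp (F z) * D j z - P n (F z) * D j z) \<le> max (r (Suc n)) (r n)" by simp
  qed
qed

lemma trig_fun_measurable:
  assumes "trig_fun I F D" "\<And>i. i \<in> I \<Longrightarrow> (\<lambda>\<omega>. X i \<omega>) \<in> borel_measurable M"
  shows "(\<lambda>\<omega>. F (\<lambda>i. X i \<omega>)) \<in> borel_measurable M"
    and "\<And>j. j \<in> I \<Longrightarrow> (\<lambda>\<omega>. D j (\<lambda>i. X i \<omega>)) \<in> borel_measurable M"
proof -
  have lim: "g \<in> borel_measurable M"
    if "\<And>k. (gs k) \<in> borel_measurable M" "r \<longlonglongrightarrow> 0" "\<And>k \<omega>. norm (g \<omega> - gs k \<omega>) \<le> r k"
    for g :: "_ \<Rightarrow> complex" and gs and r :: "nat \<Rightarrow> real"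
  proof (rule borel_measurable_LIMSEQ_metric[of gs])
    fix \<omega>
    have "(\<lambda>k. g \<omega> - gs k \<omega>) \<longlonglongrightarrow> 0"
      by (rule Lim_null_comparison[OF always_eventually that(2)]) (use that(3) in simp)
    from tendsto_diff[OF tendsto_const[of "g \<omega>"] this] show "(\<lambda>k. gs k \<omega>) \<longlonglongrightarrow> g \<omega>" by simp
  qed (use that in auto)
  have "(\<lambda>\<omega>. F (\<lambda>i. X i \<omega>)) \<in> borel_measurable M \<and> (\<forall>j\<in>I. (\<lambda>\<omega>. D j (\<lambda>i. X i \<omega>)) \<in> borel_measurable M)"
    using assms(1)
  proof induction
    case (character a)
    have [measurable]: "(\<lambda>\<omega>. \<Sum>i\<in>I. a i * X i \<omega>) \<in> borel_measurable M"
      using assms(2) by (intro borel_measurable_sum) auto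
    show ?case by (intro conjI ballI; measurable)
  next
    case (limit Fs Ds r F D)
    show ?case
    proof (intro conjI ballI)
      show "(\<lambda>\<omega>. F (\<lambda>i. X i \<omega>)) \<in> borel_measurable M"
        by (rule lim[where gs="\<lambda>k \<omega>. Fs k (\<lambda>i. X i \<omega>)" and r=r]) (use limit in auto)
      show "(\<lambda>\<omega>. D j (\<lambda>i. X i \<omega>)) \<in> borel_measurable M" if "j \<in> I" for j
        by (rule lim[where gs="\<lambda>k \<omega>. Ds k j (\<lambda>i. X i \<omega>)" and r=r]) (use limit that in auto)
    qed
  qed (auto intro!: borel_measurable_add borel_measurable_times)
  then show "(\<lambda>\<omega>. F (\<lambda>i. X i \<omega>)) \<in> borel_measurable M"
    and "\<And>j. j \<in> I \<Longrightarrow> (\<lambda>\<omega>. D j (\<lambda>i. X i \<omega>)) \<in> borel_measurable M" by auto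
qed

text \<open>A function of some of the coordinates is a function of all of them. This is used to regard functions of
one vector as functions of a pair of vectors.\<close>

lemma trig_fun_reindex:
  assumes "trig_fun I F D" "finite I" "finite J" "inj_on h I" "h ` I \<subseteq> J"
    and "\<And>i z. i \<in> I \<Longrightarrow> D' (h i) z = D i (\<lambda>i. z (h i))"
    and "\<And>j z. j \<in> J - h ` I \<Longrightarrow> D' j z = 0"
  shows "trig_fun J (\<lambda>z. F (\<lambda>i. z (h i))) D'"
proof -
  let ?D = "\<lambda>D j z. if j \<in> h ` I then D (the_inv_into I h j) (\<lambda>i. z (h i)) else (0::complex)"
  have "trig_fun J (\<lambda>z. F (\<lambda>i. z (h i))) (?D D)"
    using assms(1)
  proof induction
    case (character a)
    let ?b = "\<lambda>j. if j \<in> h ` I then a (the_inv_into I h j) else 0"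
    have *: "(\<Sum>j\<in>J. ?b j * z j) = (\<Sum>i\<in>I. a i * z (h i))" for z :: "_ \<Rightarrow> real"
    proof -
      have "(\<Sum>j\<in>J. ?b j * z j) = (\<Sum>j\<in>h ` I. ?b j * z j)"
        using assms by (intro sum.mono_neutral_right) auto
      also have "\<dots> = (\<Sum>i\<in>I. a i * z (h i))"
        using assms(4) by (auto simp: sum.reindex the_inv_into_f_f intro!: sum.cong)
      finally show ?thesis .
    qed
    show ?case
      by (rule trig_fun_cong[OF trig_fun.character[of J ?b]]) (unfold *, auto)
  next
    case (add F D G E)
    show ?case by (rule trig_fun_cong[OF trig_fun.add[OF add.IH]]) auto
  next
    case (scale F D c)
    show ?case by (rule trig_fun_cong[OF trig_fun.scale[OF scale.IH, of c]]) auto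
  next
    case (limit Fs Ds r F D)
    have r0: "r k \<ge> 0" for k using limit(3)[of undefined k] norm_ge_zero order.trans by blast
    show ?case
      by (rule trig_fun.limit[OF limit.IH limit(2)])
         (use limit(3,4) r0 the_inv_into_into[OF assms(4) _ subset_refl] in auto)
  qed
  then show ?thesis
    by (rule trig_fun_cong) (use assms(4,6,7) the_inv_into_f_f in \<open>auto simp: the_inv_into_f_f\<close>)
qed

section \<open>The Gaussian covariance identity\<close>

text \<open>Limits of integrals are needed for integrands whose continuity is not at hand, so the limit function is
first shown to be integrable by uniform approximation.\<close>

lemma has_integral_uniform_limit:
  fixes h :: "real \<Rightarrow> complex"
  assumes "\<And>k. (hs k has_integral c k) {0..1}" "r \<longlonglongrightarrow> 0" "c \<longlonglongrightarrow> l"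
    and "\<And>k x. x \<in> {0..1} \<Longrightarrow> norm (h x - hs k x) \<le> r k"
  shows "(h has_integral l) {0..1}"
proof -
  have "h integrable_on cbox 0 1"
  proof (rule integrable_uniform_limit)
    fix e :: real assume "e > 0"
    then obtain k where "r k < e"
      using assms(2) by (auto simp: LIMSEQ_def dist_real_def) (metis abs_less_iff order_refl)
    then have "norm (h x - hs k x) \<le> e" if "x \<in> {0..1}" for x
      using assms(4)[OF that, of k] by linarith
    then show "\<exists>g. (\<forall>x\<in>cbox 0 1. norm (h x - g x) \<le> e) \<and> g integrable_on cbox 0 1"
      using assms(1)[of k] by (intro exI[of _ "hs k"]) (auto simp: integrable_on_def)
  qed
  then obtain i where i: "(h has_integral i) {0..1}" by (auto simp: integrable_on_def)
  have "norm (i - c k) \<le> r k" for k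
  proof -
    have "((\<lambda>x. h x - hs k x) has_integral (i - c k)) (cbox 0 1)"
      using has_integral_diff[OF i assms(1)[of k]] by simp
    moreover have "0 \<le> r k" using assms(4)[of 0 k] norm_ge_zero[of "h 0 - hs k 0"] order.trans by (metis atLeastAtMost_iff order_refl zero_le_one)
    ultimately show ?thesis
      using has_integral_bound[of "r k" "\<lambda>x. h x - hs k x" "i - c k" 0 1] assms(4)[of _ k] by simp
  qed
  then have "(\<lambda>k. i - c k) \<longlonglongrightarrow> 0"
    by (intro Lim_null_comparison[OF always_eventually assms(2)]) simp
  from tendsto_diff[OF tendsto_const[of i] this] have "c \<longlonglongrightarrow> i" by simp
  then show ?thesis using i assms(3) LIMSEQ_unique by blast
qed

lemma has_integral_norm_le:
  fixes f :: "real \<Rightarrow> complex"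
  assumes "(f has_integral c) {0..1}" "\<And>x. x \<in> {0..1} \<Longrightarrow> norm (f x) \<le> B"
  shows "norm c \<le> B"
proof -
  have "0 \<le> B" using assms(2)[of 0] norm_ge_zero[of "f 0"] by (simp del: norm_ge_zero)
  then show ?thesis using has_integral_bound[of B f c 0 1] assms by simp
qed

lemma (in prob_space) integrable_bounded:
  fixes f :: "'a \<Rightarrow> 'b::{banach, second_countable_topology}"
  assumes "f \<in> borel_measurable M" "\<And>x. norm (f x) \<le> B"
  shows "integrable M f"
  using assms by (intro integrable_const_bound[of _ B]) auto

lemma (in prob_space) norm_integral_le:
  fixes f :: "'a \<Rightarrow> 'b::{banach, second_countable_topology}"
  assumes "f \<in> borel_measurable M" "\<And>x. norm (f x) \<le> B"
  shows "norm (integral\<^sup>L M f) \<le> B"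
proof -
  have "norm (integral\<^sup>L M f) \<le> (\<integral>x. B \<partial>M)"
    using integrable_bounded[OF assms] assms(2)
    by (intro order.trans[OF integral_norm_bound] integral_mono) auto
  then show ?thesis by (simp add: prob_space)
qed

lemma integrable_dominated:
  fixes f g :: "'a \<Rightarrow> real"
  assumes "integrable M g" "f \<in> borel_measurable M" "\<And>x. 0 \<le> f x" "\<And>x. f x \<le> g x"
  shows "integrable M f"
proof (rule Bochner_Integration.integrable_bound[OF assms(1,2)])
  have "norm (f x) \<le> norm (g x)" for x using assms(3)[of x] assms(4)[of x] by simp
  then show "AE x in M. norm (f x) \<le> norm (g x)" by simp
qed

text \<open>The covariance identity is linear in each of its two functions. This lemma extends an identity that is
linear in the pair \<open>(F, D)\<close> from characters to the whole class; it is applied once for each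
function, with the other function hidden in the weights \<open>v\<close> and \<open>w\<close>.\<close>

lemma trig_fun_has_integral_extend:
  fixes U :: "real \<Rightarrow> 'i \<Rightarrow> 'b \<Rightarrow> real" and w :: "real \<Rightarrow> 'i \<Rightarrow> 'b \<Rightarrow> complex"
  assumes "prob_space M" "prob_space N" and I: "finite I"
    and X: "\<And>i. i \<in> I \<Longrightarrow> X i \<in> borel_measurable M"
    and U: "\<And>i \<rho>. i \<in> I \<Longrightarrow> U \<rho> i \<in> borel_measurable N"
    and v: "v \<in> borel_measurable M" "\<And>\<omega>. norm (v \<omega>) \<le> B"
    and w: "\<And>i \<rho>. i \<in> I \<Longrightarrow> w \<rho> i \<in> borel_measurable N" "\<And>i \<rho> p. i \<in> I \<Longrightarrow> norm (w \<rho> i p) \<le> B"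
    and base: "\<And>a. ((\<lambda>\<rho>. \<integral>p. (\<Sum>j\<in>I. \<i> * complex_of_real (a j) * iexp (\<Sum>i\<in>I. a i * U \<rho> i p) * w \<rho> j p) \<partial>N)
       has_integral (\<integral>\<omega>. iexp (\<Sum>i\<in>I. a i * X i \<omega>) * v \<omega> \<partial>M)) {0..1}"
    and F: "trig_fun I F D"
  shows "((\<lambda>\<rho>. \<integral>p. (\<Sum>j\<in>I. D j (\<lambda>i. U \<rho> i p) * w \<rho> j p) \<partial>N)
       has_integral (\<integral>\<omega>. F (\<lambda>i. X i \<omega>) * v \<omega> \<partial>M)) {0..1}"
  using F
proof induction
  interpret M: prob_space M by fact
  interpret N: prob_space N by fact
  have meas [measurable]: "(\<lambda>\<omega>. F (\<lambda>i. X i \<omega>)) \<in> borel_measurable M"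
     "j \<in> I \<Longrightarrow> (\<lambda>p. D j (\<lambda>i. U \<rho> i p)) \<in> borel_measurable N" if ft: "trig_fun I F D" for F D \<rho> j
    using trig_fun_measurable[OF ft, of X M] trig_fun_measurable[OF ft, of "U \<rho>" N] X U by auto
  note [measurable] = v(1) w(1)
  have i1: "integrable M (\<lambda>\<omega>. F (\<lambda>i. X i \<omega>) * v \<omega>)" if ft: "trig_fun I F D" for F D
  proof -
    obtain C where C: "\<And>z. norm (F z) \<le> C" using trig_fun_bounded[OF ft I] by metis
    have "C \<ge> 0" using C norm_ge_zero order.trans by blast
    then show ?thesis using meas[OF ft] C v
      by (intro M.integrable_bounded[of _ "C * B"]) (auto simp: norm_mult intro!: mult_mono)
  qed
  have i2: "integrable N (\<lambda>p. (\<Sum>j\<in>I. D j (\<lambda>i. U \<rho> i p) * w \<rho> j p))" if ft: "trig_fun I F D" for F D \<rho>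
  proof (intro Bochner_Integration.integrable_sum)
    fix j assume j: "j \<in> I"
    obtain C where C: "\<And>z. norm (D j z) \<le> C" using trig_fun_bounded[OF ft I] j by metis
    have "C \<ge> 0" using C norm_ge_zero order.trans by blast
    then show "integrable N (\<lambda>p. D j (\<lambda>i. U \<rho> i p) * w \<rho> j p)"
      using meas(2)[OF ft j] C w(1)[OF j] w(2)[OF j]
      by (intro N.integrable_bounded[of _ "C * B"]) (auto simp: norm_mult intro!: mult_mono)
  qed
  {
    case (character a)
    then show ?case by (rule base)
  next
    case (add F D G E)
    show ?case
      using has_integral_add[OF add.IH] i1[OF add.hyps(1)] i1[OF add.hyps(2)] i2[OF add.hyps(1)] i2[OF add.hyps(2)]
      by (simp add: distrib_right sum.distrib)
  next
    case (scale F D c)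
    show ?case
      using has_integral_mult_right[OF scale.IH, of c]
      by (simp add: mult.assoc sum_distrib_left[symmetric])
  next
    case (limit Fs Ds r F D)
    have FD: "trig_fun I F D" by (rule trig_fun.limit[OF limit(1,2,3,4)])
    have r0: "r k \<ge> 0" for k using limit(3)[of undefined k] norm_ge_zero order.trans by blast
    have B0: "B \<ge> 0" using v(2) norm_ge_zero order.trans by blast
    have d1: "norm ((\<integral>\<omega>. F (\<lambda>i. X i \<omega>) * v \<omega> \<partial>M) - (\<integral>\<omega>. Fs k (\<lambda>i. X i \<omega>) * v \<omega> \<partial>M)) \<le> r k * B" for k
    proof -
      have "(\<integral>\<omega>. F (\<lambda>i. X i \<omega>) * v \<omega> \<partial>M) - (\<integral>\<omega>. Fs k (\<lambda>i. X i \<omega>) * v \<omega> \<partial>M)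
        = (\<integral>\<omega>. (F (\<lambda>i. X i \<omega>) - Fs k (\<lambda>i. X i \<omega>)) * v \<omega> \<partial>M)"
        using i1[OF FD] i1[OF limit.hyps(1)[of k]] by (simp add: left_diff_distrib)
      also have "norm \<dots> \<le> r k * B"
        using meas(1)[OF FD] meas(1)[OF limit.hyps(1)[of k]] limit(3) v r0
        by (intro M.norm_integral_le) (auto simp: norm_mult intro!: mult_mono)
      finally show ?thesis .
    qed
    have d2: "norm ((\<integral>p. (\<Sum>j\<in>I. D j (\<lambda>i. U \<rho> i p) * w \<rho> j p) \<partial>N)
       - (\<integral>p. (\<Sum>j\<in>I. Ds k j (\<lambda>i. U \<rho> i p) * w \<rho> j p) \<partial>N)) \<le> r k * (card I * B)" for k \<rho>
    proof -
      have "(\<integral>p. (\<Sum>j\<in>I. D j (\<lambda>i. U \<rho> i p) * w \<rho> j p) \<partial>N)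
       - (\<integral>p. (\<Sum>j\<in>I. Ds k j (\<lambda>i. U \<rho> i p) * w \<rho> j p) \<partial>N)
        = (\<integral>p. (\<Sum>j\<in>I. (D j (\<lambda>i. U \<rho> i p) - Ds k j (\<lambda>i. U \<rho> i p)) * w \<rho> j p) \<partial>N)"
        using i2[OF FD] i2[OF limit.hyps(1)[of k]] by (simp add: left_diff_distrib sum_subtractf)
      also have "norm \<dots> \<le> r k * (card I * B)"
      proof (intro N.norm_integral_le)
        show "(\<lambda>p. \<Sum>j\<in>I. (D j (\<lambda>i. U \<rho> i p) - Ds k j (\<lambda>i. U \<rho> i p)) * w \<rho> j p) \<in> borel_measurable N"
          using meas(2)[OF FD] meas(2)[OF limit.hyps(1)[of k]] w(1)
          by (intro borel_measurable_sum borel_measurable_times borel_measurable_diff) auto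
        fix p
        have "norm (\<Sum>j\<in>I. (D j (\<lambda>i. U \<rho> i p) - Ds k j (\<lambda>i. U \<rho> i p)) * w \<rho> j p) \<le> (\<Sum>j\<in>I. r k * B)"
          using limit(4) w(2) r0 by (intro sum_norm_le) (auto simp: norm_mult intro!: mult_mono)
        then show "norm (\<Sum>j\<in>I. (D j (\<lambda>i. U \<rho> i p) - Ds k j (\<lambda>i. U \<rho> i p)) * w \<rho> j p) \<le> r k * (card I * B)"
          by (simp add: mult_ac)
      qed
      finally show ?thesis .
    qed
    show ?case
    proof (rule has_integral_uniform_limit[OF limit.IH])
      show "(\<lambda>k. r k * (card I * B)) \<longlonglongrightarrow> 0" using limit(2) by (rule tendsto_mult_left_zero)
      have "(\<lambda>k. (\<integral>\<omega>. F (\<lambda>i. X i \<omega>) * v \<omega> \<partial>M) - (\<integral>\<omega>. Fs k (\<lambda>i. X i \<omega>) * v \<omega> \<partial>M)) \<longlonglongrightarrow> 0"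
        by (rule Lim_null_comparison[OF always_eventually tendsto_mult_left_zero[OF limit(2), of B]])
           (use d1 in simp)
      then show "(\<lambda>k. \<integral>\<omega>. Fs k (\<lambda>i. X i \<omega>) * v \<omega> \<partial>M) \<longlonglongrightarrow> (\<integral>\<omega>. F (\<lambda>i. X i \<omega>) * v \<omega> \<partial>M)"
        using tendsto_diff[OF tendsto_const[of "\<integral>\<omega>. F (\<lambda>i. X i \<omega>) * v \<omega> \<partial>M"]]
        by (fastforce simp: add_diff_cancel)
    qed (use d2 in auto)
  }
qed

text \<open>The copy \<open>Z\<^sup>\<rho>\<close>: on the product space the first factor carries \<open>Z\<close> and the second one its independent copy.\<close>

definition corr_copy :: "real \<Rightarrow> ('i \<Rightarrow> 'a \<Rightarrow> real) \<Rightarrow> 'i \<Rightarrow> 'a \<times> 'a \<Rightarrow> real" where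
  "corr_copy \<rho> X i p = \<rho> * X i (fst p) + sqrt (1 - \<rho>\<^sup>2) * X i (snd p)"

definition bilin :: "'i set \<Rightarrow> ('i \<Rightarrow> 'i \<Rightarrow> real) \<Rightarrow> ('i \<Rightarrow> real) \<Rightarrow> ('i \<Rightarrow> real) \<Rightarrow> real" where
  "bilin I K a b = (\<Sum>i\<in>I. \<Sum>j\<in>I. a i * b j * K i j)"

lemma bilin_add_left: "bilin I K (\<lambda>i. a i + b i) c = bilin I K a c + bilin I K b c"
  and bilin_add_right: "bilin I K c (\<lambda>i. a i + b i) = bilin I K c a + bilin I K c b"
  and bilin_scale_left: "bilin I K (\<lambda>i. t * a i) b = t * bilin I K a b"
  and bilin_scale_right: "bilin I K a (\<lambda>i. t * b i) = t * bilin I K a b"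
  unfolding bilin_def
  by (simp_all add: distrib_left distrib_right sum.distrib sum_distrib_left mult_ac)

text \<open>Centred jointly Gaussian vectors, given by their characteristic function; degenerate covariance matrices are
included. This form of the definition is all that a calculus based on characters uses.\<close>

locale gaussian_family = prob_space M for M :: "'a measure" +
  fixes I :: "'i set" and X :: "'i \<Rightarrow> 'a \<Rightarrow> real" and K :: "'i \<Rightarrow> 'i \<Rightarrow> real"
  assumes finite_I: "finite I"
    and X_meas: "i \<in> I \<Longrightarrow> X i \<in> borel_measurable M"
    and K_sym: "i \<in> I \<Longrightarrow> j \<in> I \<Longrightarrow> K i j = K j i"
    and char_fun: "(\<integral>\<omega>. iexp (\<Sum>i\<in>I. a i * X i \<omega>) \<partial>M) = complex_of_real (exp (- bilin I K a a / 2))"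
begin

lemma bilin_commute: "bilin I K a b = bilin I K b a"
  unfolding bilin_def by (subst sum.swap) (auto intro!: sum.cong simp: K_sym mult_ac)

lemma lin_meas [measurable]: "(\<lambda>\<omega>. \<Sum>i\<in>I. a i * X i \<omega>) \<in> borel_measurable M"
  using X_meas by (intro borel_measurable_sum) auto

lemma iexp_meas: "(\<lambda>\<omega>. iexp (\<Sum>i\<in>I. a i * X i \<omega>)) \<in> borel_measurable M"
  using measurable_compose[OF lin_meas[of a], of "\<lambda>x. iexp x" borel] by simp

sublocale pair: prob_space "M \<Otimes>\<^sub>M M"
  by (rule prob_space_pair) (rule prob_space_axioms)+

lemma fst_meas: "i \<in> I \<Longrightarrow> (\<lambda>p. X i (fst p)) \<in> borel_measurable (M \<Otimes>\<^sub>M M)"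
  and snd_meas: "i \<in> I \<Longrightarrow> (\<lambda>p. X i (snd p)) \<in> borel_measurable (M \<Otimes>\<^sub>M M)"
  using X_meas by (auto intro: measurable_compose[OF measurable_fst] measurable_compose[OF measurable_snd])

lemma corr_copy_meas: "i \<in> I \<Longrightarrow> corr_copy \<rho> X i \<in> borel_measurable (M \<Otimes>\<^sub>M M)"
  unfolding corr_copy_def using fst_meas snd_meas by simp

lemma pair_char_fun:
  assumes "0 \<le> \<rho>" "\<rho> \<le> 1"
  shows "(\<integral>p. iexp ((\<Sum>i\<in>I. a i * X i (fst p)) + (\<Sum>i\<in>I. b i * corr_copy \<rho> X i p)) \<partial>(M \<Otimes>\<^sub>M M))
    = complex_of_real (exp (- (bilin I K a a + bilin I K b b) / 2 - \<rho> * bilin I K a b))"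
proof -
  interpret P: pair_prob_space M M by unfold_locales
  define s where "s = sqrt (1 - \<rho>\<^sup>2)"
  have s: "s * s = 1 - \<rho>\<^sup>2" using assms by (simp add: s_def abs_square_le_1)
  let ?f = "\<lambda>\<omega>. iexp (\<Sum>i\<in>I. (a i + \<rho> * b i) * X i \<omega>)" and ?g = "\<lambda>\<omega>. iexp (\<Sum>i\<in>I. (s * b i) * X i \<omega>)"
  have eq: "iexp ((\<Sum>i\<in>I. a i * X i (fst p)) + (\<Sum>i\<in>I. b i * corr_copy \<rho> X i p)) = ?f (fst p) * ?g (snd p)" for p
  proof -
    have "(\<Sum>i\<in>I. a i * X i (fst p)) + (\<Sum>i\<in>I. b i * corr_copy \<rho> X i p)
      = (\<Sum>i\<in>I. (a i + \<rho> * b i) * X i (fst p)) + (\<Sum>i\<in>I. (s * b i) * X i (snd p))"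
      by (simp add: corr_copy_def s_def sum.distrib algebra_simps)
    then show ?thesis by (simp only: of_real_add distrib_left exp_add)
  qed
  have "(\<integral>p. ?f (fst p) * ?g (snd p) \<partial>(M \<Otimes>\<^sub>M M)) = (\<integral>x. (\<integral>y. ?f (fst (x, y)) * ?g (snd (x, y)) \<partial>M) \<partial>M)"
    by (rule P.integral_fst'[symmetric], rule pair.integrable_bounded[of _ 1], measurable)
       (simp add: norm_mult del: of_real_sum of_real_mult)
  also have "\<dots> = (\<integral>x. ?f x \<partial>M) * (\<integral>y. ?g y \<partial>M)" by simp
  also have "\<dots> = complex_of_real (exp (- bilin I K (\<lambda>i. a i + \<rho> * b i) (\<lambda>i. a i + \<rho> * b i) / 2
      - bilin I K (\<lambda>i. s * b i) (\<lambda>i. s * b i) / 2))"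
    unfolding char_fun of_real_mult[symmetric] exp_add[symmetric] by simp
  also have "- bilin I K (\<lambda>i. a i + \<rho> * b i) (\<lambda>i. a i + \<rho> * b i) / 2 - bilin I K (\<lambda>i. s * b i) (\<lambda>i. s * b i) / 2
    = - (bilin I K a a + bilin I K b b) / 2 - \<rho> * bilin I K a b"
  proof -
    have "bilin I K (\<lambda>i. s * b i) (\<lambda>i. s * b i) = (1 - \<rho>\<^sup>2) * bilin I K b b"
      unfolding bilin_scale_left bilin_scale_right mult.assoc[symmetric] s ..
    moreover have "bilin I K (\<lambda>i. a i + \<rho> * b i) (\<lambda>i. a i + \<rho> * b i)
      = bilin I K a a + 2 * \<rho> * bilin I K a b + \<rho>\<^sup>2 * bilin I K b b"
      unfolding bilin_add_left bilin_add_right bilin_scale_left bilin_scale_right bilin_commute[of b a]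
      by (simp add: power2_eq_square algebra_simps)
    ultimately show ?thesis by (simp add: field_simps)
  qed
  finally show ?thesis unfolding eq .
qed

text \<open>The pair \<open>(Z, Z\<^sup>\<rho>)\<close> is again Gaussian, so that results about one vector also apply to functions of both.\<close>

lemma doubled:
  assumes "0 \<le> \<rho>" "\<rho> \<le> 1"
  shows "gaussian_family (M \<Otimes>\<^sub>M M) (I <+> I) (case_sum (\<lambda>i p. X i (fst p)) (corr_copy \<rho> X))
     (\<lambda>p q. case (p, q) of (Inl i, Inl j) \<Rightarrow> K i j | (Inr i, Inr j) \<Rightarrow> K i j
        | (Inl i, Inr j) \<Rightarrow> \<rho> * K i j | (Inr i, Inl j) \<Rightarrow> \<rho> * K i j)"
    (is "gaussian_family _ _ _ ?K")
proof
  show "finite (I <+> I)" using finite_I by simp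
next
  fix i assume "i \<in> I <+> I"
  then show "case_sum (\<lambda>i p. X i (fst p)) (corr_copy \<rho> X) i \<in> borel_measurable (M \<Otimes>\<^sub>M M)"
    using fst_meas corr_copy_meas by auto
next
  fix i j assume "i \<in> I <+> I" "j \<in> I <+> I"
  then show "?K i j = ?K j i" by (auto simp: K_sym)
next
  fix a
  have "bilin (I <+> I) ?K a a = bilin I K (\<lambda>i. a (Inl i)) (\<lambda>i. a (Inl i)) + bilin I K (\<lambda>i. a (Inr i)) (\<lambda>i. a (Inr i))
     + \<rho> * bilin I K (\<lambda>i. a (Inl i)) (\<lambda>i. a (Inr i)) + \<rho> * bilin I K (\<lambda>i. a (Inr i)) (\<lambda>i. a (Inl i))"
    using finite_I unfolding bilin_def
    by (simp add: sum.Plus sum.distrib sum_distrib_left algebra_simps)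
  also have "bilin I K (\<lambda>i. a (Inr i)) (\<lambda>i. a (Inl i)) = bilin I K (\<lambda>i. a (Inl i)) (\<lambda>i. a (Inr i))" by (rule bilin_commute)
  finally have q: "- bilin (I <+> I) ?K a a / 2 = - (bilin I K (\<lambda>i. a (Inl i)) (\<lambda>i. a (Inl i)) + bilin I K (\<lambda>i. a (Inr i)) (\<lambda>i. a (Inr i))) / 2
     - \<rho> * bilin I K (\<lambda>i. a (Inl i)) (\<lambda>i. a (Inr i))" by (simp add: field_simps)
  show "(\<integral>\<omega>. iexp (\<Sum>i\<in>I <+> I. a i * case_sum (\<lambda>i p. X i (fst p)) (corr_copy \<rho> X) i \<omega>) \<partial>(M \<Otimes>\<^sub>M M))
     = complex_of_real (exp (- bilin (I <+> I) ?K a a / 2))"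
    unfolding q pair_char_fun[OF assms, symmetric] using finite_I by (simp add: sum.Plus)
qed

text \<open>For characters with frequencies \<open>a\<close> and \<open>b\<close>, the integrand is \<open>- q exp(c - \<rho> q)\<close> with \<open>q = a\<cdot>Kb\<close>, because the
derivatives bring down the factor \<open>i a\<^sub>i * i b\<^sub>j\<close> and \<open>Z\<close>, \<open>Z\<^sup>\<rho>\<close> have correlation \<open>\<rho>\<close>. This is the derivative of \<open>exp(c - \<rho> q)\<close>,
which is the expectation of the product at \<open>\<rho> = 1\<close> and the product of the expectations at \<open>\<rho> = 0\<close>.\<close>

lemma covariance_character:
  "((\<lambda>\<rho>. \<integral>p. (\<Sum>j\<in>I. \<i> * complex_of_real (b j) * iexp (\<Sum>i\<in>I. b i * corr_copy \<rho> X i p) *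
        (\<Sum>i\<in>I. complex_of_real (K i j) * (\<i> * complex_of_real (a i) * iexp (\<Sum>i\<in>I. a i * X i (fst p))))) \<partial>(M \<Otimes>\<^sub>M M))
    has_integral (\<integral>\<omega>. iexp (\<Sum>i\<in>I. b i * X i \<omega>) *
       (iexp (\<Sum>i\<in>I. a i * X i \<omega>) - (\<integral>\<omega>. iexp (\<Sum>i\<in>I. a i * X i \<omega>) \<partial>M)) \<partial>M)) {0..1}"
proof -
  let ?q = "bilin I K a b" and ?c = "- (bilin I K a a + bilin I K b b) / 2"
  let ?ea = "\<lambda>\<omega>. iexp (\<Sum>i\<in>I. a i * X i \<omega>)" and ?eb = "\<lambda>\<omega>. iexp (\<Sum>i\<in>I. b i * X i \<omega>)"
  have h1: "((\<lambda>\<rho>. complex_of_real (- ?q * exp (?c - \<rho> * ?q))) has_integral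
      complex_of_real (exp (?c - 1 * ?q)) - complex_of_real (exp (?c - 0 * ?q))) {0..1}"
    by (rule fundamental_theorem_of_calculus)
       (auto intro!: derivative_eq_intros has_vector_derivative_of_real simp: has_real_derivative_iff_has_vector_derivative[symmetric])
  have h2: "(\<integral>p. (\<Sum>j\<in>I. \<i> * complex_of_real (b j) * iexp (\<Sum>i\<in>I. b i * corr_copy \<rho> X i p) *
        (\<Sum>i\<in>I. complex_of_real (K i j) * (\<i> * complex_of_real (a i) * ?ea (fst p)))) \<partial>(M \<Otimes>\<^sub>M M))
     = complex_of_real (- ?q * exp (?c - \<rho> * ?q))" if "\<rho> \<in> {0..1}" for \<rho>
  proof -
    have "(\<Sum>j\<in>I. \<i> * complex_of_real (b j) * iexp (\<Sum>i\<in>I. b i * corr_copy \<rho> X i p) *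
        (\<Sum>i\<in>I. complex_of_real (K i j) * (\<i> * complex_of_real (a i) * ?ea (fst p))))
      = - complex_of_real ?q * iexp ((\<Sum>i\<in>I. a i * X i (fst p)) + (\<Sum>i\<in>I. b i * corr_copy \<rho> X i p))" for p
    proof -
      have "(\<Sum>j\<in>I. \<i> * complex_of_real (b j) * iexp (\<Sum>i\<in>I. b i * corr_copy \<rho> X i p) *
        (\<Sum>i\<in>I. complex_of_real (K i j) * (\<i> * complex_of_real (a i) * ?ea (fst p))))
        = (\<Sum>j\<in>I. \<Sum>i\<in>I. - complex_of_real (a i * b j * K i j) * (?ea (fst p) * iexp (\<Sum>i\<in>I. b i * corr_copy \<rho> X i p)))"
        by (simp add: sum_distrib_left algebra_simps)
      also have "\<dots> = - complex_of_real (\<Sum>j\<in>I. \<Sum>i\<in>I. a i * b j * K i j) * (?ea (fst p) * iexp (\<Sum>i\<in>I. b i * corr_copy \<rho> X i p))"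
        by (simp only: sum_distrib_right sum_negf of_real_sum of_real_minus minus_mult_left[symmetric])
      also have "(\<Sum>j\<in>I. \<Sum>i\<in>I. a i * b j * K i j) = ?q" unfolding bilin_def by (rule sum.swap)
      finally show ?thesis by (simp only: of_real_add distrib_left exp_add)
    qed
    note e = this
    have "(\<integral>p. (\<Sum>j\<in>I. \<i> * complex_of_real (b j) * iexp (\<Sum>i\<in>I. b i * corr_copy \<rho> X i p) *
        (\<Sum>i\<in>I. complex_of_real (K i j) * (\<i> * complex_of_real (a i) * ?ea (fst p)))) \<partial>(M \<Otimes>\<^sub>M M))
      = (\<integral>p. - complex_of_real ?q * iexp ((\<Sum>i\<in>I. a i * X i (fst p)) + (\<Sum>i\<in>I. b i * corr_copy \<rho> X i p)) \<partial>(M \<Otimes>\<^sub>M M))"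
      by (simp only: e)
    also have "\<dots> = - complex_of_real ?q * (\<integral>p. iexp ((\<Sum>i\<in>I. a i * X i (fst p)) + (\<Sum>i\<in>I. b i * corr_copy \<rho> X i p)) \<partial>(M \<Otimes>\<^sub>M M))"
      by (rule integral_mult_right_zero)
    also have "\<dots> = complex_of_real (- ?q * exp (?c - \<rho> * ?q))"
      using pair_char_fun[of \<rho> a b] that by simp
    finally show ?thesis .
  qed
  have h3: "complex_of_real (exp (?c - 1 * ?q)) - complex_of_real (exp (?c - 0 * ?q))
    = (\<integral>\<omega>. ?eb \<omega> * (?ea \<omega> - (\<integral>\<omega>. ?ea \<omega> \<partial>M)) \<partial>M)"
  proof -
    have "integrable M ?eb"
      by (rule integrable_bounded[of _ 1, OF iexp_meas]) (simp del: of_real_sum of_real_mult)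
    then have i: "integrable M (\<lambda>\<omega>. ?eb \<omega> * (\<integral>\<omega>. ?ea \<omega> \<partial>M))" by simp
    have i': "integrable M (\<lambda>\<omega>. ?eb \<omega> * ?ea \<omega>)"
      by (rule integrable_bounded[of _ 1, OF borel_measurable_times[OF iexp_meas iexp_meas]])
         (simp add: norm_mult del: of_real_sum of_real_mult)
    have "(\<integral>\<omega>. ?eb \<omega> * (?ea \<omega> - (\<integral>\<omega>. ?ea \<omega> \<partial>M)) \<partial>M) = (\<integral>\<omega>. ?eb \<omega> * ?ea \<omega> \<partial>M) - (\<integral>\<omega>. ?eb \<omega> \<partial>M) * (\<integral>\<omega>. ?ea \<omega> \<partial>M)"
      using i i' by (simp add: right_diff_distrib del: of_real_sum of_real_mult)
    also have "(\<lambda>\<omega>. ?eb \<omega> * ?ea \<omega>) = (\<lambda>\<omega>. iexp (\<Sum>i\<in>I. (a i + b i) * X i \<omega>))"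
      by (simp only: distrib_right sum.distrib of_real_add distrib_left exp_add mult.commute)
    also have "bilin I K (\<lambda>i. a i + b i) (\<lambda>i. a i + b i) = bilin I K a a + bilin I K b b + 2 * ?q"
      unfolding bilin_add_left bilin_add_right bilin_commute[of b a] by simp
    then have "(\<integral>\<omega>. iexp (\<Sum>i\<in>I. (a i + b i) * X i \<omega>) \<partial>M) = complex_of_real (exp (?c - 1 * ?q))"
      unfolding char_fun by (simp add: field_simps)
    also have "(\<integral>\<omega>. ?eb \<omega> \<partial>M) * (\<integral>\<omega>. ?ea \<omega> \<partial>M) = complex_of_real (exp (?c - 0 * ?q))"
      unfolding char_fun of_real_mult[symmetric] exp_add[symmetric] by (simp add: field_simps)
    finally show ?thesis by simp
  qed
  show ?thesis
    unfolding h3[symmetric] by (rule has_integral_eq[OF h2[symmetric] h1])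
qed

text \<open>The gradients are formal, so no integration by parts takes place: the identity is an algebraic fact about characters that is
extended first in \<open>G\<close> and then in \<open>F\<close>. In between, the symmetry of \<open>K\<close> lets the two functions change places.\<close>

lemma covariance_identity:
  assumes F: "trig_fun I F DF" and G: "trig_fun I G DG"
  shows "((\<lambda>\<rho>. \<integral>p. (\<Sum>i\<in>I. \<Sum>j\<in>I. complex_of_real (K i j) * DF i (\<lambda>i. X i (fst p)) * DG j (\<lambda>i. corr_copy \<rho> X i p)) \<partial>(M \<Otimes>\<^sub>M M))
    has_integral ((\<integral>\<omega>. F (\<lambda>i. X i \<omega>) * G (\<lambda>i. X i \<omega>) \<partial>M) - (\<integral>\<omega>. F (\<lambda>i. X i \<omega>) \<partial>M) * (\<integral>\<omega>. G (\<lambda>i. X i \<omega>) \<partial>M))) {0..1}"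
proof -
  have trig_int: "integrable M (\<lambda>\<omega>. F (\<lambda>i. X i \<omega>))" if ft: "trig_fun I F D" for F D
  proof -
    obtain B where "\<And>z. norm (F z) \<le> B" using trig_fun_bounded[OF ft finite_I] by metis
    then show ?thesis by (intro integrable_bounded[OF trig_fun_measurable(1)[OF ft X_meas]]) auto
  qed
  have wm: "(\<lambda>p. \<Sum>i\<in>I. complex_of_real (c i j) * DF i (\<lambda>i. Y i p)) \<in> borel_measurable N"
    if "trig_fun I F DF" "\<And>i. i \<in> I \<Longrightarrow> Y i \<in> borel_measurable N" for F DF Y c j and N :: "'b measure"
    using trig_fun_measurable(2)[OF that(1), of Y N] that(2) by (intro borel_measurable_sum) auto
  have wb: "\<exists>B. \<forall>z. \<forall>j\<in>I. norm (\<Sum>i\<in>I. complex_of_real (K i j) * DF i z) \<le> B \<and> norm (F z - e) \<le> B" if ft: "trig_fun I F DF" for F DF e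
  proof -
    obtain C where C: "\<And>z. norm (F z) \<le> C" "\<And>z j. j \<in> I \<Longrightarrow> norm (DF j z) \<le> C"
      using trig_fun_bounded[OF ft finite_I] by metis
    have C0: "C \<ge> 0" using C norm_ge_zero order.trans by blast
    let ?S = "\<Sum>j\<in>I. \<Sum>i\<in>I. \<bar>K i j\<bar> * C"
    have "norm (\<Sum>i\<in>I. complex_of_real (K i j) * DF i z) \<le> ?S" if "j \<in> I" for j z
    proof -
      have "norm (\<Sum>i\<in>I. complex_of_real (K i j) * DF i z) \<le> (\<Sum>i\<in>I. \<bar>K i j\<bar> * C)"
        using C by (intro sum_norm_le) (auto simp: norm_mult mult_left_mono)
      also have "\<dots> \<le> ?S" using that finite_I C0 by (intro member_le_sum) (auto intro!: sum_nonneg)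
      finally show ?thesis .
    qed
    moreover have "norm (F z - e) \<le> C + norm e" for z
      using C(1)[of z] norm_triangle_ineq4[of "F z" e] by linarith
    ultimately show ?thesis
      by (intro exI[of _ "max ?S (C + norm e)"]) (auto simp: le_max_iff_disj)
  qed
  have step1: "((\<lambda>\<rho>. \<integral>p. (\<Sum>j\<in>I. DG j (\<lambda>i. corr_copy \<rho> X i p) * (\<Sum>i\<in>I. complex_of_real (K i j) * (\<i> * complex_of_real (a i) * iexp (\<Sum>i\<in>I. a i * X i (fst p))))) \<partial>(M \<Otimes>\<^sub>M M))
    has_integral (\<integral>\<omega>. G (\<lambda>i. X i \<omega>) *
       (iexp (\<Sum>i\<in>I. a i * X i \<omega>) - (\<integral>\<omega>. iexp (\<Sum>i\<in>I. a i * X i \<omega>) \<partial>M)) \<partial>M)) {0..1}" (is "(_ has_integral ?v) _") for a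
  proof -
    let ?e = "\<integral>\<omega>. iexp (\<Sum>i\<in>I. a i * X i \<omega>) \<partial>M"
    obtain B where B: "\<And>z j. j \<in> I \<Longrightarrow> norm (\<Sum>i\<in>I. complex_of_real (K i j) * (\<i> * complex_of_real (a i) * iexp (\<Sum>i\<in>I. a i * z i))) \<le> B"
      using wb[OF trig_fun.character[of I a]] by metis
    have B': "norm (iexp (\<Sum>i\<in>I. a i * X i \<omega>) - ?e) \<le> max B 2" for \<omega>
    proof -
      have "norm ?e \<le> 1" by (rule norm_integral_le[OF iexp_meas]) (simp del: of_real_sum of_real_mult)
      then have "norm (iexp (\<Sum>i\<in>I. a i * X i \<omega>) - ?e) \<le> 2"
        using norm_triangle_ineq4[of "iexp (\<Sum>i\<in>I. a i * X i \<omega>)" ?e]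
        by (simp del: of_real_sum of_real_mult)
      then show ?thesis by linarith
    qed
    show ?thesis
    proof (rule trig_fun_has_integral_extend[OF prob_space_axioms pair.prob_space_axioms finite_I X_meas corr_copy_meas _ B' _ _ covariance_character G])
      show "norm (\<Sum>i\<in>I. complex_of_real (K i j) * (\<i> * complex_of_real (a i) * iexp (\<Sum>i\<in>I. a i * X i (fst p)))) \<le> max B 2"
        if "j \<in> I" for j p using B[OF that, of "\<lambda>i. X i (fst p)"] by simp
      show "(\<lambda>p. \<Sum>i\<in>I. complex_of_real (K i j) * (\<i> * complex_of_real (a i) * iexp (\<Sum>i\<in>I. a i * X i (fst p)))) \<in> borel_measurable (M \<Otimes>\<^sub>M M)" for j
        by (rule wm[OF trig_fun.character[of I a] fst_meas])
      show "(\<lambda>\<omega>. iexp (\<Sum>i\<in>I. a i * X i \<omega>) - ?e) \<in> borel_measurable M"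
        using iexp_meas by (rule borel_measurable_diff) simp
    qed auto
  qed
  let ?EG = "\<integral>\<omega>. G (\<lambda>i. X i \<omega>) \<partial>M"
  have step2: "((\<lambda>\<rho>. \<integral>p. (\<Sum>i\<in>I. \<i> * complex_of_real (a i) * iexp (\<Sum>i\<in>I. a i * X i (fst p)) * (\<Sum>j\<in>I. complex_of_real (K j i) * DG j (\<lambda>i. corr_copy \<rho> X i p))) \<partial>(M \<Otimes>\<^sub>M M))
    has_integral (\<integral>\<omega>. iexp (\<Sum>i\<in>I. a i * X i \<omega>) * (G (\<lambda>i. X i \<omega>) - ?EG) \<partial>M)) {0..1}" for a
  proof -
    let ?ea = "\<lambda>\<omega>. iexp (\<Sum>i\<in>I. a i * X i \<omega>)"
    have ia: "integrable M ?ea" by (rule trig_int[OF trig_fun.character])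
    have iga: "integrable M (\<lambda>\<omega>. G (\<lambda>i. X i \<omega>) * ?ea \<omega>)"
      by (rule trig_int[OF trig_fun_mult[OF G trig_fun.character finite_I]])
    have "(\<integral>\<omega>. G (\<lambda>i. X i \<omega>) * (?ea \<omega> - (\<integral>\<omega>. ?ea \<omega> \<partial>M)) \<partial>M) = (\<integral>\<omega>. ?ea \<omega> * (G (\<lambda>i. X i \<omega>) - ?EG) \<partial>M)"
      using ia iga trig_int[OF G] by (simp add: left_diff_distrib right_diff_distrib mult.commute del: of_real_sum of_real_mult)
    moreover have "(\<Sum>j\<in>I. DG j (\<lambda>i. corr_copy \<rho> X i p) * (\<Sum>i\<in>I. complex_of_real (K i j) * (\<i> * complex_of_real (a i) * ?ea (fst p))))
      = (\<Sum>i\<in>I. \<i> * complex_of_real (a i) * ?ea (fst p) * (\<Sum>j\<in>I. complex_of_real (K j i) * DG j (\<lambda>i. corr_copy \<rho> X i p)))" for \<rho> p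
      unfolding sum_distrib_left by (subst sum.swap) (auto intro!: sum.cong simp: K_sym mult_ac)
    ultimately show ?thesis using step1[of a] by simp
  qed
  obtain B where B: "\<And>z j. j \<in> I \<Longrightarrow> norm (\<Sum>i\<in>I. complex_of_real (K i j) * DG i z) \<le> B" "\<And>z j. j \<in> I \<Longrightarrow> norm (G z - ?EG) \<le> B"
    using wb[OF G, of ?EG] by metis
  obtain C where C: "\<And>z. norm (G z) \<le> C" using trig_fun_bounded[OF G finite_I] by metis
  have B': "norm (G z - ?EG) \<le> max B (C + norm ?EG)" for z
    using C[of z] norm_triangle_ineq4[of "G z" ?EG] by linarith
  have "((\<lambda>\<rho>. \<integral>p. (\<Sum>i\<in>I. DF i (\<lambda>i. X i (fst p)) * (\<Sum>j\<in>I. complex_of_real (K j i) * DG j (\<lambda>i. corr_copy \<rho> X i p))) \<partial>(M \<Otimes>\<^sub>M M))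
    has_integral (\<integral>\<omega>. F (\<lambda>i. X i \<omega>) * (G (\<lambda>i. X i \<omega>) - ?EG) \<partial>M)) {0..1}"
  proof (rule trig_fun_has_integral_extend[OF prob_space_axioms pair.prob_space_axioms finite_I X_meas fst_meas _ B' _ _ step2 F])
    show "(\<lambda>p. \<Sum>j\<in>I. complex_of_real (K j i) * DG j (\<lambda>i. corr_copy \<rho> X i p)) \<in> borel_measurable (M \<Otimes>\<^sub>M M)" for i \<rho>
      by (rule wm[OF G corr_copy_meas])
    show "norm (\<Sum>j\<in>I. complex_of_real (K j i) * DG j (\<lambda>i. corr_copy \<rho> X i p)) \<le> max B (C + norm ?EG)" if "i \<in> I" for i \<rho> p
      using B(1)[OF that, of "\<lambda>i. corr_copy \<rho> X i p"] by linarith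
    show "(\<lambda>\<omega>. G (\<lambda>i. X i \<omega>) - ?EG) \<in> borel_measurable M"
      using trig_fun_measurable(1)[OF G X_meas] by simp
  qed auto
  moreover have "(\<Sum>i\<in>I. DF i (\<lambda>i. X i (fst p)) * (\<Sum>j\<in>I. complex_of_real (K j i) * DG j (\<lambda>i. corr_copy \<rho> X i p)))
    = (\<Sum>i\<in>I. \<Sum>j\<in>I. complex_of_real (K i j) * DF i (\<lambda>i. X i (fst p)) * DG j (\<lambda>i. corr_copy \<rho> X i p))" for \<rho> p
    unfolding sum_distrib_left by (auto intro!: sum.cong simp: K_sym mult_ac)
  moreover have "(\<integral>\<omega>. F (\<lambda>i. X i \<omega>) * (G (\<lambda>i. X i \<omega>) - ?EG) \<partial>M)
    = (\<integral>\<omega>. F (\<lambda>i. X i \<omega>) * G (\<lambda>i. X i \<omega>) \<partial>M) - (\<integral>\<omega>. F (\<lambda>i. X i \<omega>) \<partial>M) * ?EG"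
    using trig_int[OF F] trig_int[OF trig_fun_mult[OF F G finite_I]] by (simp add: right_diff_distrib)
  ultimately show ?thesis by simp
qed

end

section \<open>From the covariance identity to characteristic functions\<close>

context gaussian_family
begin

lemma covariance_bound:
  fixes \<kappa> b c :: real
  assumes F: "trig_fun I F DF" and G: "trig_fun I G DG"
    and K: "\<And>i. i \<in> I \<Longrightarrow> (\<Sum>j\<in>I. \<bar>K i j\<bar>) \<le> \<kappa>"
    and DF: "\<And>i z. i \<in> I \<Longrightarrow> norm (DF i z) \<le> b" and DG: "\<And>i z. i \<in> I \<Longrightarrow> norm (DG i z) \<le> c"
    and "0 \<le> \<kappa>" "0 \<le> b" "0 \<le> c"
  shows "norm ((\<integral>\<omega>. F (\<lambda>i. X i \<omega>) * G (\<lambda>i. X i \<omega>) \<partial>M) - (\<integral>\<omega>. F (\<lambda>i. X i \<omega>) \<partial>M) * (\<integral>\<omega>. G (\<lambda>i. X i \<omega>) \<partial>M))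
     \<le> card I * \<kappa> * b * c" (is "norm ?c \<le> ?B")
proof -
  have "norm (\<integral>p. (\<Sum>i\<in>I. \<Sum>j\<in>I. complex_of_real (K i j) * DF i (\<lambda>i. X i (fst p)) * DG j (\<lambda>i. corr_copy \<rho> X i p)) \<partial>(M \<Otimes>\<^sub>M M)) \<le> ?B" for \<rho>
  proof (rule pair.norm_integral_le)
    show "(\<lambda>p. \<Sum>i\<in>I. \<Sum>j\<in>I. complex_of_real (K i j) * DF i (\<lambda>i. X i (fst p)) * DG j (\<lambda>i. corr_copy \<rho> X i p)) \<in> borel_measurable (M \<Otimes>\<^sub>M M)"
      by (intro borel_measurable_sum borel_measurable_times trig_fun_measurable(2)[OF F] trig_fun_measurable(2)[OF G] fst_meas corr_copy_meas) auto
    fix p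
    have "norm (\<Sum>i\<in>I. \<Sum>j\<in>I. complex_of_real (K i j) * DF i (\<lambda>i. X i (fst p)) * DG j (\<lambda>i. corr_copy \<rho> X i p))
      \<le> (\<Sum>i\<in>I. \<Sum>j\<in>I. \<bar>K i j\<bar> * b * c)"
      by (intro sum_norm_le) (auto simp: norm_mult intro!: mult_mono mult_nonneg_nonneg DF DG assms(7))
    also have "\<dots> = (\<Sum>i\<in>I. (\<Sum>j\<in>I. \<bar>K i j\<bar>) * (b * c))" by (simp add: sum_distrib_right mult.assoc)
    also have "\<dots> \<le> (\<Sum>i\<in>I. \<kappa> * (b * c))"
      using assms by (intro sum_mono mult_right_mono K) auto
    finally show "norm (\<Sum>i\<in>I. \<Sum>j\<in>I. complex_of_real (K i j) * DF i (\<lambda>i. X i (fst p)) * DG j (\<lambda>i. corr_copy \<rho> X i p)) \<le> ?B"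
      by (simp add: mult.assoc)
  qed
  then show ?thesis using has_integral_norm_le[OF covariance_identity[OF F G]] by blast
qed

text \<open>Stein's equation \<open>E[W exp(itW)] = it Var(W) E exp(itW)\<close> characterises Gaussian laws; here it holds up to an error.
Expanding both sides by the covariance identity leaves the covariance of \<open>exp(itW(Z))\<close> with the function
\<open>g\<close> of \<open>(Z, Z\<^sup>\<rho>)\<close>, which the same identity for the doubled vector bounds by gradients. With \<open>b\<close> of order
\<open>n\<^sup>-\<^sup>1\<^sup>/\<^sup>2\<close> and \<open>card I = n\<close>, the error is of order \<open>n\<^sup>-\<^sup>1\<^sup>/\<^sup>2\<close>.\<close>

lemma stein_covariance_bound:
  fixes w :: "('i \<Rightarrow> real) \<Rightarrow> real" and \<kappa> b t :: real
  assumes W: "trig_fun I (\<lambda>z. complex_of_real (w z)) D"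
    and D: "\<And>i. i \<in> I \<Longrightarrow> trig_fun I (D i) (H i)"
    and K: "\<And>i. i \<in> I \<Longrightarrow> (\<Sum>j\<in>I. \<bar>K i j\<bar>) \<le> \<kappa>"
    and Db: "\<And>i z. i \<in> I \<Longrightarrow> norm (D i z) \<le> b"
    and Hb: "\<And>l z. l \<in> I \<Longrightarrow> (\<Sum>i\<in>I. norm (H i l z)) \<le> b"
    and "0 \<le> \<kappa>" "0 \<le> b" and mean0: "(\<integral>\<omega>. w (\<lambda>i. X i \<omega>) \<partial>M) = 0"
  shows "norm ((\<integral>\<omega>. complex_of_real (w (\<lambda>i. X i \<omega>)) * iexp (t * w (\<lambda>i. X i \<omega>)) \<partial>M)
      - \<i> * t * (\<integral>\<omega>. (w (\<lambda>i. X i \<omega>))\<^sup>2 \<partial>M) * (\<integral>\<omega>. iexp (t * w (\<lambda>i. X i \<omega>)) \<partial>M)) \<le> (4 * card I * \<kappa>\<^sup>2 * b^3) * t\<^sup>2"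
proof -
  let ?W = "\<lambda>z. complex_of_real (w z)" and ?e = "\<lambda>z. iexp (t * w z)"
  define De where "De = (\<lambda>i z. ?e z * (\<i> * t * D i z))"
  have e: "trig_fun I ?e De"
    unfolding De_def
    by (rule trig_fun_cong[OF trig_fun_exp[OF trig_fun.scale[OF W, of "\<i> * t"] finite_I]]) (simp_all add: mult_ac)
  have ne: "norm (?e z) = 1" for z by simp
  let ?N = "M \<Otimes>\<^sub>M M"
  define x where "x = (\<lambda>(p :: 'a \<times> 'a) i. X i (fst p))"
  define y where "y = (\<lambda>\<rho> p i. corr_copy \<rho> X i p)"
  have xy: "(\<lambda>i. X i (fst p)) = x p" "(\<lambda>i. corr_copy \<rho> X i p) = y \<rho> p" for p \<rho>
    by (simp_all add: x_def y_def)
  \<comment> \<open>\<open>x\<close> and \<open>y \<rho>\<close> are \<open>Z\<close> and \<open>Z\<^sup>\<rho>\<close> on the product space; the mean of \<open>g\<close> averages to the variance.\<close>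
  define g where "g = (\<lambda>x y. \<Sum>i\<in>I. \<Sum>j\<in>I. complex_of_real (K i j) * (D i x * D j y))"
  have xm: "(\<lambda>p. x p i) \<in> borel_measurable ?N" "(\<lambda>p. y \<rho> p i) \<in> borel_measurable ?N" if "i \<in> I" for i \<rho>
    unfolding x_def y_def using fst_meas[OF that] corr_copy_meas[OF that] by auto
  have gm: "(\<lambda>p. g (x p) (y \<rho> p)) \<in> borel_measurable ?N" for \<rho>
    unfolding g_def
    by (intro borel_measurable_sum borel_measurable_times trig_fun_measurable(2)[OF W] xm) auto
  have em: "(\<lambda>p. ?e (x p)) \<in> borel_measurable ?N"
    by (rule trig_fun_measurable(1)[OF e xm(1)])
  have Ee: "(\<integral>p. ?e (x p) \<partial>?N) = (\<integral>\<omega>. ?e (\<lambda>i. X i \<omega>) \<partial>M)"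
  proof -
    interpret P: pair_prob_space M M by unfold_locales
    have "(\<integral>p. ?e (x p) \<partial>?N) = (\<integral>a. (\<integral>b. ?e (x (a, b)) \<partial>M) \<partial>M)"
      by (rule P.integral_fst'[symmetric], rule pair.integrable_bounded[OF em, of 1]) simp
    also have "\<dots> = (\<integral>\<omega>. ?e (\<lambda>i. X i \<omega>) \<partial>M)" by (simp add: x_def prob_space)
    finally show ?thesis .
  qed
  have I1: "((\<lambda>\<rho>. \<i> * t * (\<integral>p. ?e (x p) * g (x p) (y \<rho> p) \<partial>?N)) has_integral
      (\<integral>\<omega>. ?W (\<lambda>i. X i \<omega>) * ?e (\<lambda>i. X i \<omega>) \<partial>M)) {0..1}"
  proof -
    have "(\<Sum>i\<in>I. \<Sum>j\<in>I. complex_of_real (K i j) * De i (x p) * D j (y \<rho> p)) = \<i> * t * (?e (x p) * g (x p) (y \<rho> p))" for p \<rho>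
      unfolding De_def g_def by (simp add: sum_distrib_left mult_ac)
    moreover have "(\<integral>\<omega>. ?W (\<lambda>i. X i \<omega>) \<partial>M) = 0" using mean0 by simp
    ultimately show ?thesis
      using covariance_identity[OF e W] unfolding xy
      by (simp add: mult.commute[of "?W _"])
  qed
  have I2: "((\<lambda>\<rho>. (\<integral>p. g (x p) (y \<rho> p) \<partial>?N)) has_integral
      complex_of_real (\<integral>\<omega>. (w (\<lambda>i. X i \<omega>))\<^sup>2 \<partial>M)) {0..1}"
  proof -
    have "(\<Sum>i\<in>I. \<Sum>j\<in>I. complex_of_real (K i j) * D i (x p) * D j (y \<rho> p)) = g (x p) (y \<rho> p)" for p \<rho>
      unfolding g_def by (simp add: mult_ac)
    moreover have "(\<integral>\<omega>. ?W (\<lambda>i. X i \<omega>) \<partial>M) = 0" using mean0 by simp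
    moreover have "(\<integral>\<omega>. ?W (\<lambda>i. X i \<omega>) * ?W (\<lambda>i. X i \<omega>) \<partial>M) = complex_of_real (\<integral>\<omega>. (w (\<lambda>i. X i \<omega>))\<^sup>2 \<partial>M)"
      by (simp add: power2_eq_square flip: of_real_mult)
    ultimately show ?thesis
      using covariance_identity[OF W W] unfolding xy by simp
  qed
  have cov: "norm ((\<integral>p. ?e (x p) * g (x p) (y \<rho> p) \<partial>?N) - (\<integral>p. ?e (x p) \<partial>?N) * (\<integral>p. g (x p) (y \<rho> p) \<partial>?N))
      \<le> (4 * card I * \<kappa>\<^sup>2 * b^3) * \<bar>t\<bar>" if \<rho>: "\<rho> \<in> {0..1}" for \<rho>
  proof -
    let ?J = "I <+> I"
    define K' where "K' = (\<lambda>p q. case (p, q) of (Inl i, Inl j) \<Rightarrow> K i j | (Inr i, Inr j) \<Rightarrow> K i j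
        | (Inl i, Inr j) \<Rightarrow> \<rho> * K i j | (Inr i, Inl j) \<Rightarrow> \<rho> * K i j)"
    define X' where "X' = case_sum (\<lambda>i p. X i (fst p)) (corr_copy \<rho> X)"
    interpret D: gaussian_family ?N ?J X' K'
      unfolding X'_def K'_def by (rule doubled) (use \<rho> in auto)
    have X': "(\<lambda>i. X' (Inl i) p) = x p" "(\<lambda>i. X' (Inr i) p) = y \<rho> p" for p
      by (auto simp: X'_def x_def y_def)
    \<comment> \<open>Gradients of \<open>D i\<close> in the doubled coordinates, when \<open>D i\<close> acts on the left or on the right copy.\<close>
    define HL where "HL = (\<lambda>i p (z :: 'i + 'i \<Rightarrow> real). case p of Inl l \<Rightarrow> H i l (\<lambda>i. z (Inl i)) | Inr (_::'i) \<Rightarrow> 0)"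
    define HR where "HR = (\<lambda>i p (z :: 'i + 'i \<Rightarrow> real). case p of Inr l \<Rightarrow> H i l (\<lambda>i. z (Inr i)) | Inl (_::'i) \<Rightarrow> 0)"
    have L: "trig_fun ?J (\<lambda>z. D i (\<lambda>i. z (Inl i))) (HL i)" if "i \<in> I" for i
      by (rule trig_fun_reindex[OF D[OF that] finite_I, where h=Inl]) (auto simp: finite_I HL_def)
    have R: "trig_fun ?J (\<lambda>z. D i (\<lambda>i. z (Inr i))) (HR i)" if "i \<in> I" for i
      by (rule trig_fun_reindex[OF D[OF that] finite_I, where h=Inr]) (auto simp: finite_I HR_def)
    define De' where "De' = (\<lambda>p (z :: 'i + 'i \<Rightarrow> real). case p of Inl l \<Rightarrow> De l (\<lambda>i. z (Inl i)) | Inr (_::'i) \<Rightarrow> 0)"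
    have e': "trig_fun ?J (\<lambda>z. ?e (\<lambda>i. z (Inl i))) De'"
      by (rule trig_fun_reindex[OF e finite_I, where h=Inl]) (auto simp: finite_I De'_def)
    define Dg where "Dg = (\<lambda>p z. \<Sum>i\<in>I. \<Sum>j\<in>I. complex_of_real (K i j) *
       (HL i p z * D j (\<lambda>i. z (Inr i)) + D i (\<lambda>i. z (Inl i)) * HR j p z))"
    have g': "trig_fun ?J (\<lambda>z. g (\<lambda>i. z (Inl i)) (\<lambda>i. z (Inr i))) Dg"
      unfolding g_def Dg_def
      by (intro trig_fun_sum trig_fun.scale trig_fun_mult L R) (auto simp: finite_I)
    have "norm ((\<integral>p. ?e (\<lambda>i. X' (Inl i) p) * g (\<lambda>i. X' (Inl i) p) (\<lambda>i. X' (Inr i) p) \<partial>?N)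
       - (\<integral>p. ?e (\<lambda>i. X' (Inl i) p) \<partial>?N) * (\<integral>p. g (\<lambda>i. X' (Inl i) p) (\<lambda>i. X' (Inr i) p) \<partial>?N))
      \<le> card ?J * (2 * \<kappa>) * (\<bar>t\<bar> * b) * (\<kappa> * b * b)"
    proof (rule D.covariance_bound[OF e' g'])
      show "(\<Sum>q\<in>?J. \<bar>K' p q\<bar>) \<le> 2 * \<kappa>" if "p \<in> ?J" for p
      proof -
        have "(\<Sum>j\<in>I. \<bar>K i j\<bar>) + (\<Sum>j\<in>I. \<rho> * \<bar>K i j\<bar>) \<le> 2 * \<kappa>" if "i \<in> I" for i
        proof -
          have "(\<Sum>j\<in>I. \<rho> * \<bar>K i j\<bar>) \<le> (\<Sum>j\<in>I. \<bar>K i j\<bar>)"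
            using \<rho> by (intro sum_mono) (auto intro: mult_left_le_one_le)
          then show ?thesis using K[OF that] by simp
        qed
        then show ?thesis using that \<rho> finite_I by (auto simp: K'_def sum.Plus abs_mult add.commute)
      qed
      show "norm (De' p z) \<le> \<bar>t\<bar> * b" if "p \<in> ?J" for p z
        using that Db \<open>0 \<le> b\<close> by (auto simp: De'_def De_def norm_mult intro!: mult_left_mono)
      show "norm (Dg p z) \<le> \<kappa> * b * b" if p: "p \<in> ?J" for p z
      proof -
        let ?x = "\<lambda>i. z (Inl i)" and ?y = "\<lambda>i. z (Inr i)"
        have row: "(\<Sum>i\<in>I. \<Sum>j\<in>I. \<bar>K i j\<bar> * (h i * b)) \<le> \<kappa> * b * b"
          if "\<And>i. h i \<ge> 0" "(\<Sum>i\<in>I. h i) \<le> b" for h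
        proof -
          have "(\<Sum>i\<in>I. \<Sum>j\<in>I. \<bar>K i j\<bar> * (h i * b)) = (\<Sum>i\<in>I. (\<Sum>j\<in>I. \<bar>K i j\<bar>) * (h i * b))"
            by (simp add: sum_distrib_right)
          also have "\<dots> \<le> (\<Sum>i\<in>I. \<kappa> * (h i * b))"
            using that assms by (intro sum_mono mult_right_mono K) auto
          also have "\<dots> = \<kappa> * b * (\<Sum>i\<in>I. h i)" by (simp add: sum_distrib_left mult_ac)
          also have "\<dots> \<le> \<kappa> * b * b" using that assms by (intro mult_left_mono) auto
          finally show ?thesis .
        qed
        from p consider l where "p = Inl l" "l \<in> I" | l where "p = Inr l" "l \<in> I" by auto
        then show ?thesis
        proof cases
          case 1
          have "norm (Dg p z) \<le> (\<Sum>i\<in>I. \<Sum>j\<in>I. \<bar>K i j\<bar> * (norm (H i l ?x) * b))"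
            unfolding Dg_def using 1 Db
            by (intro sum_norm_le) (auto simp: HL_def HR_def norm_mult intro!: mult_left_mono)
          also have "\<dots> \<le> \<kappa> * b * b" by (rule row) (use Hb[OF 1(2)] in auto)
          finally show ?thesis .
        next
          case 2
          have "norm (Dg p z) \<le> (\<Sum>i\<in>I. \<Sum>j\<in>I. \<bar>K i j\<bar> * (norm (H j l ?y) * b))"
            unfolding Dg_def using 2 Db
            by (intro sum_norm_le) (auto simp: HL_def HR_def norm_mult mult.commute[of "norm (H _ _ _)"] intro!: mult_left_mono mult_right_mono)
          also have "\<dots> = (\<Sum>j\<in>I. \<Sum>i\<in>I. \<bar>K j i\<bar> * (norm (H j l ?y) * b))"
            by (subst sum.swap) (auto intro!: sum.cong simp: K_sym)
          also have "\<dots> \<le> \<kappa> * b * b" by (rule row) (use Hb[OF 2(2)] in auto)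
          finally show ?thesis .
        qed
      qed
    qed (use assms in auto)
    also have "card ?J * (2 * \<kappa>) * (\<bar>t\<bar> * b) * (\<kappa> * b * b) = (4 * card I * \<kappa>\<^sup>2 * b^3) * \<bar>t\<bar>"
      using finite_I by (simp add: card_Plus power2_eq_square power3_eq_cube)
    finally show ?thesis unfolding X' .
  qed
  let ?v = "complex_of_real (\<integral>\<omega>. (w (\<lambda>i. X i \<omega>))\<^sup>2 \<partial>M)" and ?\<phi> = "\<integral>\<omega>. ?e (\<lambda>i. X i \<omega>) \<partial>M"
  have "((\<lambda>\<rho>. \<i> * t * (\<integral>p. ?e (x p) * g (x p) (y \<rho> p) \<partial>?N) - \<i> * t * ?\<phi> * (\<integral>p. g (x p) (y \<rho> p) \<partial>?N))
     has_integral ((\<integral>\<omega>. ?W (\<lambda>i. X i \<omega>) * ?e (\<lambda>i. X i \<omega>) \<partial>M) - \<i> * t * ?\<phi> * ?v)) {0..1}"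
    using has_integral_diff[OF I1 has_integral_mult_right[OF I2, of "\<i> * t * ?\<phi>"]] by simp
  moreover have "norm (\<i> * t * (\<integral>p. ?e (x p) * g (x p) (y \<rho> p) \<partial>?N) - \<i> * t * ?\<phi> * (\<integral>p. g (x p) (y \<rho> p) \<partial>?N))
      \<le> (4 * card I * \<kappa>\<^sup>2 * b^3) * t\<^sup>2" if "\<rho> \<in> {0..1}" for \<rho> :: real
  proof -
    have "\<i> * t * (\<integral>p. ?e (x p) * g (x p) (y \<rho> p) \<partial>?N) - \<i> * t * ?\<phi> * (\<integral>p. g (x p) (y \<rho> p) \<partial>?N)
      = \<i> * t * ((\<integral>p. ?e (x p) * g (x p) (y \<rho> p) \<partial>?N) - (\<integral>p. ?e (x p) \<partial>?N) * (\<integral>p. g (x p) (y \<rho> p) \<partial>?N))"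
      unfolding Ee by (simp only: right_diff_distrib mult.assoc)
    also have "norm \<dots> \<le> \<bar>t\<bar> * ((4 * card I * \<kappa>\<^sup>2 * b^3) * \<bar>t\<bar>)"
      unfolding norm_mult using cov[of \<rho>] that by (intro mult_mono) auto
    also have "\<dots> = (4 * card I * \<kappa>\<^sup>2 * b^3) * t\<^sup>2" by (simp add: power2_eq_square[of t] abs_mult_self_eq flip: mult.assoc)
    finally show ?thesis .
  qed
  ultimately have "norm ((\<integral>\<omega>. ?W (\<lambda>i. X i \<omega>) * ?e (\<lambda>i. X i \<omega>) \<partial>M) - \<i> * t * ?\<phi> * ?v)
    \<le> (4 * card I * \<kappa>\<^sup>2 * b^3) * t\<^sup>2"
    by (rule has_integral_norm_le)
  then show ?thesis by (simp add: mult_ac)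
qed

end

text \<open>The hypothesis says \<open>\<phi>' + t v \<phi> = O(t\<^sup>2)\<close> for the characteristic function \<open>\<phi>\<close> of \<open>w\<close>. Multiplying by the
integrating factor \<open>exp(v t\<^sup>2 / 2)\<close> and using the mean value inequality on the interval from \<open>0\<close> to \<open>t\<close> gives the
bound; the integrating factor is monotone in \<open>\<bar>t\<bar>\<close>, so it cancels at the end.\<close>

lemma (in prob_space) approximate_stein_imp_char_close:
  fixes w :: "'a \<Rightarrow> real" and B v C t :: real
  assumes wm[measurable]: "w \<in> borel_measurable M" and wB: "\<And>\<omega>. \<bar>w \<omega>\<bar> \<le> B" and "0 \<le> v" "0 \<le> C"
    and stein: "\<And>t. norm ((\<integral>\<omega>. complex_of_real (w \<omega>) * iexp (t * w \<omega>) \<partial>M) - \<i> * t * v * (\<integral>\<omega>. iexp (t * w \<omega>) \<partial>M)) \<le> C * t\<^sup>2"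
  shows "norm ((\<integral>\<omega>. iexp (t * w \<omega>) \<partial>M) - exp (- (v * t\<^sup>2) / 2)) \<le> C * \<bar>t\<bar>^3"
proof -
  define \<phi> where "\<phi> = (\<lambda>t. \<integral>\<omega>. iexp (t * w \<omega>) \<partial>M)"
  define \<phi>' where "\<phi>' = (\<lambda>t. \<integral>\<omega>. complex_of_real (w \<omega>) * iexp (t * w \<omega>) \<partial>M)"
  have iM: "(\<lambda>\<omega>. iexp (t * w \<omega>)) \<in> borel_measurable M" for t
    using measurable_compose[of "\<lambda>\<omega>. t * w \<omega>" M borel "\<lambda>x. iexp x" borel] by simp
  have ii: "integrable M (\<lambda>\<omega>. iexp (t * w \<omega>))" for t
    by (rule integrable_bounded[of _ 1], rule iM) simp
  have iw: "integrable M (\<lambda>\<omega>. complex_of_real (w \<omega>) * iexp (t * w \<omega>))" for t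
    by (rule integrable_bounded[of _ B]) (use iM wB in \<open>auto simp: norm_mult simp del: of_real_mult\<close>)
  have B0: "B \<ge> 0" using wB[of undefined] by linarith
  have der: "(\<phi> has_vector_derivative (\<i> * \<phi>' t)) (at t)" for t
    unfolding has_vector_derivative_def
  proof (rule has_derivativeI_sandwich[of 1])
    show "bounded_linear (\<lambda>h. h *\<^sub>R (\<i> * \<phi>' t))" by (rule bounded_linear_scaleR_left)
    show "((\<lambda>y. B\<^sup>2 / 2 * \<bar>y - t\<bar>) \<longlongrightarrow> 0) (at t)"
      by (auto intro!: tendsto_eq_intros)
    fix y assume "y \<noteq> t"
    let ?h = "y - t"
    have "\<phi> y - \<phi> t - ?h *\<^sub>R (\<i> * \<phi>' t) = (\<integral>\<omega>. iexp (y * w \<omega>) - iexp (t * w \<omega>) - ?h * \<i> * (complex_of_real (w \<omega>) * iexp (t * w \<omega>)) \<partial>M)"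
      unfolding \<phi>_def \<phi>'_def using ii iw by (simp add: scaleR_conv_of_real mult.assoc)
    also have "norm \<dots> \<le> (?h * B)\<^sup>2 / 2"
    proof (rule norm_integral_le)
      show "(\<lambda>\<omega>. iexp (y * w \<omega>) - iexp (t * w \<omega>) - ?h * \<i> * (complex_of_real (w \<omega>) * iexp (t * w \<omega>))) \<in> borel_measurable M"
        using ii iw by (intro borel_measurable_diff borel_measurable_times) auto
      fix \<omega>
      have "iexp (y * w \<omega>) = iexp (t * w \<omega>) * iexp (?h * w \<omega>)"
        by (simp add: exp_add[symmetric] algebra_simps)
      then have "iexp (y * w \<omega>) - iexp (t * w \<omega>) - ?h * \<i> * (complex_of_real (w \<omega>) * iexp (t * w \<omega>))
        = iexp (t * w \<omega>) * (iexp (?h * w \<omega>) - (1 + \<i> * (?h * w \<omega>)))" by (simp add: algebra_simps)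
      also have "norm \<dots> = norm (iexp (?h * w \<omega>) - (1 + \<i> * (?h * w \<omega>)))"
        unfolding norm_mult by (simp only: norm_exp_i_times mult_1)
      also have "\<dots> \<le> \<bar>?h * w \<omega>\<bar>\<^sup>2 / 2" using iexp_approx1[of "?h * w \<omega>" 1] by (simp add: numeral_2_eq_2)
      also have "\<dots> \<le> (?h * B)\<^sup>2 / 2"
        using power_mono[OF mult_left_mono[OF wB[of \<omega>], of "\<bar>?h\<bar>"], of 2] by (simp add: abs_mult power_mult_distrib)
      finally show "norm (iexp (y * w \<omega>) - iexp (t * w \<omega>) - ?h * \<i> * (complex_of_real (w \<omega>) * iexp (t * w \<omega>))) \<le> (?h * B)\<^sup>2 / 2" .
    qed
    finally have "norm (\<phi> y - \<phi> t - ?h *\<^sub>R (\<i> * \<phi>' t)) / norm ?h \<le> (?h * B)\<^sup>2 / 2 / norm ?h"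
      by (rule divide_right_mono) simp
    also have "\<dots> = B\<^sup>2 / 2 * \<bar>?h\<bar>"
    proof -
      have "(?h * B)\<^sup>2 = \<bar>?h\<bar> * (\<bar>?h\<bar> * B\<^sup>2)" by (simp add: power2_eq_square)
      then show ?thesis using \<open>y \<noteq> t\<close> by simp
    qed
    finally show "norm (\<phi> y - \<phi> t - ?h *\<^sub>R (\<i> * \<phi>' t)) / norm ?h \<le> B\<^sup>2 / 2 * \<bar>?h\<bar>" .
  qed simp
  define E where "E = (\<lambda>s. exp (v * s\<^sup>2 / 2))"
  define \<psi> where "\<psi> = (\<lambda>s. E s *\<^sub>R \<phi> s)"
  have dpsi: "(\<psi> has_vector_derivative (E s *\<^sub>R (\<i> * (\<phi>' s - \<i> * s * v * \<phi> s)))) (at s)" for s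
  proof -
    have "(E has_real_derivative (v * s * E s)) (at s)"
      unfolding E_def by (auto intro!: derivative_eq_intros)
    from has_vector_derivative_scaleR[OF this der[of s]] show ?thesis
      unfolding \<psi>_def by (simp add: algebra_simps scaleR_conv_of_real)
  qed
  have "norm (\<psi> t - \<psi> 0) \<le> (E t * (C * t\<^sup>2)) * norm (t - 0)"
  proof (rule differentiable_bound)
    show "convex {- \<bar>t\<bar>..\<bar>t\<bar>}" by simp
    show "t \<in> {- \<bar>t\<bar>..\<bar>t\<bar>}" "0 \<in> {- \<bar>t\<bar>..\<bar>t\<bar>}" by auto
    fix s assume s: "s \<in> {- \<bar>t\<bar>..\<bar>t\<bar>}"
    show "(\<psi> has_derivative (\<lambda>h. h *\<^sub>R (E s *\<^sub>R (\<i> * (\<phi>' s - \<i> * s * v * \<phi> s))))) (at s within {- \<bar>t\<bar>..\<bar>t\<bar>})"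
      using dpsi[of s] unfolding has_vector_derivative_def by (rule has_derivative_at_withinI)
    have s2: "s\<^sup>2 \<le> t\<^sup>2" using s by (intro abs_le_square_iff[THEN iffD1]) auto
    have "norm (E s *\<^sub>R (\<i> * (\<phi>' s - \<i> * s * v * \<phi> s))) \<le> E s * (C * s\<^sup>2)"
      using stein[of s] unfolding \<phi>_def \<phi>'_def by (simp add: E_def norm_mult)
    also have "\<dots> \<le> E t * (C * t\<^sup>2)"
      using s2 assms by (intro mult_mono) (auto simp: E_def intro!: mult_left_mono)
    finally have n: "norm (E s *\<^sub>R (\<i> * (\<phi>' s - \<i> * s * v * \<phi> s))) \<le> E t * (C * t\<^sup>2)" .
    show "onorm (\<lambda>h. h *\<^sub>R (E s *\<^sub>R (\<i> * (\<phi>' s - \<i> * s * v * \<phi> s)))) \<le> E t * (C * t\<^sup>2)"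
    proof (rule onorm_le)
      fix h :: real
      show "norm (h *\<^sub>R (E s *\<^sub>R (\<i> * (\<phi>' s - \<i> * s * v * \<phi> s)))) \<le> (E t * (C * t\<^sup>2)) * norm h"
        unfolding norm_scaleR[of h] using mult_left_mono[OF n, of "\<bar>h\<bar>"] by (simp only: mult.commute real_norm_def)
    qed
  qed
  moreover have "\<psi> 0 = 1" by (simp add: \<psi>_def E_def \<phi>_def prob_space)
  ultimately have "norm (E t *\<^sub>R \<phi> t - 1) \<le> E t * (C * \<bar>t\<bar>^3)"
    by (simp add: \<psi>_def power3_eq_cube power2_eq_square mult.assoc)
  moreover have "E t *\<^sub>R \<phi> t - 1 = E t *\<^sub>R (\<phi> t - exp (- (v * t\<^sup>2) / 2))"
    unfolding E_def by (simp add: scaleR_conv_of_real right_diff_distrib flip: of_real_mult exp_add)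
  ultimately have "E t * norm (\<phi> t - exp (- (v * t\<^sup>2) / 2)) \<le> E t * (C * \<bar>t\<bar>^3)"
    by (simp add: E_def)
  moreover have "E t > 0" by (simp add: E_def)
  ultimately show ?thesis unfolding \<phi>_def by simp
qed

section \<open>One-dimensional Gaussian laws\<close>

lemma prob_space_std_normal: "prob_space std_normal_distribution"
  by (rule real_dist_normal_dist[THEN real_distribution.axioms(1)])

text \<open>Viewing every Gaussian law, including the Dirac measures, as an affine image of the standard one avoids
separate treatment of zero variance.\<close>

lemma gaussian_eq_distr:
  assumes "0 \<le> v"
  shows "gaussian m v = distr std_normal_distribution borel (\<lambda>x. m + sqrt v * x)"
proof (cases "v = 0")
  case True
  interpret N: prob_space std_normal_distribution by (rule prob_space_std_normal)
  show ?thesis using True N.distr_const[of m borel] by (simp add: gaussian_def)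
next
  case False
  interpret N: prob_space std_normal_distribution by (rule prob_space_std_normal)
  have "distributed std_normal_distribution lborel (\<lambda>x. x) std_normal_density"
    unfolding distributed_def by (auto simp: distr_id2 cong: distr_cong)
  from N.normal_density_affine[OF this, of "sqrt v" m] False assms
  have "distributed std_normal_distribution lborel (\<lambda>x. m + sqrt v * x) (normal_density m (sqrt v))"
    by (simp add: mult.commute)
  then have "distr std_normal_distribution lborel (\<lambda>x. m + sqrt v * x) = density lborel (normal_density m (sqrt v))"
    by (simp add: distributed_def)
  moreover have "distr std_normal_distribution lborel (\<lambda>x. m + sqrt v * x) = distr std_normal_distribution borel (\<lambda>x. m + sqrt v * x)"
    by (rule distr_cong) auto
  ultimately show ?thesis using False by (simp add: gaussian_def)
qed

lemma real_distribution_gaussian: "0 \<le> v \<Longrightarrow> real_distribution (gaussian m v)"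
  unfolding gaussian_eq_distr
  by (rule prob_space.real_distribution_distr[OF prob_space_std_normal]) simp

lemma char_gaussian:
  assumes "0 \<le> v"
  shows "char (gaussian 0 v) t = exp (- (v * t\<^sup>2) / 2)"
proof -
  have "char (gaussian 0 v) t = (\<integral>x. iexp (t * (0 + sqrt v * x)) \<partial>std_normal_distribution)"
    unfolding char_def gaussian_eq_distr[OF assms] by (rule integral_distr) auto
  also have "\<dots> = char std_normal_distribution (t * sqrt v)" by (simp add: char_def mult.assoc)
  also have "\<dots> = exp (- (v * t\<^sup>2) / 2)"
    using assms by (simp add: char_std_normal_distribution power_mult_distrib mult.commute)
  finally show ?thesis .
qed

lemma integrable_exp_std_normal: "integrable std_normal_distribution (\<lambda>x. exp (c * x))"
proof -
  have "std_normal_density x * exp (c * x) = exp (c\<^sup>2 / 2) * normal_density c 1 x" for x :: real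
  proof -
    have e: "exp (- x\<^sup>2 / 2) * exp (c * x) = exp (c\<^sup>2 / 2) * exp (- (x - c)\<^sup>2 / 2)"
      unfolding exp_add[symmetric] by (simp add: power2_eq_square field_simps)
    show ?thesis using e by (simp add: std_normal_density_def normal_density_def)
  qed
  moreover have "integrable lborel (\<lambda>x. exp (c\<^sup>2 / 2) * normal_density c 1 x)" by simp
  ultimately show ?thesis by (subst integrable_density) (auto simp: normal_density_nonneg)
qed

lemma integrable_exp_gaussian:
  assumes "0 \<le> v"
  shows "integrable (gaussian m v) (\<lambda>x. exp (c * \<bar>x\<bar>))"
proof -
  have p: "integrable (gaussian m v) (\<lambda>x. exp (d * x))" for d
    unfolding gaussian_eq_distr[OF assms]
    by (subst integrable_distr_eq)
       (use integrable_exp_std_normal[of "d * sqrt v"] in \<open>auto simp: distrib_left exp_add mult.assoc\<close>)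
  have "sets (gaussian m v) = sets borel" by (simp add: gaussian_eq_distr[OF assms])
  moreover have "norm (exp (c * \<bar>x\<bar>)) \<le> norm (exp (c * x) + exp (- c * x))" for x :: real
  proof -
    have "norm (exp (c * x) + exp (- c * x)) = exp (c * x) + exp (- c * x)"
      by (simp add: add_pos_pos)
    then show ?thesis by (cases "x \<ge> 0") auto
  qed
  ultimately show ?thesis
    by (intro Bochner_Integration.integrable_bound[OF Bochner_Integration.integrable_add[OF p[of c] p[of "-c"]]])
       (auto cong: measurable_cong_sets simp del: real_norm_def)
qed

lemma gaussian_moments:
  assumes "0 \<le> v"
  shows "integrable (gaussian m v) (\<lambda>x. x)" "(\<integral>x. x \<partial>gaussian m v) = m"
    and "integrable (gaussian m v) (\<lambda>x. x\<^sup>2)" "(\<integral>x. x\<^sup>2 \<partial>gaussian m v) = m\<^sup>2 + v"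
proof -
  interpret N: prob_space std_normal_distribution by (rule prob_space_std_normal)
  have i: "integrable std_normal_distribution (\<lambda>x. x)" "integrable std_normal_distribution (\<lambda>x. x\<^sup>2)"
    using integrable_std_normal_distribution_moment[of 1] integrable_std_normal_distribution_moment[of 2] by simp_all
  have m: "(\<integral>x. x \<partial>std_normal_distribution) = 0" "(\<integral>x. x\<^sup>2 \<partial>std_normal_distribution) = 1"
    using integral_std_normal_distribution_moment_odd[of 1] std_normal_distribution_even_moments(1)[of 1]
    by simp_all
  have sq: "(m + sqrt v * x)\<^sup>2 = m\<^sup>2 + 2 * m * sqrt v * x + v * x\<^sup>2" for x
    using assms by (simp add: power2_sum power_mult_distrib)
  have d: "integrable (gaussian m v) f = integrable std_normal_distribution (\<lambda>x. f (m + sqrt v * x))"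
      "(\<integral>x. f x \<partial>gaussian m v) = (\<integral>x. f (m + sqrt v * x) \<partial>std_normal_distribution)"
    if "f \<in> borel_measurable borel" for f :: "real \<Rightarrow> real"
    unfolding gaussian_eq_distr[OF assms] using that by (simp_all add: integrable_distr_eq integral_distr)
  have i1: "integrable std_normal_distribution (\<lambda>x. m + sqrt v * x)"
    by (intro Bochner_Integration.integrable_add integrable_mult_right i N.integrable_const)
  have i2: "integrable std_normal_distribution (\<lambda>x. m\<^sup>2 + 2 * m * sqrt v * x + v * x\<^sup>2)"
    by (intro Bochner_Integration.integrable_add integrable_mult_right i N.integrable_const)
  have pU: "N.prob UNIV = 1" using N.prob_space by simp
  have q: "(\<lambda>x::real. x) \<in> borel_measurable borel" "(\<lambda>x::real. x\<^sup>2) \<in> borel_measurable borel" by simp_all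
  show "integrable (gaussian m v) (\<lambda>x. x)" unfolding d(1)[OF q(1)] by (rule i1)
  show "integrable (gaussian m v) (\<lambda>x. x\<^sup>2)" unfolding d(1)[OF q(2)] sq by (rule i2)
  show "(\<integral>x. x \<partial>gaussian m v) = m"
    unfolding d(2)[OF q(1)] using m i by (simp add: pU)
  show "(\<integral>x. x\<^sup>2 \<partial>gaussian m v) = m\<^sup>2 + v"
    unfolding d(2)[OF q(2)] sq using m i by (simp add: pU)
qed

section \<open>Trigonometric polynomials in one variable\<close>

text \<open>Generators and closure rules rather than coefficients: the class is closed under differentiation and under
composition of a polynomial with a member, which is what the approximation argument produces.\<close>

inductive trig_poly :: "(real \<Rightarrow> real) \<Rightarrow> bool" where
  const: "trig_poly (\<lambda>_. c)"
| sin: "trig_poly (\<lambda>x. sin (l * x))"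
| cos: "trig_poly (\<lambda>x. cos (l * x))"
| add: "trig_poly f \<Longrightarrow> trig_poly g \<Longrightarrow> trig_poly (\<lambda>x. f x + g x)"
| mult: "trig_poly f \<Longrightarrow> trig_poly g \<Longrightarrow> trig_poly (\<lambda>x. f x * g x)"

lemma trig_poly_power: "trig_poly f \<Longrightarrow> trig_poly (\<lambda>x. f x ^ n)"
  by (induction n) (auto intro: trig_poly.intros)

lemma trig_poly_sum: "(\<And>k. k \<in> S \<Longrightarrow> trig_poly (f k)) \<Longrightarrow> trig_poly (\<lambda>x. \<Sum>k\<in>S. f k x)"
  by (induction S rule: infinite_finite_induct) (auto intro: trig_poly.intros)

lemma trig_poly_bounded: "trig_poly f \<Longrightarrow> \<exists>B. \<forall>x. \<bar>f x\<bar> \<le> B"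
proof (induction rule: trig_poly.induct)
  case (add f g)
  then show ?case by (meson abs_triangle_ineq add_mono order_trans)
next
  case (mult f g)
  then obtain B C where "\<And>x. \<bar>f x\<bar> \<le> B" "\<And>x. \<bar>g x\<bar> \<le> C" by blast
  then have "\<bar>f x * g x\<bar> \<le> B * C" for x
    unfolding abs_mult by (intro mult_mono) (auto intro: order.trans[OF abs_ge_zero])
  then show ?case by blast
qed (auto intro: exI[of _ 1])

lemma trig_fun_sin_cos:
  assumes "finite I" "i \<in> I"
  shows "trig_fun I (\<lambda>z. complex_of_real (sin (l * z i))) (\<lambda>j z. if j = i then complex_of_real (l * cos (l * z i)) else 0)"
    and "trig_fun I (\<lambda>z. complex_of_real (cos (l * z i))) (\<lambda>j z. if j = i then complex_of_real (- l * sin (l * z i)) else 0)"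
proof -
  define a where "a = (\<lambda>(c::real) j. if j = i then c else 0)"
  have a: "(\<Sum>j\<in>I. a c j * z j) = c * z i" for c z
  proof -
    have "(\<Sum>j\<in>I. a c j * z j) = (\<Sum>j\<in>I. if j = i then c * z i else 0)" by (rule sum.cong) (auto simp: a_def)
    then show ?thesis using assms by simp
  qed
  have e: "iexp x = complex_of_real (cos x) + \<i> * complex_of_real (sin x)" for x
    by (simp add: exp_Euler cos_of_real sin_of_real)
  show "trig_fun I (\<lambda>z. complex_of_real (sin (l * z i))) (\<lambda>j z. if j = i then complex_of_real (l * cos (l * z i)) else 0)"
    by (rule trig_fun_cong[OF trig_fun.add[OF trig_fun.scale[OF trig_fun.character[of I "a l"], of "- \<i> / 2"]
        trig_fun.scale[OF trig_fun.character[of I "a (- l)"], of "\<i> / 2"]]])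
       (unfold a e, auto simp: a_def algebra_simps)
  show "trig_fun I (\<lambda>z. complex_of_real (cos (l * z i))) (\<lambda>j z. if j = i then complex_of_real (- l * sin (l * z i)) else 0)"
    by (rule trig_fun_cong[OF trig_fun.add[OF trig_fun.scale[OF trig_fun.character[of I "a l"], of "1 / 2"]
        trig_fun.scale[OF trig_fun.character[of I "a (- l)"], of "1 / 2"]]])
       (unfold a e, auto simp: a_def algebra_simps)
qed

text \<open>A function of one variable and its derivative, applied to one coordinate of a vector indexed by \<open>'i\<close>, form a pair in
\<open>trig_fun\<close>. The type argument fixes the index type.\<close>

definition trig_coord :: "'i itself \<Rightarrow> (real \<Rightarrow> real) \<Rightarrow> (real \<Rightarrow> real) \<Rightarrow> bool" where
  "trig_coord _ f f' \<longleftrightarrow> (\<forall>(I :: 'i set) i. finite I \<longrightarrow> i \<in> I \<longrightarrow>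
     trig_fun I (\<lambda>z. complex_of_real (f (z i))) (\<lambda>j z. if j = i then complex_of_real (f' (z i)) else 0))"

lemma trig_coordD:
  fixes I :: "'i set"
  assumes "trig_coord TYPE('i) f f'" "finite I" "i \<in> I"
  shows "trig_fun I (\<lambda>z. complex_of_real (f (z i))) (\<lambda>j z. if j = i then complex_of_real (f' (z i)) else 0)"
  using assms unfolding trig_coord_def by blast

lemma trig_poly_deriv:
  assumes "trig_poly f"
  shows "\<exists>f'. trig_poly f' \<and> (\<forall>x. (f has_real_derivative f' x) (at x)) \<and> trig_coord TYPE('i) f f'"
  using assms
proof induction
  case (const c)
  have "trig_coord TYPE('i) (\<lambda>_. c) (\<lambda>_. 0)"
    unfolding trig_coord_def by (intro allI impI trig_fun_cong[OF trig_fun_const[of _ c]]) auto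
  then show ?case by (intro exI[of _ "\<lambda>_. 0"]) (auto intro: trig_poly.const)
next
  case (sin l)
  have "trig_coord TYPE('i) (\<lambda>x. sin (l * x)) (\<lambda>x. l * cos (l * x))"
    unfolding trig_coord_def by (intro allI impI trig_fun_sin_cos(1))
  moreover have "trig_poly (\<lambda>x. l * cos (l * x))" by (intro trig_poly.intros)
  ultimately show ?case
    by (intro exI[of _ "\<lambda>x. l * cos (l * x)"]) (auto intro!: derivative_eq_intros)
next
  case (cos l)
  have "trig_coord TYPE('i) (\<lambda>x. cos (l * x)) (\<lambda>x. - l * sin (l * x))"
    unfolding trig_coord_def by (intro allI impI trig_fun_sin_cos(2))
  moreover have "trig_poly (\<lambda>x. - l * sin (l * x))" by (intro trig_poly.intros)
  moreover have "((\<lambda>x. cos (l * x)) has_real_derivative - l * sin (l * x)) (at x)" for x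
    by (auto intro!: derivative_eq_intros)
  ultimately show ?case by (intro exI[of _ "\<lambda>x. - l * sin (l * x)"] conjI allI)
next
  case (add f g)
  then obtain f' g' where f': "trig_poly f'" "\<And>x. (f has_real_derivative f' x) (at x)" "trig_coord TYPE('i) f f'"
    and g': "trig_poly g'" "\<And>x. (g has_real_derivative g' x) (at x)" "trig_coord TYPE('i) g g'"
    by blast
  show ?case
  proof (intro exI[of _ "\<lambda>x. f' x + g' x"] conjI allI)
    show "trig_coord TYPE('i) (\<lambda>x. f x + g x) (\<lambda>x. f' x + g' x)"
      unfolding trig_coord_def
    proof (intro allI impI)
      fix I :: "'i set" and i assume I: "finite I" "i \<in> I"
      show "trig_fun I (\<lambda>z. complex_of_real (f (z i) + g (z i))) (\<lambda>j z. if j = i then complex_of_real (f' (z i) + g' (z i)) else 0)"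
        by (rule trig_fun_cong[OF trig_fun.add[OF trig_coordD[OF f'(3) I] trig_coordD[OF g'(3) I]]]) auto
    qed
    show "((\<lambda>x. f x + g x) has_real_derivative f' x + g' x) (at x)" for x
      by (rule DERIV_add[OF f'(2) g'(2)])
  qed (intro trig_poly.add f' g')
next
  case (mult f g)
  then obtain f' g' where f': "trig_poly f'" "\<And>x. (f has_real_derivative f' x) (at x)" "trig_coord TYPE('i) f f'"
    and g': "trig_poly g'" "\<And>x. (g has_real_derivative g' x) (at x)" "trig_coord TYPE('i) g g'"
    by blast
  show ?case
  proof (intro exI[of _ "\<lambda>x. f' x * g x + f x * g' x"] conjI allI)
    show "trig_coord TYPE('i) (\<lambda>x. f x * g x) (\<lambda>x. f' x * g x + f x * g' x)"
      unfolding trig_coord_def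
    proof (intro allI impI)
      fix I :: "'i set" and i assume I: "finite I" "i \<in> I"
      show "trig_fun I (\<lambda>z. complex_of_real (f (z i) * g (z i))) (\<lambda>j z. if j = i then complex_of_real (f' (z i) * g (z i) + f (z i) * g' (z i)) else 0)"
        by (rule trig_fun_cong[OF trig_fun_mult[OF trig_coordD[OF f'(3) I] trig_coordD[OF g'(3) I] I(1)]]) auto
    qed
    show "((\<lambda>x. f x * g x) has_real_derivative f' x * g x + f x * g' x) (at x)" for x
      using DERIV_mult[OF f'(2)[of x] g'(2)[of x]] by (simp add: algebra_simps)
  qed (intro trig_poly.add trig_poly.mult f' g' mult.hyps)
qed

section \<open>Marginal laws and a Poincare inequality\<close>

context gaussian_family
begin

text \<open>\<open>Z\<^sup>\<rho>\<close> has the same marginal laws as \<open>Z\<close>, so moments of functions of one coordinate do not depend on \<open>\<rho>\<close>.\<close>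

lemma corr_copy_law:
  assumes "0 \<le> \<rho>" "\<rho> \<le> 1" "i \<in> I" "0 \<le> K i i"
  shows "distr (M \<Otimes>\<^sub>M M) borel (corr_copy \<rho> X i) = gaussian 0 (K i i)"
proof (rule Levy_uniqueness)
  show "real_distribution (distr (M \<Otimes>\<^sub>M M) borel (corr_copy \<rho> X i))"
    by (rule pair.real_distribution_distr[OF corr_copy_meas[OF assms(3)]])
  show "real_distribution (gaussian 0 (K i i))" by (rule real_distribution_gaussian[OF assms(4)])
  show "char (distr (M \<Otimes>\<^sub>M M) borel (corr_copy \<rho> X i)) = char (gaussian 0 (K i i))"
  proof
    fix t :: real
    define b where "b = (\<lambda>j. if j = i then t else 0)"
    have s: "(\<Sum>j\<in>I. b j * c j) = t * c i" for c
    proof -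
      have "(\<Sum>j\<in>I. b j * c j) = (\<Sum>j\<in>I. if j = i then t * c i else 0)" by (rule sum.cong) (auto simp: b_def)
      then show ?thesis using assms finite_I by simp
    qed
    have "bilin I K b b = (\<Sum>j\<in>I. b j * (\<Sum>l\<in>I. b l * K j l))" unfolding bilin_def by (simp add: sum_distrib_left mult.assoc)
    then have q: "bilin I K b b = t\<^sup>2 * K i i" unfolding s by (simp add: power2_eq_square)
    have "char (distr (M \<Otimes>\<^sub>M M) borel (corr_copy \<rho> X i)) t = (\<integral>p. iexp (t * corr_copy \<rho> X i p) \<partial>(M \<Otimes>\<^sub>M M))"
      unfolding char_def using corr_copy_meas[OF assms(3)] by (intro integral_distr) auto
    also have "\<dots> = complex_of_real (exp (- (bilin I K (\<lambda>_. 0) (\<lambda>_. 0) + bilin I K b b) / 2 - \<rho> * bilin I K (\<lambda>_. 0) b))"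
      using pair_char_fun[OF assms(1,2), of "\<lambda>_. 0" b] unfolding s by simp
    also have "\<dots> = char (gaussian 0 (K i i)) t"
      unfolding char_gaussian[OF assms(4)] q by (simp add: bilin_def mult.commute)
    finally show "char (distr (M \<Otimes>\<^sub>M M) borel (corr_copy \<rho> X i)) t = char (gaussian 0 (K i i)) t" .
  qed
qed

lemma X_law:
  assumes "i \<in> I" "0 \<le> K i i"
  shows "distr M borel (X i) = gaussian 0 (K i i)"
proof -
  have "distr (M \<Otimes>\<^sub>M M) borel (corr_copy 1 X i) = distr (distr (M \<Otimes>\<^sub>M M) M fst) borel (X i)"
    using X_meas[OF assms(1)] by (subst distr_distr) (auto simp: corr_copy_def comp_def intro!: distr_cong)
  also have "distr (M \<Otimes>\<^sub>M M) M fst = M" by (rule distr_pair_fst)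
  finally show ?thesis using corr_copy_law[of 1 i] assms by simp
qed

text \<open>A Poincare inequality: in the covariance identity with \<open>F = G\<close>, each product of derivatives is bounded in mean by
its two second moments, and summing against the rows of \<open>K\<close> gives \<open>\<kappa>\<close> times the energy of the gradient.
The bound has to be in mean square rather than uniform, since it is applied to differences that are only small in mean.\<close>

lemma variance_bound_L2:
  fixes w :: "('i \<Rightarrow> real) \<Rightarrow> real" and d :: "'i \<Rightarrow> ('i \<Rightarrow> real) \<Rightarrow> real" and \<kappa> \<delta> :: real
  assumes W: "trig_fun I (\<lambda>z. complex_of_real (w z)) (\<lambda>i z. complex_of_real (d i z))"
    and K: "\<And>i. i \<in> I \<Longrightarrow> (\<Sum>j\<in>I. \<bar>K i j\<bar>) \<le> \<kappa>"
    and d: "\<And>i \<rho>. i \<in> I \<Longrightarrow> \<rho> \<in> {0..1} \<Longrightarrow> (\<integral>p. (d i (\<lambda>i. corr_copy \<rho> X i p))\<^sup>2 \<partial>(M \<Otimes>\<^sub>M M)) \<le> \<delta>"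
    and "0 \<le> \<delta>"
  shows "(\<integral>\<omega>. (w (\<lambda>i. X i \<omega>))\<^sup>2 \<partial>M) - (\<integral>\<omega>. w (\<lambda>i. X i \<omega>) \<partial>M)\<^sup>2 \<le> card I * \<kappa> * \<delta>"
proof -
  let ?N = "M \<Otimes>\<^sub>M M"
  define y where "y = (\<lambda>\<rho> p i. corr_copy \<rho> X i p)"
  have yy: "(\<lambda>i. X i (fst p)) = y 1 p" "(\<lambda>i. corr_copy \<rho> X i p) = y \<rho> p" for p \<rho>
    by (auto simp: y_def corr_copy_def)
  have dm: "(\<lambda>p. d i (y \<rho> p)) \<in> borel_measurable ?N" if "i \<in> I" for i \<rho>
  proof -
    have "(\<lambda>p. complex_of_real (d i (y \<rho> p))) \<in> borel_measurable ?N"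
      unfolding y_def by (rule trig_fun_measurable(2)[OF W _ that]) (rule corr_copy_meas)
    from measurable_compose[OF this, of Re borel] show ?thesis by simp
  qed
  obtain B where B: "\<And>i z. i \<in> I \<Longrightarrow> \<bar>d i z\<bar> \<le> B"
    using trig_fun_bounded[OF W finite_I] by (auto simp: norm_of_real)
  have di: "integrable ?N (\<lambda>p. (d i (y \<rho> p))\<^sup>2)" if "i \<in> I" for i \<rho>
    by (rule pair.integrable_bounded[of _ "B\<^sup>2"])
       (use dm[OF that] power_mono[OF B[OF that], of _ 2] in auto)
  have dij: "integrable ?N (\<lambda>p. d i (y 1 p) * d j (y \<rho> p))" if "i \<in> I" "j \<in> I" for i j \<rho>
    by (rule pair.integrable_bounded[of _ "B * B"])
       (use dm that in \<open>auto simp: abs_mult intro!: mult_mono B order.trans[OF abs_ge_zero B]\<close>)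
  have pair: "\<bar>\<integral>p. d i (y 1 p) * d j (y \<rho> p) \<partial>?N\<bar> \<le> \<delta>" if ij: "i \<in> I" "j \<in> I" and \<rho>: "\<rho> \<in> {0..1}" for i j \<rho>
  proof -
    have "\<bar>\<integral>p. d i (y 1 p) * d j (y \<rho> p) \<partial>?N\<bar> \<le> (\<integral>p. \<bar>d i (y 1 p) * d j (y \<rho> p)\<bar> \<partial>?N)"
      by (rule integral_abs_bound)
    also have "\<dots> \<le> (\<integral>p. ((d i (y 1 p))\<^sup>2 + (d j (y \<rho> p))\<^sup>2) / 2 \<partial>?N)"
    proof (rule integral_mono)
      fix p
      have "0 \<le> (\<bar>d i (y 1 p)\<bar> - \<bar>d j (y \<rho> p)\<bar>)\<^sup>2" by simp
      then show "\<bar>d i (y 1 p) * d j (y \<rho> p)\<bar> \<le> ((d i (y 1 p))\<^sup>2 + (d j (y \<rho> p))\<^sup>2) / 2"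
        by (simp add: power2_diff abs_mult)
    qed (use dij di ij in auto)
    also have "\<dots> \<le> \<delta>"
      using d[OF ij(1), of 1] d[OF ij(2) \<rho>] di[OF ij(1)] di[OF ij(2)] by (simp add: y_def)
    finally show ?thesis .
  qed
  have "norm (\<integral>p. (\<Sum>i\<in>I. \<Sum>j\<in>I. complex_of_real (K i j) * complex_of_real (d i (y 1 p)) * complex_of_real (d j (y \<rho> p))) \<partial>?N)
    \<le> card I * \<kappa> * \<delta>" if \<rho>: "\<rho> \<in> {0..1}" for \<rho>
  proof -
    have "(\<integral>p. (\<Sum>i\<in>I. \<Sum>j\<in>I. complex_of_real (K i j) * complex_of_real (d i (y 1 p)) * complex_of_real (d j (y \<rho> p))) \<partial>?N)
      = complex_of_real (\<integral>p. (\<Sum>i\<in>I. \<Sum>j\<in>I. K i j * (d i (y 1 p) * d j (y \<rho> p))) \<partial>?N)"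
      by (simp add: mult.assoc flip: integral_complex_of_real)
    also have "(\<integral>p. (\<Sum>i\<in>I. \<Sum>j\<in>I. K i j * (d i (y 1 p) * d j (y \<rho> p))) \<partial>?N)
      = (\<Sum>i\<in>I. \<Sum>j\<in>I. K i j * (\<integral>p. d i (y 1 p) * d j (y \<rho> p) \<partial>?N))"
      using dij by (simp add: Bochner_Integration.integral_sum)
    also have "norm (complex_of_real \<dots>) \<le> (\<Sum>i\<in>I. \<Sum>j\<in>I. \<bar>K i j\<bar> * \<delta>)"
      unfolding norm_of_real real_norm_def[symmetric]
      using pair \<rho> by (intro sum_norm_le) (auto simp: abs_mult intro!: mult_left_mono)
    also have "\<dots> = (\<Sum>i\<in>I. (\<Sum>j\<in>I. \<bar>K i j\<bar>) * \<delta>)" by (simp add: sum_distrib_right)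
    also have "\<dots> \<le> (\<Sum>i\<in>I. \<kappa> * \<delta>)" using assms by (intro sum_mono mult_right_mono K) auto
    finally show ?thesis by (simp add: mult.assoc)
  qed
  from has_integral_norm_le[OF covariance_identity[OF W W, unfolded yy] this]
  have "norm ((\<integral>\<omega>. complex_of_real (w (\<lambda>i. X i \<omega>)) * complex_of_real (w (\<lambda>i. X i \<omega>)) \<partial>M)
     - (\<integral>\<omega>. complex_of_real (w (\<lambda>i. X i \<omega>)) \<partial>M) * (\<integral>\<omega>. complex_of_real (w (\<lambda>i. X i \<omega>)) \<partial>M)) \<le> card I * \<kappa> * \<delta>" .
  moreover have "(\<integral>\<omega>. complex_of_real (w (\<lambda>i. X i \<omega>)) * complex_of_real (w (\<lambda>i. X i \<omega>)) \<partial>M)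
     - (\<integral>\<omega>. complex_of_real (w (\<lambda>i. X i \<omega>)) \<partial>M) * (\<integral>\<omega>. complex_of_real (w (\<lambda>i. X i \<omega>)) \<partial>M)
     = complex_of_real ((\<integral>\<omega>. (w (\<lambda>i. X i \<omega>))\<^sup>2 \<partial>M) - (\<integral>\<omega>. w (\<lambda>i. X i \<omega>) \<partial>M)\<^sup>2)"
    by (simp add: power2_eq_square flip: of_real_mult)
  ultimately show ?thesis by (simp add: norm_of_real del: of_real_diff)
qed

end

section \<open>Quadratic forms in a transformed Gaussian vector\<close>

text \<open>In each product one factor is small and the other bounded, in mean of order four; the parameter
\<open>\<epsilon>\<close> balances the two.\<close>

lemma young_quartic:
  fixes a b c d \<epsilon> :: real
  assumes "\<epsilon> > 0"
  shows "(a * b + c * d)\<^sup>2 \<le> (a^4 + d^4) / \<epsilon> + \<epsilon> * (b^4 + c^4)"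
proof -
  have y: "2 * (x\<^sup>2 * y\<^sup>2) \<le> x^4 / \<epsilon> + \<epsilon> * y^4" for x y :: real
  proof -
    have "0 \<le> (x\<^sup>2 - \<epsilon> * y\<^sup>2)\<^sup>2 / \<epsilon>" using assms by simp
    also have "\<dots> = x^4 / \<epsilon> + \<epsilon> * y^4 - 2 * (x\<^sup>2 * y\<^sup>2)"
      using assms by (simp add: power2_eq_square power4_eq_xxxx field_simps)
    finally show ?thesis by simp
  qed
  have "0 \<le> (a * b - c * d)\<^sup>2" by simp
  then have "(a * b + c * d)\<^sup>2 \<le> 2 * (a\<^sup>2 * b\<^sup>2) + 2 * (d\<^sup>2 * c\<^sup>2)"
    unfolding power2_sum power2_diff by (simp add: power_mult_distrib mult.commute)
  also have "\<dots> \<le> (a^4 / \<epsilon> + \<epsilon> * b^4) + (d^4 / \<epsilon> + \<epsilon> * c^4)" by (intro add_mono y)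
  finally show ?thesis by (simp add: add_divide_distrib distrib_left)
qed

lemma weighted_sum_square:
  fixes s a :: "'j \<Rightarrow> real"
  shows "(\<Sum>j\<in>J. s j * a j)\<^sup>2 \<le> (\<Sum>j\<in>J. \<bar>s j\<bar>) * (\<Sum>j\<in>J. \<bar>s j\<bar> * (a j)\<^sup>2)"
proof -
  have "\<bar>\<Sum>j\<in>J. s j * a j\<bar> \<le> (\<Sum>j\<in>J. sqrt \<bar>s j\<bar> * (sqrt \<bar>s j\<bar> * \<bar>a j\<bar>))"
    by (rule order.trans[OF sum_abs]) (simp add: abs_mult flip: mult.assoc)
  then have "(\<Sum>j\<in>J. s j * a j)\<^sup>2 \<le> (\<Sum>j\<in>J. sqrt \<bar>s j\<bar> * (sqrt \<bar>s j\<bar> * \<bar>a j\<bar>))\<^sup>2"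
    using power_mono[of "\<bar>\<Sum>j\<in>J. s j * a j\<bar>" _ 2] by simp
  also have "\<dots> \<le> (\<Sum>j\<in>J. (sqrt \<bar>s j\<bar>)\<^sup>2) * (\<Sum>j\<in>J. (sqrt \<bar>s j\<bar> * \<bar>a j\<bar>)\<^sup>2)"
    by (rule Cauchy_Schwarz_ineq_sum)
  finally show ?thesis by (simp add: power_mult_distrib)
qed

text \<open>The change of a product \<open>f * f\<close> into \<open>h * h\<close> is \<open>(f - h) * f + h * (f - h)\<close>, a sum of products in which \<open>a\<close> and
\<open>d\<close> are small and \<open>b\<close> and \<open>c\<close> bounded. Both the gradient of a quadratic form and the form itself change by
weighted sums of this kind.\<close>

lemma (in prob_space) weighted_product_sum_second_moment:
  fixes s :: "'j \<Rightarrow> real" and a b c d :: "'j \<Rightarrow> 'a \<Rightarrow> real" and \<epsilon> m :: real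
  assumes "0 < \<epsilon>"
    and meas: "\<And>j. j \<in> J \<Longrightarrow> a j \<in> borel_measurable M" "\<And>j. j \<in> J \<Longrightarrow> b j \<in> borel_measurable M"
      "\<And>j. j \<in> J \<Longrightarrow> c j \<in> borel_measurable M" "\<And>j. j \<in> J \<Longrightarrow> d j \<in> borel_measurable M"
    and int: "\<And>j. j \<in> J \<Longrightarrow> integrable M (\<lambda>\<omega>. a j \<omega> ^ 4)" "\<And>j. j \<in> J \<Longrightarrow> integrable M (\<lambda>\<omega>. b j \<omega> ^ 4)"
      "\<And>j. j \<in> J \<Longrightarrow> integrable M (\<lambda>\<omega>. c j \<omega> ^ 4)" "\<And>j. j \<in> J \<Longrightarrow> integrable M (\<lambda>\<omega>. d j \<omega> ^ 4)"
    and small: "\<And>j. j \<in> J \<Longrightarrow> (\<integral>\<omega>. a j \<omega> ^ 4 \<partial>M) \<le> \<epsilon>\<^sup>2" "\<And>j. j \<in> J \<Longrightarrow> (\<integral>\<omega>. d j \<omega> ^ 4 \<partial>M) \<le> \<epsilon>\<^sup>2"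
    and large: "\<And>j. j \<in> J \<Longrightarrow> (\<integral>\<omega>. b j \<omega> ^ 4 \<partial>M) \<le> m" "\<And>j. j \<in> J \<Longrightarrow> (\<integral>\<omega>. c j \<omega> ^ 4 \<partial>M) \<le> m"
  defines "S \<equiv> \<lambda>\<omega>. \<Sum>j\<in>J. s j * (a j \<omega> * b j \<omega> + c j \<omega> * d j \<omega>)"
  shows "integrable M (\<lambda>\<omega>. (S \<omega>)\<^sup>2)" "(\<integral>\<omega>. (S \<omega>)\<^sup>2 \<partial>M) \<le> (\<Sum>j\<in>J. \<bar>s j\<bar>)\<^sup>2 * (2 * \<epsilon> * (1 + m))"
proof -
  define R where "R = (\<lambda>j \<omega>. (a j \<omega> ^ 4 + d j \<omega> ^ 4) / \<epsilon> + \<epsilon> * (b j \<omega> ^ 4 + c j \<omega> ^ 4))"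
  have Ri: "integrable M (R j)" "(\<integral>\<omega>. R j \<omega> \<partial>M) \<le> 2 * \<epsilon> * (1 + m)" if j: "j \<in> J" for j
  proof -
    show "integrable M (R j)" unfolding R_def using int j by auto
    have "(\<integral>\<omega>. R j \<omega> \<partial>M) = ((\<integral>\<omega>. a j \<omega> ^ 4 \<partial>M) + (\<integral>\<omega>. d j \<omega> ^ 4 \<partial>M)) / \<epsilon>
        + \<epsilon> * ((\<integral>\<omega>. b j \<omega> ^ 4 \<partial>M) + (\<integral>\<omega>. c j \<omega> ^ 4 \<partial>M))"
      unfolding R_def using int j by simp
    also have "\<dots> \<le> (\<epsilon>\<^sup>2 + \<epsilon>\<^sup>2) / \<epsilon> + \<epsilon> * (m + m)"
      using small large j \<open>0 < \<epsilon>\<close> by (intro add_mono divide_right_mono mult_left_mono) auto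
    also have "\<dots> = 2 * \<epsilon> * (1 + m)" using \<open>0 < \<epsilon>\<close> by (simp add: power2_eq_square field_simps)
    finally show "(\<integral>\<omega>. R j \<omega> \<partial>M) \<le> 2 * \<epsilon> * (1 + m)" .
  qed
  let ?s = "\<Sum>j\<in>J. \<bar>s j\<bar>"
  have pw: "(S \<omega>)\<^sup>2 \<le> ?s * (\<Sum>j\<in>J. \<bar>s j\<bar> * R j \<omega>)" for \<omega>
  proof -
    have "(S \<omega>)\<^sup>2 \<le> ?s * (\<Sum>j\<in>J. \<bar>s j\<bar> * (a j \<omega> * b j \<omega> + c j \<omega> * d j \<omega>)\<^sup>2)"
      unfolding S_def by (rule weighted_sum_square)
    also have "\<dots> \<le> ?s * (\<Sum>j\<in>J. \<bar>s j\<bar> * R j \<omega>)"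
      unfolding R_def by (intro mult_left_mono sum_mono young_quartic[OF \<open>0 < \<epsilon>\<close>]) (auto intro: sum_nonneg)
    finally show ?thesis .
  qed
  have Rsum: "integrable M (\<lambda>\<omega>. ?s * (\<Sum>j\<in>J. \<bar>s j\<bar> * R j \<omega>))"
    using Ri by (intro integrable_mult_right Bochner_Integration.integrable_sum) auto
  show Si: "integrable M (\<lambda>\<omega>. (S \<omega>)\<^sup>2)"
    unfolding S_def by (rule integrable_dominated[OF Rsum _ _ pw[unfolded S_def]]) (use meas in auto)
  have "(\<integral>\<omega>. (S \<omega>)\<^sup>2 \<partial>M) \<le> (\<integral>\<omega>. ?s * (\<Sum>j\<in>J. \<bar>s j\<bar> * R j \<omega>) \<partial>M)"
    by (rule integral_mono[OF Si Rsum pw])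
  also have "\<dots> = ?s * (\<Sum>j\<in>J. \<bar>s j\<bar> * (\<integral>\<omega>. R j \<omega> \<partial>M))"
    using Ri(1) by (simp add: Bochner_Integration.integral_sum)
  also have "\<dots> \<le> ?s * (\<Sum>j\<in>J. \<bar>s j\<bar> * (2 * \<epsilon> * (1 + m)))"
    using Ri(2) by (intro mult_left_mono sum_mono) (auto intro!: sum_nonneg)
  also have "\<dots> = ?s\<^sup>2 * (2 * \<epsilon> * (1 + m))"
    unfolding sum_distrib_right[symmetric] by (simp add: power2_eq_square mult.assoc)
  finally show "(\<integral>\<omega>. (S \<omega>)\<^sup>2 \<partial>M) \<le> ?s\<^sup>2 * (2 * \<epsilon> * (1 + m))" .
qed

definition qform :: "'i set \<Rightarrow> ('i \<Rightarrow> 'i \<Rightarrow> real) \<Rightarrow> (real \<Rightarrow> real) \<Rightarrow> ('i \<Rightarrow> real) \<Rightarrow> real" where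
  "qform I A f z = (\<Sum>i\<in>I. \<Sum>j\<in>I. A i j * (f (z i) * f (z j)))"

lemma sum_product_rule:
  fixes a b :: "'i \<Rightarrow> real"
  assumes "finite I" "l \<in> I"
  shows "(\<Sum>i\<in>I. \<Sum>j\<in>I. A i j * ((if l = i then a i else 0) * b j + b i * (if l = j then a j else 0)))
    = a l * (\<Sum>j\<in>I. (A l j + A j l) * b j)"
proof -
  have "(\<Sum>i\<in>I. \<Sum>j\<in>I. A i j * ((if l = i then a i else 0) * b j)) = (\<Sum>i\<in>I. if l = i then \<Sum>j\<in>I. A l j * (a l * b j) else 0)"
    by (rule sum.cong) auto
  also have "\<dots> = (\<Sum>j\<in>I. A l j * (a l * b j))" using assms by simp
  finally have 1: "(\<Sum>i\<in>I. \<Sum>j\<in>I. A i j * ((if l = i then a i else 0) * b j)) = (\<Sum>j\<in>I. A l j * (a l * b j))" .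
  have "(\<Sum>j\<in>I. A i j * (b i * (if l = j then a j else 0))) = (\<Sum>j\<in>I. if l = j then A i l * (b i * a l) else 0)" for i
    by (rule sum.cong) auto
  then have 2: "(\<Sum>j\<in>I. A i j * (b i * (if l = j then a j else 0))) = A i l * (b i * a l)" for i
    using assms by simp
  show ?thesis
    by (simp only: distrib_left sum.distrib 1 2) (simp add: sum_distrib_left distrib_left distrib_right sum.distrib mult_ac)
qed

lemma trig_fun_qform:
  fixes I :: "'i set"
  assumes f: "trig_coord TYPE('i) f f'" and I: "finite I"
  shows "trig_fun I (\<lambda>z. complex_of_real (qform I A f z))
    (\<lambda>l z. complex_of_real (f' (z l) * (\<Sum>j\<in>I. (A l j + A j l) * f (z j))))"
proof -
  have t: "trig_fun I (\<lambda>z. complex_of_real (f (z i))) (\<lambda>j z. if j = i then complex_of_real (f' (z i)) else 0)" if "i \<in> I" for i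
    using f I that by (auto simp: trig_coord_def)
  have "trig_fun I (\<lambda>z. \<Sum>i\<in>I. \<Sum>j\<in>I. complex_of_real (A i j) * (complex_of_real (f (z i)) * complex_of_real (f (z j))))
    (\<lambda>l z. \<Sum>i\<in>I. \<Sum>j\<in>I. complex_of_real (A i j) * ((if l = i then complex_of_real (f' (z i)) else 0) * complex_of_real (f (z j))
       + complex_of_real (f (z i)) * (if l = j then complex_of_real (f' (z j)) else 0)))"
    by (intro trig_fun_sum trig_fun.scale trig_fun_mult t I)
  then show ?thesis
  proof (rule trig_fun_cong)
    show "complex_of_real (qform I A f z) = (\<Sum>i\<in>I. \<Sum>j\<in>I. complex_of_real (A i j) * (complex_of_real (f (z i)) * complex_of_real (f (z j))))" for z
      by (simp add: qform_def)
    fix l z assume l: "l \<in> I"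
    have "(\<Sum>i\<in>I. \<Sum>j\<in>I. complex_of_real (A i j) * ((if l = i then complex_of_real (f' (z i)) else 0) * complex_of_real (f (z j))
       + complex_of_real (f (z i)) * (if l = j then complex_of_real (f' (z j)) else 0)))
      = complex_of_real (\<Sum>i\<in>I. \<Sum>j\<in>I. A i j * ((if l = i then f' (z i) else 0) * f (z j) + f (z i) * (if l = j then f' (z j) else 0)))"
      unfolding of_real_sum by (intro sum.cong refl) simp
    then show "complex_of_real (f' (z l) * (\<Sum>j\<in>I. (A l j + A j l) * f (z j))) =
       (\<Sum>i\<in>I. \<Sum>j\<in>I. complex_of_real (A i j) * ((if l = i then complex_of_real (f' (z i)) else 0) * complex_of_real (f (z j))
       + complex_of_real (f (z i)) * (if l = j then complex_of_real (f' (z j)) else 0)))"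
      using sum_product_rule[OF I l, of A "\<lambda>i. f' (z i)" "\<lambda>i. f (z i)"] by simp
  qed
qed

lemma trig_fun_qform_grad:
  fixes I :: "'i set"
  assumes f: "trig_coord TYPE('i) f f'" and f': "trig_coord TYPE('i) f' f''" and I: "finite I" and l: "l \<in> I"
  shows "trig_fun I (\<lambda>z. complex_of_real (f' (z l) * (\<Sum>j\<in>I. S j * f (z j))))
    (\<lambda>m z. complex_of_real ((if m = l then f'' (z l) * (\<Sum>j\<in>I. S j * f (z j)) else 0) + f' (z l) * (S m * f' (z m))))"
proof -
  have t: "trig_fun I (\<lambda>z. complex_of_real (f (z i))) (\<lambda>j z. if j = i then complex_of_real (f' (z i)) else 0)"
    "trig_fun I (\<lambda>z. complex_of_real (f' (z i))) (\<lambda>j z. if j = i then complex_of_real (f'' (z i)) else 0)" if "i \<in> I" for i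
    using f f' I that by (auto simp: trig_coord_def)
  have "trig_fun I (\<lambda>z. complex_of_real (f' (z l)) * (\<Sum>j\<in>I. complex_of_real (S j) * complex_of_real (f (z j))))
    (\<lambda>m z. (if m = l then complex_of_real (f'' (z l)) else 0) * (\<Sum>j\<in>I. complex_of_real (S j) * complex_of_real (f (z j)))
      + complex_of_real (f' (z l)) * (\<Sum>j\<in>I. complex_of_real (S j) * (if m = j then complex_of_real (f' (z j)) else 0)))"
    by (intro trig_fun_mult trig_fun_sum trig_fun.scale t I l)
  then show ?thesis
  proof (rule trig_fun_cong)
    fix m z assume m: "m \<in> I"
    have "(\<Sum>j\<in>I. complex_of_real (S j) * (if m = j then complex_of_real (f' (z j)) else 0))
      = (\<Sum>j\<in>I. if m = j then complex_of_real (S m) * complex_of_real (f' (z m)) else 0)"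
      by (rule sum.cong) auto
    also have "\<dots> = complex_of_real (S m) * complex_of_real (f' (z m))" using m I by simp
    finally show "complex_of_real ((if m = l then f'' (z l) * (\<Sum>j\<in>I. S j * f (z j)) else 0) + f' (z l) * (S m * f' (z m))) =
       (if m = l then complex_of_real (f'' (z l)) else 0) * (\<Sum>j\<in>I. complex_of_real (S j) * complex_of_real (f (z j)))
      + complex_of_real (f' (z l)) * (\<Sum>j\<in>I. complex_of_real (S j) * (if m = j then complex_of_real (f' (z j)) else 0))"
      by simp
  qed simp
qed

lemma sum_weight_le:
  fixes S g :: "'i \<Rightarrow> real"
  assumes "\<And>j. \<bar>g j\<bar> \<le> B" "(\<Sum>j\<in>I. \<bar>S j\<bar>) \<le> \<beta>" "0 \<le> B"
  shows "\<bar>\<Sum>j\<in>I. S j * g j\<bar> \<le> \<beta> * B"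
proof -
  have "\<bar>\<Sum>j\<in>I. S j * g j\<bar> \<le> (\<Sum>j\<in>I. \<bar>S j\<bar> * B)"
    using assms(1) by (intro order.trans[OF sum_abs] sum_mono) (auto simp: abs_mult intro!: mult_left_mono)
  also have "\<dots> \<le> \<beta> * B" using mult_right_mono[OF assms(2,3)] by (simp add: sum_distrib_right)
  finally show ?thesis .
qed

context gaussian_family
begin

context
  fixes A :: "'i \<Rightarrow> 'i \<Rightarrow> real" and \<kappa> \<alpha> :: real
  assumes K: "\<And>i. i \<in> I \<Longrightarrow> (\<Sum>j\<in>I. \<bar>K i j\<bar>) \<le> \<kappa>"
    and rows: "\<And>i. i \<in> I \<Longrightarrow> (\<Sum>j\<in>I. \<bar>A i j\<bar>) \<le> \<alpha>" and cols: "\<And>i. i \<in> I \<Longrightarrow> (\<Sum>j\<in>I. \<bar>A j i\<bar>) \<le> \<alpha>"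
    and pos: "0 \<le> \<kappa>" "0 \<le> \<alpha>"
begin

lemma sym_rows: "l \<in> I \<Longrightarrow> (\<Sum>j\<in>I. \<bar>A l j + A j l\<bar>) \<le> 2 * \<alpha>"
proof -
  assume l: "l \<in> I"
  have "(\<Sum>j\<in>I. \<bar>A l j + A j l\<bar>) \<le> (\<Sum>j\<in>I. \<bar>A l j\<bar> + \<bar>A j l\<bar>)" by (intro sum_mono abs_triangle_ineq)
  then show ?thesis using rows[OF l] cols[OF l] by (simp add: sum.distrib)
qed

text \<open>With \<open>c = n\<^sup>-\<^sup>1\<^sup>/\<^sup>2\<close> and \<open>card I = n\<close>, the bound on the characteristic function is of order \<open>n\<^sup>-\<^sup>1\<^sup>/\<^sup>2\<close> and the
bound on the variance is constant: the \<open>l\<close>-th derivative \<open>f' (z l) * (\<Sum>j. (A l j + A j l) * f (z j))\<close> and the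
column sums of the Hessian are bounded by \<open>4 \<alpha> B\<^sup>2\<close>.\<close>

lemma qform_clt_rate:
  fixes f f' f'' :: "real \<Rightarrow> real" and B c m t :: real
  assumes f: "trig_coord TYPE('i) f f'" and f': "trig_coord TYPE('i) f' f''"
    and B: "\<And>x. \<bar>f x\<bar> \<le> B" "\<And>x. \<bar>f' x\<bar> \<le> B" "\<And>x. \<bar>f'' x\<bar> \<le> B" and "0 \<le> c"
    and m: "m = (\<integral>\<omega>. qform I A f (\<lambda>i. X i \<omega>) \<partial>M)"
  defines "w \<equiv> \<lambda>\<omega>. c * (qform I A f (\<lambda>i. X i \<omega>) - m)"
  shows "norm ((\<integral>\<omega>. iexp (t * w \<omega>) \<partial>M) - exp (- ((\<integral>\<omega>. (w \<omega>)\<^sup>2 \<partial>M) * t\<^sup>2) / 2))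
      \<le> 4 * card I * \<kappa>\<^sup>2 * (c * (4 * \<alpha> * B\<^sup>2))^3 * \<bar>t\<bar>^3"
    and "(\<integral>\<omega>. (w \<omega>)\<^sup>2 \<partial>M) \<le> card I * \<kappa> * (c * (4 * \<alpha> * B\<^sup>2))\<^sup>2"
proof -
  have B0: "0 \<le> B" using B(1)[of 0] by linarith
  define b where "b = c * (4 * \<alpha> * B\<^sup>2)"
  have b0: "0 \<le> b" unfolding b_def using \<open>0 \<le> c\<close> pos by simp
  define g where "g = (\<lambda>z. c * (qform I A f z - m))"
  define D where "D = (\<lambda>l z. c * (f' (z l) * (\<Sum>j\<in>I. (A l j + A j l) * f (z j))))"
  define H where "H = (\<lambda>l m z. c * ((if m = l then f'' (z l) * (\<Sum>j\<in>I. (A l j + A j l) * f (z j)) else 0) + f' (z l) * ((A l m + A m l) * f' (z m))))"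
  have W: "trig_fun I (\<lambda>z. complex_of_real (g z)) (\<lambda>l z. complex_of_real (D l z))"
    by (rule trig_fun_cong[OF trig_fun.scale[OF trig_fun_diff[OF trig_fun_qform[OF f finite_I, of A] trig_fun_const[of I "complex_of_real m"]], of "complex_of_real c"]])
       (simp_all add: g_def D_def)
  have D: "trig_fun I (\<lambda>z. complex_of_real (D l z)) (\<lambda>m z. complex_of_real (H l m z))" if "l \<in> I" for l
    by (rule trig_fun_cong[OF trig_fun.scale[OF trig_fun_qform_grad[OF f f' finite_I that, of "\<lambda>j. A l j + A j l"], of "complex_of_real c"]])
       (simp_all add: D_def H_def)
  have S: "\<bar>\<Sum>j\<in>I. (A l j + A j l) * f (z j)\<bar> \<le> 2 * \<alpha> * B" if "l \<in> I" for l z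
    by (rule sum_weight_le[OF B(1) sym_rows[OF that] B0])
  have Db: "\<bar>D l z\<bar> \<le> b" if "l \<in> I" for l z
  proof -
    have "\<bar>D l z\<bar> \<le> c * (B * (2 * \<alpha> * B))"
      unfolding D_def abs_mult using S[OF that] B(2) B0 \<open>0 \<le> c\<close> by (intro mult_mono) auto
    also have "\<dots> \<le> b" unfolding b_def using \<open>0 \<le> c\<close> pos B0
      by (intro mult_left_mono) (auto simp: power2_eq_square mult_ac)
    finally show ?thesis .
  qed
  have Hb: "(\<Sum>l\<in>I. \<bar>H l m z\<bar>) \<le> b" if m: "m \<in> I" for m z
  proof -
    have "(\<Sum>l\<in>I. \<bar>H l m z\<bar>) \<le> (\<Sum>l\<in>I. c * ((if m = l then B * (2 * \<alpha> * B) else 0) + B * (\<bar>A m l + A l m\<bar> * B)))"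
    proof (intro sum_mono)
      fix l assume l: "l \<in> I"
      have H1: "\<bar>f'' (z l) * (\<Sum>j\<in>I. (A l j + A j l) * f (z j))\<bar> \<le> B * (2 * \<alpha> * B)"
        unfolding abs_mult using S[OF l] B(3) B0 by (intro mult_mono) auto
      have H2: "\<bar>f' (z l) * ((A l m + A m l) * f' (z m))\<bar> \<le> B * (\<bar>A m l + A l m\<bar> * B)"
        unfolding abs_mult using B(2) B0 by (intro mult_mono) (auto simp: add.commute)
      have tri: "\<bar>(if P then x else 0) + y\<bar> \<le> (if P then b1 else 0) + b2" if "\<bar>x\<bar> \<le> b1" "\<bar>y\<bar> \<le> b2"
        for x y b1 b2 :: real and P using that by auto
      show "\<bar>H l m z\<bar> \<le> c * ((if m = l then B * (2 * \<alpha> * B) else 0) + B * (\<bar>A m l + A l m\<bar> * B))"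
        unfolding H_def abs_mult[of c] abs_of_nonneg[OF \<open>0 \<le> c\<close>]
        by (intro mult_left_mono tri H1 H2 \<open>0 \<le> c\<close>)
    qed
    also have "\<dots> = c * (B * (2 * \<alpha> * B) + B * B * (\<Sum>l\<in>I. \<bar>A m l + A l m\<bar>))"
      using m finite_I by (simp add: sum.distrib sum_distrib_left distrib_left if_distrib[of "\<lambda>x. c * x"] mult_ac cong: if_cong)
    also have "\<dots> \<le> c * (B * (2 * \<alpha> * B) + B * B * (2 * \<alpha>))"
      using sym_rows[OF m] B0 \<open>0 \<le> c\<close> by (intro mult_left_mono add_left_mono) auto
    also have "\<dots> = b" by (simp add: b_def power2_eq_square)
    finally show ?thesis .
  qed
  have qm: "integrable M (\<lambda>\<omega>. qform I A f (\<lambda>i. X i \<omega>))" and gm: "(\<lambda>\<omega>. g (\<lambda>i. X i \<omega>)) \<in> borel_measurable M"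
  proof -
    note T = trig_fun_qform[OF f finite_I, of A]
    obtain C where C: "\<And>z. \<bar>qform I A f z\<bar> \<le> C" using trig_fun_bounded[OF T finite_I] by (auto simp: norm_of_real)
    have "(\<lambda>\<omega>. complex_of_real (qform I A f (\<lambda>i. X i \<omega>))) \<in> borel_measurable M"
      by (rule trig_fun_measurable(1)[OF T]) (rule X_meas)
    from measurable_compose[OF this, of Re borel]
    have "(\<lambda>\<omega>. qform I A f (\<lambda>i. X i \<omega>)) \<in> borel_measurable M" by simp
    then show "integrable M (\<lambda>\<omega>. qform I A f (\<lambda>i. X i \<omega>))" "(\<lambda>\<omega>. g (\<lambda>i. X i \<omega>)) \<in> borel_measurable M"
      using C by (auto intro!: integrable_bounded simp: g_def)
  qed
  have mean: "(\<integral>\<omega>. g (\<lambda>i. X i \<omega>) \<partial>M) = 0"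
    using qm by (simp add: g_def m prob_space)
  obtain C where C: "\<And>z. \<bar>g z\<bar> \<le> C" using trig_fun_bounded[OF W finite_I] by (auto simp: norm_of_real)
  have "norm ((\<integral>\<omega>. iexp (t * g (\<lambda>i. X i \<omega>)) \<partial>M) - exp (- ((\<integral>\<omega>. (g (\<lambda>i. X i \<omega>))\<^sup>2 \<partial>M) * t\<^sup>2) / 2))
      \<le> (4 * card I * \<kappa>\<^sup>2 * b^3) * \<bar>t\<bar>^3"
  proof (rule approximate_stein_imp_char_close[OF gm C])
    fix t :: real
    show "norm ((\<integral>\<omega>. complex_of_real (g (\<lambda>i. X i \<omega>)) * iexp (t * g (\<lambda>i. X i \<omega>)) \<partial>M)
      - \<i> * t * (\<integral>\<omega>. (g (\<lambda>i. X i \<omega>))\<^sup>2 \<partial>M) * (\<integral>\<omega>. iexp (t * g (\<lambda>i. X i \<omega>)) \<partial>M)) \<le> (4 * card I * \<kappa>\<^sup>2 * b^3) * t\<^sup>2"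
      by (rule stein_covariance_bound[OF W D K _ _ pos(1) b0 mean]) (use Db Hb in \<open>auto simp: norm_of_real\<close>)
  qed (use b0 in auto)
  then show "norm ((\<integral>\<omega>. iexp (t * w \<omega>) \<partial>M) - exp (- ((\<integral>\<omega>. (w \<omega>)\<^sup>2 \<partial>M) * t\<^sup>2) / 2))
      \<le> 4 * card I * \<kappa>\<^sup>2 * (c * (4 * \<alpha> * B\<^sup>2))^3 * \<bar>t\<bar>^3"
    by (simp only: g_def w_def b_def)
  have "norm ((\<integral>\<omega>. complex_of_real (g (\<lambda>i. X i \<omega>)) * complex_of_real (g (\<lambda>i. X i \<omega>)) \<partial>M)
     - (\<integral>\<omega>. complex_of_real (g (\<lambda>i. X i \<omega>)) \<partial>M) * (\<integral>\<omega>. complex_of_real (g (\<lambda>i. X i \<omega>)) \<partial>M)) \<le> card I * \<kappa> * b * b"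
    by (rule covariance_bound[OF W W K]) (use Db b0 pos in \<open>auto simp: norm_of_real\<close>)
  moreover have "(\<integral>\<omega>. complex_of_real (g (\<lambda>i. X i \<omega>)) * complex_of_real (g (\<lambda>i. X i \<omega>)) \<partial>M) = complex_of_real (\<integral>\<omega>. (w \<omega>)\<^sup>2 \<partial>M)"
    by (simp add: g_def w_def power2_eq_square flip: of_real_mult)
  ultimately show "(\<integral>\<omega>. (w \<omega>)\<^sup>2 \<partial>M) \<le> card I * \<kappa> * (c * (4 * \<alpha> * B\<^sup>2))\<^sup>2"
    unfolding b_def[symmetric] using mean by (simp add: norm_of_real power2_eq_square mult.assoc)
qed

text \<open>For \<open>c\<^sup>2 * card I = 1\<close> the bound is independent of the number of variables, thanks to the Poincare inequality:
the size of \<open>I\<close> enters once, not through the square of the number of terms of the quadratic form.\<close>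

lemma qform_diff_variance:
  fixes f f' h h' :: "real \<Rightarrow> real" and c v \<epsilon> m :: real
  assumes f: "trig_coord TYPE('i) f f'" and h: "trig_coord TYPE('i) h h'"
    and v: "\<And>i. i \<in> I \<Longrightarrow> K i i = v" "0 \<le> v" and "0 < \<epsilon>" "0 \<le> m"
    and meas: "f \<in> borel_measurable borel" "f' \<in> borel_measurable borel" "h \<in> borel_measurable borel" "h' \<in> borel_measurable borel"
    and bdd: "\<And>x. \<bar>f x\<bar> \<le> B" "\<And>x. \<bar>f' x\<bar> \<le> B" "\<And>x. \<bar>h x\<bar> \<le> B" "\<And>x. \<bar>h' x\<bar> \<le> B"
    and small: "(\<integral>x. (f x - h x)^4 \<partial>gaussian 0 v) \<le> \<epsilon>\<^sup>2" "(\<integral>x. (f' x - h' x)^4 \<partial>gaussian 0 v) \<le> \<epsilon>\<^sup>2"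
    and large: "(\<integral>x. (f x)^4 \<partial>gaussian 0 v) \<le> m" "(\<integral>x. (h' x)^4 \<partial>gaussian 0 v) \<le> m"
  defines "w \<equiv> \<lambda>\<omega>. c * (qform I A f (\<lambda>i. X i \<omega>) - qform I A h (\<lambda>i. X i \<omega>))"
  shows "(\<integral>\<omega>. (w \<omega>)\<^sup>2 \<partial>M) - (\<integral>\<omega>. w \<omega> \<partial>M)\<^sup>2 \<le> card I * \<kappa> * (c\<^sup>2 * (8 * \<alpha>\<^sup>2 * \<epsilon> * (1 + m)))"
proof -
  let ?g = "\<lambda>z. c * (qform I A f z - qform I A h z)"
  let ?S = "\<lambda>l j. A l j + A j l"
  let ?u = "\<lambda>x. f x - h x" and ?u' = "\<lambda>x. f' x - h' x"
  let ?\<gamma> = "gaussian 0 v" and ?N = "M \<Otimes>\<^sub>M M"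
  interpret G: real_distribution ?\<gamma> by (rule real_distribution_gaussian[OF v(2)])
  define D where "D = (\<lambda>l z. c * (f' (z l) * (\<Sum>j\<in>I. ?S l j * f (z j)) - h' (z l) * (\<Sum>j\<in>I. ?S l j * h (z j))))"
  have W: "trig_fun I (\<lambda>z. complex_of_real (?g z)) (\<lambda>l z. complex_of_real (D l z))"
    by (rule trig_fun_cong[OF trig_fun.scale[OF trig_fun_diff[OF trig_fun_qform[OF f finite_I, of A] trig_fun_qform[OF h finite_I, of A]], of "complex_of_real c"]])
       (simp_all add: D_def)
  define \<delta> where "\<delta> = c\<^sup>2 * (8 * \<alpha>\<^sup>2 * \<epsilon> * (1 + m))"
  have int4: "integrable ?\<gamma> (\<lambda>x. g x ^ 4)" if "g \<in> borel_measurable borel" "\<And>x. \<bar>g x\<bar> \<le> C" for g :: "real \<Rightarrow> real" and C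
    using that power_mono[OF that(2), of _ 4] by (intro G.integrable_bounded[of _ "C^4"]) (auto simp: power_abs)
  have u_bdd: "\<bar>?u x\<bar> \<le> 2 * B" "\<bar>?u' x\<bar> \<le> 2 * B" for x
    using bdd(1)[of x] bdd(2)[of x] bdd(3)[of x] bdd(4)[of x] by linarith+
  have i4: "integrable ?\<gamma> (\<lambda>x. ?u x ^ 4)" "integrable ?\<gamma> (\<lambda>x. ?u' x ^ 4)" "integrable ?\<gamma> (\<lambda>x. f x ^ 4)" "integrable ?\<gamma> (\<lambda>x. h' x ^ 4)"
    using meas by (auto intro!: int4[OF _ u_bdd(1)] int4[OF _ u_bdd(2)] int4[OF _ bdd(1)] int4[OF _ bdd(4)])
  have "(\<integral>p. (D l (\<lambda>i. corr_copy \<rho> X i p))\<^sup>2 \<partial>?N) \<le> \<delta>" if l: "l \<in> I" and \<rho>: "\<rho> \<in> {0..1}" for l \<rho>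
  proof -
    let ?y = "\<lambda>i p. corr_copy \<rho> X i p"
    have law: "distr ?N borel (?y i) = ?\<gamma>" if "i \<in> I" for i
      using corr_copy_law[of \<rho> i] v that \<rho> by simp
    have tr: "integrable ?N (\<lambda>p. g (?y i p))" "(\<integral>p. g (?y i p) \<partial>?N) = (\<integral>x. g x \<partial>?\<gamma>)"
      if "integrable ?\<gamma> g" "i \<in> I" for g :: "real \<Rightarrow> real" and i
    proof -
      have gm: "g \<in> borel_measurable borel" using borel_measurable_integrable[OF that(1)] by simp
      show "integrable ?N (\<lambda>p. g (?y i p))" "(\<integral>p. g (?y i p) \<partial>?N) = (\<integral>x. g x \<partial>?\<gamma>)"
        using that(1) gm unfolding law[OF that(2), symmetric]
        by (simp_all add: integrable_distr_eq integral_distr corr_copy_meas[OF that(2)])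
    qed
    have gm: "(\<lambda>p. g (?y i p)) \<in> borel_measurable ?N" if "g \<in> borel_measurable borel" "i \<in> I" for g :: "real \<Rightarrow> real" and i
      using measurable_compose[OF corr_copy_meas[OF that(2)] that(1)] .
    have um: "?u \<in> borel_measurable borel" "?u' \<in> borel_measurable borel" using meas by auto
    have D: "D l (\<lambda>i. ?y i p) = c * (\<Sum>j\<in>I. ?S l j * (?u' (?y l p) * f (?y j p) + h' (?y l p) * ?u (?y j p)))" for p
      unfolding D_def by (simp add: sum_distrib_left sum_subtractf sum.distrib algebra_simps)
    have "(\<integral>p. (\<Sum>j\<in>I. ?S l j * (?u' (?y l p) * f (?y j p) + h' (?y l p) * ?u (?y j p)))\<^sup>2 \<partial>?N)
        \<le> (\<Sum>j\<in>I. \<bar>?S l j\<bar>)\<^sup>2 * (2 * \<epsilon> * (1 + m))"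
      by (rule pair.weighted_product_sum_second_moment(2)[OF \<open>0 < \<epsilon>\<close>])
         (use gm[OF um(1)] gm[OF um(2) l] gm[OF meas(1)] gm[OF meas(4) l] small large
            tr[OF i4(1)] tr[OF i4(2) l] tr[OF i4(3)] tr[OF i4(4) l] in simp_all)
    then have "(\<integral>p. (D l (\<lambda>i. ?y i p))\<^sup>2 \<partial>?N) \<le> c\<^sup>2 * ((\<Sum>j\<in>I. \<bar>?S l j\<bar>)\<^sup>2 * (2 * \<epsilon> * (1 + m)))"
      unfolding D power_mult_distrib[of c] by (simp add: mult_left_mono)
    also have "\<dots> \<le> c\<^sup>2 * ((2 * \<alpha>)\<^sup>2 * (2 * \<epsilon> * (1 + m)))"
      using sym_rows[OF l] \<open>0 < \<epsilon>\<close> \<open>0 \<le> m\<close>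
      by (intro mult_left_mono mult_right_mono power_mono) (auto intro: sum_nonneg)
    also have "\<dots> = \<delta>" by (simp add: \<delta>_def power2_eq_square)
    finally show ?thesis .
  qed
  moreover have "0 \<le> \<delta>" using \<open>0 < \<epsilon>\<close> \<open>0 \<le> m\<close> by (simp add: \<delta>_def)
  ultimately show ?thesis
    unfolding w_def \<delta>_def[symmetric] by (intro variance_bound_L2[OF W K]) auto
qed

end

text \<open>A crude bound whose constant grows with \<open>I\<close>. It holds for every function with fourth moments, and serves to pass from trigonometric
polynomials to the transformation itself while \<open>I\<close> is fixed.\<close>

lemma qform_diff_second_moment:
  fixes A :: "'i \<Rightarrow> 'i \<Rightarrow> real" and f h :: "real \<Rightarrow> real" and c v \<epsilon> m :: real
  assumes v: "\<And>i. i \<in> I \<Longrightarrow> K i i = v" "0 \<le> v" and "0 < \<epsilon>" "0 \<le> m"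
    and meas: "f \<in> borel_measurable borel" "h \<in> borel_measurable borel"
    and i4: "integrable (gaussian 0 v) (\<lambda>x. f x ^ 4)" "integrable (gaussian 0 v) (\<lambda>x. h x ^ 4)" "integrable (gaussian 0 v) (\<lambda>x. (f x - h x) ^ 4)"
    and small: "(\<integral>x. (f x - h x)^4 \<partial>gaussian 0 v) \<le> \<epsilon>\<^sup>2"
    and large: "(\<integral>x. (f x)^4 \<partial>gaussian 0 v) \<le> m" "(\<integral>x. (h x)^4 \<partial>gaussian 0 v) \<le> m"
  defines "w \<equiv> \<lambda>\<omega>. c * (qform I A f (\<lambda>i. X i \<omega>) - qform I A h (\<lambda>i. X i \<omega>))"
  shows "integrable M (\<lambda>\<omega>. (w \<omega>)\<^sup>2)" "(\<integral>\<omega>. (w \<omega>)\<^sup>2 \<partial>M) \<le> c\<^sup>2 * ((\<Sum>i\<in>I. \<Sum>j\<in>I. \<bar>A i j\<bar>)\<^sup>2 * (2 * \<epsilon> * (1 + m)))"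
proof -
  let ?\<gamma> = "gaussian 0 v" and ?u = "\<lambda>x. f x - h x"
  interpret G: real_distribution ?\<gamma> by (rule real_distribution_gaussian[OF v(2)])
  have law: "distr M borel (X i) = ?\<gamma>" if "i \<in> I" for i using X_law v that by simp
  have tr: "integrable M (\<lambda>p. g (X i p))" "(\<integral>p. g (X i p) \<partial>M) = (\<integral>x. g x \<partial>?\<gamma>)"
    if "integrable ?\<gamma> g" "i \<in> I" for g :: "real \<Rightarrow> real" and i
  proof -
    have gm: "g \<in> borel_measurable borel" using borel_measurable_integrable[OF that(1)] by simp
    show "integrable M (\<lambda>p. g (X i p))" "(\<integral>p. g (X i p) \<partial>M) = (\<integral>x. g x \<partial>?\<gamma>)"
      using that(1) gm unfolding law[OF that(2), symmetric]
      by (simp_all add: integrable_distr_eq integral_distr X_meas[OF that(2)])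
  qed
  have gm: "(\<lambda>\<omega>. g (X i \<omega>)) \<in> borel_measurable M" if "g \<in> borel_measurable borel" "i \<in> I" for g :: "real \<Rightarrow> real" and i
    using measurable_compose[OF X_meas[OF that(2)] that(1)] .
  have um: "?u \<in> borel_measurable borel" using meas by auto
  let ?w = "\<lambda>\<omega>. \<Sum>q\<in>I \<times> I. A (fst q) (snd q) * (?u (X (fst q) \<omega>) * f (X (snd q) \<omega>) + h (X (fst q) \<omega>) * ?u (X (snd q) \<omega>))"
  have "integrable M (\<lambda>\<omega>. (?w \<omega>)\<^sup>2)" "(\<integral>\<omega>. (?w \<omega>)\<^sup>2 \<partial>M) \<le> (\<Sum>q\<in>I \<times> I. \<bar>A (fst q) (snd q)\<bar>)\<^sup>2 * (2 * \<epsilon> * (1 + m))"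
    by (rule weighted_product_sum_second_moment[OF \<open>0 < \<epsilon>\<close>];
        use gm[OF um] gm[OF meas(1)] gm[OF meas(2)] small large tr[OF i4(1)] tr[OF i4(2)] tr[OF i4(3)] in force)+
  moreover have "w \<omega> = c * ?w \<omega>" for \<omega>
    unfolding w_def qform_def sum.cartesian_product sum_subtractf[symmetric]
    by (simp add: split_beta algebra_simps)
  ultimately show "integrable M (\<lambda>\<omega>. (w \<omega>)\<^sup>2)"
    "(\<integral>\<omega>. (w \<omega>)\<^sup>2 \<partial>M) \<le> c\<^sup>2 * ((\<Sum>i\<in>I. \<Sum>j\<in>I. \<bar>A i j\<bar>)\<^sup>2 * (2 * \<epsilon> * (1 + m)))"
    by (simp_all add: power_mult_distrib mult_left_mono sum.cartesian_product split_beta)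
qed

end

section \<open>Approximation of a transformation and its derivative in mean of order four\<close>

lemma power4_sum_le: "(a + b)^4 \<le> 8 * (a^4 + b^4)" for a b :: real
proof -
  have s: "(x + y)\<^sup>2 \<le> 2 * (x\<^sup>2 + y\<^sup>2)" for x y :: real
    using sum_squares_ge_zero[of "x - y" 0] by (simp add: power2_eq_square algebra_simps)
  have "(a + b)^4 = ((a + b)\<^sup>2)\<^sup>2" by (simp flip: power_mult)
  also have "\<dots> \<le> (2 * (a\<^sup>2 + b\<^sup>2))\<^sup>2" using s by (intro power_mono) auto
  also have "\<dots> = 4 * (a\<^sup>2 + b\<^sup>2)\<^sup>2" by (simp only: power_mult_distrib) simp
  also have "\<dots> \<le> 4 * (2 * ((a\<^sup>2)\<^sup>2 + (b\<^sup>2)\<^sup>2))" using s[of "a\<^sup>2" "b\<^sup>2"] by linarith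
  finally show ?thesis by (simp flip: power_mult)
qed

lemma power4_diff_le: "(a - b)^4 \<le> 8 * (a^4 + b^4)" for a b :: real
  using power4_sum_le[of a "- b"] by simp

lemma integrable_power4_exp_growth:
  assumes "real_distribution \<mu>" and exp: "\<And>c. integrable \<mu> (\<lambda>x. exp (c * \<bar>x\<bar>))"
    and g: "g \<in> borel_measurable borel" "\<And>x. \<bar>g x\<bar> \<le> C * exp (C * \<bar>x\<bar>)"
  shows "integrable \<mu> (\<lambda>x. g x ^ 4)"
proof -
  interpret real_distribution \<mu> by fact
  have "integrable \<mu> (\<lambda>x. C^4 * exp ((4 * C) * \<bar>x\<bar>))" by (intro integrable_mult_right exp)
  then show ?thesis
  proof (rule Bochner_Integration.integrable_bound)
    show "AE x in \<mu>. norm (g x ^ 4) \<le> norm (C^4 * exp ((4 * C) * \<bar>x\<bar>))"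
    proof (rule AE_I2)
      fix x
      have "\<bar>g x\<bar>^4 \<le> (C * exp (C * \<bar>x\<bar>))^4" by (intro power_mono g(2)) simp
      also have "\<dots> = C^4 * exp ((4 * C) * \<bar>x\<bar>)"
        by (simp add: power_mult_distrib exp_of_nat_mult[symmetric] mult.assoc)
      finally show "norm (g x ^ 4) \<le> norm (C^4 * exp ((4 * C) * \<bar>x\<bar>))" by (simp add: power_abs)
    qed
  qed (use g(1) in simp)
qed

text \<open>The functions \<open>x \<mapsto> k sin(x / k)\<close> tend to the identity and are dominated by it in absolute value. Composing with
them makes a function periodic without increasing its growth, and needs its values on a bounded interval only.\<close>

lemma scaled_sin_tendsto: "(\<lambda>k. real (Suc k) * sin (x / real (Suc k))) \<longlonglongrightarrow> x"
proof -
  have b: "\<bar>sin y - y\<bar> \<le> y\<^sup>2" for y :: real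
  proof -
    have "\<bar>sin y - y\<bar> * 2 \<le> y * y"
      using Maclaurin_sin_bound[of y 2] by (simp add: numeral_2_eq_2 sin_coeff_def)
    then show ?thesis using order.trans[of "\<bar>sin y - y\<bar>" "\<bar>sin y - y\<bar> * 2" "y * y"] by (simp add: power2_eq_square)
  qed
  have "norm (real (Suc k) * sin (x / real (Suc k)) - x) \<le> x\<^sup>2 * (1 / real (Suc k))" for k
  proof -
    have "real (Suc k) * sin (x / real (Suc k)) - x = real (Suc k) * (sin (x / real (Suc k)) - x / real (Suc k))"
      by (simp add: right_diff_distrib)
    also have "norm \<dots> \<le> real (Suc k) * (x / real (Suc k))\<^sup>2"
      using b[of "x / real (Suc k)"] by (simp add: abs_mult mult_left_mono)
    finally show ?thesis by (simp add: power2_eq_square)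
  qed
  note le = this
  have lim0: "(\<lambda>k. x\<^sup>2 * (1 / real (Suc k))) \<longlonglongrightarrow> 0"
    using tendsto_mult_right_zero[OF LIMSEQ_inverse_real_of_nat, of "x\<^sup>2"] by (simp add: inverse_eq_divide)
  have "(\<lambda>k. real (Suc k) * sin (x / real (Suc k)) - x) \<longlonglongrightarrow> 0"
    by (rule Lim_null_comparison[OF always_eventually lim0]) (use le in blast)
  then show ?thesis by (rule LIM_zero_cancel)
qed

lemma scaled_sin_le: "\<bar>real (Suc k) * sin (x / real (Suc k))\<bar> \<le> \<bar>x\<bar>"
proof -
  have "\<bar>real (Suc k) * sin (x / real (Suc k))\<bar> \<le> real (Suc k) * \<bar>x / real (Suc k)\<bar>"
    unfolding abs_mult using abs_sin_x_le_abs_x[of "x / real (Suc k)"] by (intro mult_mono) auto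
  then show ?thesis by simp
qed

text \<open>Weierstrass approximation of the derivative, integrated from \<open>0\<close>.\<close>

lemma polynomial_C1_approx:
  fixes T T' :: "real \<Rightarrow> real"
  assumes T: "\<And>x. (T has_real_derivative T' x) (at x)" and cont: "continuous_on UNIV T'" and "\<theta> > 0" "L > 0"
  obtains p p' where "\<And>g. trig_poly g \<Longrightarrow> trig_poly (\<lambda>x. p (g x))" "\<And>g. trig_poly g \<Longrightarrow> trig_poly (\<lambda>x. p' (g x))"
    "\<And>x. (p has_real_derivative p' x) (at x)"
    "\<And>x. \<bar>x\<bar> \<le> L \<Longrightarrow> \<bar>T x - p x\<bar> \<le> \<theta> * L" "\<And>x. \<bar>x\<bar> \<le> L \<Longrightarrow> \<bar>T' x - p' x\<bar> \<le> \<theta>"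
proof -
  obtain p' where p': "real_polynomial_function p'" "\<And>x. x \<in> {-L..L} \<Longrightarrow> \<bar>T' x - p' x\<bar> < \<theta>"
    using Stone_Weierstrass_real_polynomial_function[of "{-L..L}" T' \<theta>] assms
    by (auto intro: continuous_on_subset)
  then obtain a n where a: "p' = (\<lambda>x. \<Sum>i\<le>n. a i * x^i)" using real_polynomial_function_imp_sum by blast
  define p where "p = (\<lambda>x. T 0 + (\<Sum>i\<le>n. a i / real (Suc i) * x^Suc i))"
  have dp: "(p has_real_derivative p' x) (at x)" for x
  proof -
    have "((\<lambda>x. a i / real (Suc i) * x^Suc i) has_real_derivative a i * x^i) (at x)" for i
      using DERIV_cmult[OF DERIV_pow[of "Suc i" x], of "a i / real (Suc i)"] by simp
    then have "((\<lambda>x. \<Sum>i\<le>n. a i / real (Suc i) * x^Suc i) has_real_derivative (\<Sum>i\<le>n. a i * x^i)) (at x)"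
      by (intro DERIV_sum) auto
    from DERIV_add[OF DERIV_const[of "T 0"] this] show ?thesis by (simp add: p_def a)
  qed
  show ?thesis
  proof (rule that[OF _ _ dp])
    show "trig_poly (\<lambda>x. p (g x))" "trig_poly (\<lambda>x. p' (g x))" if "trig_poly g" for g
      unfolding p_def a by (intro trig_poly.add trig_poly_sum trig_poly.mult trig_poly.const trig_poly_power that)+
    show "\<bar>T' x - p' x\<bar> \<le> \<theta>" if "\<bar>x\<bar> \<le> L" for x
      using that by (intro less_imp_le[OF p'(2)]) (auto simp: abs_le_iff)
    show "\<bar>T x - p x\<bar> \<le> \<theta> * L" if x: "\<bar>x\<bar> \<le> L" for x
    proof -
      have "norm ((\<lambda>x. T x - p x) x - (\<lambda>x. T x - p x) 0) \<le> \<theta> * norm (x - 0)"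
      proof (rule field_differentiable_bound[of "{-L..L}"])
        show "((\<lambda>x. T x - p x) has_field_derivative (T' z - p' z)) (at z within {-L..L})" for z
          using DERIV_diff[OF T[of z] dp[of z]] by (rule has_field_derivative_at_within)
        show "norm (T' z - p' z) \<le> \<theta>" if "z \<in> {-L..L}" for z using p'(2)[OF that] by simp
      qed (use x \<open>L > 0\<close> in auto)
      moreover have "T 0 - p 0 = 0" by (simp add: p_def)
      ultimately have "\<bar>T x - p x\<bar> \<le> \<theta> * \<bar>x\<bar>" by simp
      also have "\<dots> \<le> \<theta> * L" using x \<open>\<theta> > 0\<close> by (intro mult_left_mono) auto
      finally show ?thesis .
    qed
  qed
qed

text \<open>First replace \<open>T x\<close> by \<open>T (k sin(x / k))\<close>, which is close for large \<open>k\<close> by dominated convergence; then replace \<open>T\<close> by a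
polynomial on the range \<open>[-k, k]\<close> of the inner function. The exponential moments of \<open>\<mu>\<close> provide the dominating functions.\<close>

lemma trig_poly_L4_approx:
  fixes T T' :: "real \<Rightarrow> real"
  assumes \<mu>: "real_distribution \<mu>" and exp: "\<And>c. integrable \<mu> (\<lambda>x. exp (c * \<bar>x\<bar>))"
    and T: "\<And>x. (T has_real_derivative T' x) (at x)" and cont: "continuous_on UNIV T'"
    and growth: "\<And>x. \<bar>T x\<bar> \<le> C * exp (C * \<bar>x\<bar>)" "\<And>x. \<bar>T' x\<bar> \<le> C * exp (C * \<bar>x\<bar>)"
    and "\<eta> > 0"
  obtains f f' where "trig_poly f" "trig_poly f'" "\<And>x. (f has_real_derivative f' x) (at x)"
    "(\<integral>x. (T x - f x)^4 \<partial>\<mu>) \<le> \<eta>" "(\<integral>x. (T' x - f' x)^4 \<partial>\<mu>) \<le> \<eta>"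
proof -
  interpret real_distribution \<mu> by fact
  have contT: "continuous_on UNIV T" using T by (meson DERIV_isCont continuous_at_imp_continuous_on)
  have Tm [measurable]: "T \<in> borel_measurable borel" "T' \<in> borel_measurable borel"
    using contT cont by (auto intro: borel_measurable_continuous_onI)
  have C0: "C \<ge> 0" using growth(1)[of 0] by simp
  define s where "s = (\<lambda>k x. real (Suc k) * sin (x / real (Suc k)))"
  have s_lim: "(\<lambda>k. s k x) \<longlonglongrightarrow> x" and s_le: "\<bar>s k x\<bar> \<le> \<bar>x\<bar>" for k x
    unfolding s_def by (rule scaled_sin_tendsto, rule scaled_sin_le)
  have s_der: "(s k has_real_derivative cos (x / real (Suc k))) (at x)" for k x
    unfolding s_def by (auto intro!: derivative_eq_intros simp del: of_nat_Suc)
  have sm [measurable]: "s k \<in> borel_measurable borel" for k unfolding s_def by measurable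
  have lim: "(\<lambda>k. \<integral>x. (g x - g (s k x) * h k x)^4 \<partial>\<mu>) \<longlonglongrightarrow> 0"
    if g: "continuous_on UNIV g" "\<And>x. \<bar>g x\<bar> \<le> C * exp (C * \<bar>x\<bar>)"
      and h: "\<And>k. h k \<in> borel_measurable borel" "\<And>k x. \<bar>h k x\<bar> \<le> 1" "\<And>x. (\<lambda>k. h k x) \<longlonglongrightarrow> 1"
    for g :: "real \<Rightarrow> real" and h :: "nat \<Rightarrow> real \<Rightarrow> real"
  proof -
    have [measurable]: "g \<in> borel_measurable borel" using g(1) by (rule borel_measurable_continuous_onI)
    note [measurable] = h(1)
    have "(\<lambda>k. \<integral>x. (g x - g (s k x) * h k x)^4 \<partial>\<mu>) \<longlonglongrightarrow> (\<integral>x. 0 \<partial>\<mu>)"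
    proof (rule integral_dominated_convergence[where w="\<lambda>x. (2 * C)^4 * exp ((4 * C) * \<bar>x\<bar>)"])
      show "integrable \<mu> (\<lambda>x. (2 * C)^4 * exp ((4 * C) * \<bar>x\<bar>))" by (intro integrable_mult_right exp)
      show "AE x in \<mu>. (\<lambda>k. (g x - g (s k x) * h k x)^4) \<longlonglongrightarrow> 0"
      proof (rule AE_I2)
        fix x
        have "isCont g x" using g(1) by (simp add: continuous_on_eq_continuous_at)
        then have "(\<lambda>k. g (s k x)) \<longlonglongrightarrow> g x" using s_lim isCont_tendsto_compose by blast
        then have "(\<lambda>k. (g x - g (s k x) * h k x)^4) \<longlonglongrightarrow> (g x - g x * 1)^4"
          by (intro tendsto_intros h(3))
        then show "(\<lambda>k. (g x - g (s k x) * h k x)^4) \<longlonglongrightarrow> 0" by simp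
      qed
      fix k
      show "AE x in \<mu>. norm ((g x - g (s k x) * h k x)^4) \<le> (2 * C)^4 * exp ((4 * C) * \<bar>x\<bar>)"
      proof (rule AE_I2)
        fix x
        have "\<bar>g (s k x)\<bar> \<le> C * exp (C * \<bar>x\<bar>)"
          using s_le[of k x] C0 by (intro order.trans[OF g(2)] mult_left_mono) (auto intro: mult_left_mono)
        then have "\<bar>g (s k x) * h k x\<bar> \<le> C * exp (C * \<bar>x\<bar>) * 1"
          unfolding abs_mult using h(2) C0 by (intro mult_mono) auto
        then have "\<bar>g x - g (s k x) * h k x\<bar> \<le> 2 * C * exp (C * \<bar>x\<bar>)" using g(2)[of x] by linarith
        then have "\<bar>g x - g (s k x) * h k x\<bar>^4 \<le> (2 * C * exp (C * \<bar>x\<bar>))^4" by (intro power_mono) auto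
        also have "\<dots> = (2 * C)^4 * exp ((4 * C) * \<bar>x\<bar>)"
          by (simp add: power_mult_distrib exp_of_nat_mult[symmetric] mult.assoc)
        finally show "norm ((g x - g (s k x) * h k x)^4) \<le> (2 * C)^4 * exp ((4 * C) * \<bar>x\<bar>)" by (simp add: power_abs)
      qed
    qed (auto intro!: measurable_compose[OF sm])
    then show ?thesis by simp
  qed
  have l1: "(\<lambda>k. \<integral>x. (T x - T (s k x) * 1)^4 \<partial>\<mu>) \<longlonglongrightarrow> 0"
    by (rule lim[OF contT growth(1)]) auto
  have l2: "(\<lambda>k. \<integral>x. (T' x - T' (s k x) * cos (x / real (Suc k)))^4 \<partial>\<mu>) \<longlonglongrightarrow> 0"
  proof (rule lim[OF cont growth(2)])
    fix x :: real
    have "(\<lambda>k. x / real (Suc k)) \<longlonglongrightarrow> 0"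
      using tendsto_mult_right_zero[OF LIMSEQ_inverse_real_of_nat, of x] by (simp add: divide_inverse)
    then show "(\<lambda>k. cos (x / real (Suc k))) \<longlonglongrightarrow> 1" using tendsto_cos by fastforce
  qed auto
  have "\<forall>\<^sub>F k in sequentially. (\<integral>x. (T x - T (s k x) * 1)^4 \<partial>\<mu>) < \<eta> / 16 \<and>
     (\<integral>x. (T' x - T' (s k x) * cos (x / real (Suc k)))^4 \<partial>\<mu>) < \<eta> / 16"
    using order_tendstoD(2)[OF l1, of "\<eta> / 16"] order_tendstoD(2)[OF l2, of "\<eta> / 16"] \<open>\<eta> > 0\<close>
    by (auto intro: eventually_conj)
  then obtain k where k: "(\<integral>x. (T x - T (s k x))^4 \<partial>\<mu>) < \<eta> / 16"
     "(\<integral>x. (T' x - T' (s k x) * cos (x / real (Suc k)))^4 \<partial>\<mu>) < \<eta> / 16"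
    by (auto simp: eventually_sequentially)
  define L where "L = real (Suc k)"
  have L: "L \<ge> 1" by (simp add: L_def)
  \<comment> \<open>By \<open>power4_sum_le\<close>, two errors of \<open>\<eta> / 16\<close> in mean of order four add up to at most \<open>\<eta>\<close>.\<close>
  define r where "r = min 1 (\<eta> / 16)"
  have r: "r > 0" "r \<le> 1" "r \<le> \<eta> / 16" using \<open>\<eta> > 0\<close> by (auto simp: r_def)
  have r4: "r^4 \<le> \<eta> / 16" using power_decreasing[of 1 4 r] r by simp
  obtain p p' where p: "\<And>g. trig_poly g \<Longrightarrow> trig_poly (\<lambda>x. p (g x))" "\<And>g. trig_poly g \<Longrightarrow> trig_poly (\<lambda>x. p' (g x))"
    "\<And>x. (p has_real_derivative p' x) (at x)"
    "\<And>x. \<bar>x\<bar> \<le> L \<Longrightarrow> \<bar>T x - p x\<bar> \<le> r / L * L" "\<And>x. \<bar>x\<bar> \<le> L \<Longrightarrow> \<bar>T' x - p' x\<bar> \<le> r / L"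
    using polynomial_C1_approx[OF T cont, of "r / L" L] L r by (auto simp: field_simps)
  have sL: "\<bar>s k x\<bar> \<le> L" for x
  proof -
    have "L * \<bar>sin (x / L)\<bar> \<le> L * 1" using L by (intro mult_left_mono) auto
    then show ?thesis using L by (simp add: s_def L_def[symmetric] abs_mult del: of_nat_Suc)
  qed
  have ts: "trig_poly (s k)"
    using trig_poly.mult[OF trig_poly.const[of L] trig_poly.sin[of "1 / L"]] by (simp add: s_def L_def del: of_nat_Suc)
  have tc: "trig_poly (\<lambda>x. cos (x / L))" using trig_poly.cos[of "1 / L"] by simp
  define f where "f = (\<lambda>x. p (s k x))"
  define f' where "f' = (\<lambda>x. p' (s k x) * cos (x / L))"
  have tf: "trig_poly f" "trig_poly f'" unfolding f_def f'_def by (intro trig_poly.mult p ts tc)+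
  have df: "(f has_real_derivative f' x) (at x)" for x
    unfolding f_def f'_def L_def using DERIV_chain2[OF p(3) s_der] by simp
  have meas: "f \<in> borel_measurable borel" "f' \<in> borel_measurable borel"
  proof -
    show "f \<in> borel_measurable borel"
      using df by (intro borel_measurable_continuous_onI) (meson DERIV_isCont continuous_at_imp_continuous_on)
    obtain f'' where "\<And>x. (f' has_real_derivative f'' x) (at x)" using trig_poly_deriv[OF tf(2)] by blast
    then show "f' \<in> borel_measurable borel"
      by (intro borel_measurable_continuous_onI) (meson DERIV_isCont continuous_at_imp_continuous_on)
  qed
  have combine: "(\<integral>x. (g x - h x)^4 \<partial>\<mu>) \<le> \<eta>"
    if ex: "(\<integral>x. (g x - u x)^4 \<partial>\<mu>) < \<eta> / 16" and uh: "\<And>x. \<bar>u x - h x\<bar> \<le> r"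
      and gm: "g \<in> borel_measurable borel" "\<And>x. \<bar>g x\<bar> \<le> C * exp (C * \<bar>x\<bar>)"
      and um: "u \<in> borel_measurable borel" "\<And>x. \<bar>u x\<bar> \<le> C * exp (C * \<bar>x\<bar>)"
      and hm: "h \<in> borel_measurable borel" for g u h :: "real \<Rightarrow> real"
  proof -
    have i: "integrable \<mu> (\<lambda>x. (g x - u x)^4)"
    proof (rule integrable_power4_exp_growth[OF \<mu> exp])
      fix x
      have e: "C * exp (C * \<bar>x\<bar>) \<le> C * exp (2 * C * \<bar>x\<bar>)" using C0 by (intro mult_left_mono) auto
      then show "\<bar>g x - u x\<bar> \<le> (2 * C) * exp ((2 * C) * \<bar>x\<bar>)" using gm(2)[of x] um(2)[of x] by (simp add: mult.assoc)
    qed (use gm um in auto)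
    have "(g x - h x)^4 \<le> 8 * ((g x - u x)^4 + \<eta> / 16)" for x
    proof -
      have "\<bar>u x - h x\<bar>^4 \<le> r^4" using uh by (intro power_mono) auto
      then show ?thesis using power4_sum_le[of "g x - u x" "u x - h x"] r4 by (simp add: power_abs)
    qed
    note pw = this
    have i8: "integrable \<mu> (\<lambda>x. 8 * ((g x - u x)^4 + \<eta> / 16))" using i by simp
    have "(\<integral>x. (g x - h x)^4 \<partial>\<mu>) \<le> (\<integral>x. 8 * ((g x - u x)^4 + \<eta> / 16) \<partial>\<mu>)"
    proof (rule integral_mono[OF _ i8 pw])
      show "integrable \<mu> (\<lambda>x. (g x - h x)^4)"
        by (rule integrable_dominated[OF i8 _ _ pw]) (use gm hm in auto)
    qed
    also have "\<dots> \<le> \<eta>" using i ex prob_space by simp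
    finally show ?thesis .
  qed
  have ucs: "\<bar>g (s k x)\<bar> \<le> C * exp (C * \<bar>x\<bar>)" if "\<And>x. \<bar>g x\<bar> \<le> C * exp (C * \<bar>x\<bar>)" for g :: "real \<Rightarrow> real" and x
    using s_le[of k x] C0 by (intro order.trans[OF that] mult_left_mono) (auto intro: mult_left_mono)
  show ?thesis
  proof (rule that[OF tf df])
    show "(\<integral>x. (T x - f x)^4 \<partial>\<mu>) \<le> \<eta>"
      by (rule combine[OF k(1) _ _ growth(1) _ ucs[OF growth(1)]]) (use p(4)[OF sL] L meas in \<open>auto simp: f_def\<close>)
    show "(\<integral>x. (T' x - f' x)^4 \<partial>\<mu>) \<le> \<eta>"
    proof (rule combine[OF k(2) _ _ growth(2)])
      show "\<bar>T' (s k x) * cos (x / real (Suc k)) - f' x\<bar> \<le> r" for x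
      proof -
        have "\<bar>T' (s k x) * cos (x / real (Suc k)) - f' x\<bar> = \<bar>T' (s k x) - p' (s k x)\<bar> * \<bar>cos (x / L)\<bar>"
          by (simp add: f'_def L_def left_diff_distrib[symmetric] abs_mult)
        also have "\<dots> \<le> (r / L) * 1" using p(5)[OF sL] r L by (intro mult_mono) auto
        also have "\<dots> \<le> r" using L r by (simp add: divide_le_eq mult_left_le)
        finally show ?thesis .
      qed
      show "\<bar>T' (s k x) * cos (x / real (Suc k))\<bar> \<le> C * exp (C * \<bar>x\<bar>)" for x
        using mult_mono[OF ucs[OF growth(2), of x] abs_cos_le_one[of "x / real (Suc k)"]] C0 by (simp add: abs_mult)
    qed (use meas in auto)
  qed
qed

section \<open>Row sums over well-separated points\<close>

lemma sum_int_powr_bounded: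
  fixes q :: real
  assumes "q > 1"
  shows "\<exists>G\<ge>0. \<forall>F :: int set. finite F \<longrightarrow> (\<Sum>m\<in>F. (1 + \<bar>real_of_int m\<bar>) powr (- q)) \<le> G"
proof -
  let ?h = "\<lambda>n. (1 + real n) powr (- q)"
  have "summable (\<lambda>n. real (Suc n) powr (- q))"
    using assms summable_real_powr_iff[of "- q"] by (subst summable_Suc_iff) simp
  then have sh: "summable ?h" by (simp add: add.commute)
  have half: "(\<Sum>m\<in>F. (1 + \<bar>real_of_int m\<bar>) powr (- q)) \<le> suminf ?h"
    if "finite F" "inj_on (\<lambda>m. nat \<bar>m\<bar>) F" for F :: "int set"
  proof -
    have "(\<Sum>m\<in>F. (1 + \<bar>real_of_int m\<bar>) powr (- q)) = (\<Sum>n\<in>(\<lambda>m. nat \<bar>m\<bar>) ` F. ?h n)"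
      by (subst sum.reindex[OF that(2)]) (auto intro!: sum.cong)
    also have "\<dots> \<le> suminf ?h" using that(1) by (intro sum_le_suminf[OF sh]) auto
    finally show ?thesis .
  qed
  have "(\<Sum>m\<in>F. (1 + \<bar>real_of_int m\<bar>) powr (- q)) \<le> 2 * suminf ?h" if F: "finite F" for F :: "int set"
  proof -
    have "F = (F \<inter> {0..}) \<union> (F \<inter> {..<0})" by auto
    then have "(\<Sum>m\<in>F. (1 + \<bar>real_of_int m\<bar>) powr (- q))
      = (\<Sum>m\<in>F \<inter> {0..}. (1 + \<bar>real_of_int m\<bar>) powr (- q)) + (\<Sum>m\<in>F \<inter> {..<0}. (1 + \<bar>real_of_int m\<bar>) powr (- q))"
      using F by (subst sum.union_disjoint[symmetric]) auto
    also have "\<dots> \<le> suminf ?h + suminf ?h"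
      using F by (intro add_mono half) (auto simp: inj_on_def)
    finally show ?thesis by simp
  qed
  moreover have "suminf ?h \<ge> 0" by (intro suminf_nonneg sh) simp
  ultimately show ?thesis by (intro exI[of _ "2 * suminf ?h"]) simp
qed

text \<open>Sending \<open>s j\<close> to the cell of the lattice of mesh \<open>\<delta>\<close> around \<open>s i\<close> that contains it is injective, because two points in one half-open
cell have distance less than \<open>\<delta>\<close>. The decay \<open>(1 + r)\<^sup>-\<^sup>(\<^sup>d\<^sup>+\<^sup>c\<^sup>)\<close> is the product of \<open>d\<close> factors
\<open>(1 + r)\<^sup>-\<^sup>q\<close> with \<open>q = 1 + c / d > 1\<close>, one for each coordinate, so the sum over the
lattice is at most the \<open>d\<close>-th power of a convergent sum over the integers.\<close>

lemma well_separated_row_sums: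
  fixes s :: "nat \<Rightarrow> real^'d"
  assumes sep: "\<And>i j. i \<noteq> j \<Longrightarrow> \<delta> \<le> infnorm (s i - s j)" and "\<delta> > 0" "c > 0"
  shows "\<exists>B\<ge>0. \<forall>n i. (\<Sum>j<n. 1 / (1 + infnorm (s i - s j) powr (real CARD('d) + c))) \<le> B"
proof -
  define d where "d = real CARD('d)"
  have d: "d \<ge> 1" unfolding d_def by (simp add: Suc_leI)
  define p where "p = d + c"
  define q where "q = 1 + c / d"
  have q: "q > 1" "q * d = p" using d \<open>c > 0\<close> by (auto simp: q_def p_def field_simps)
  have p0: "p > 0" using d \<open>c > 0\<close> by (simp add: p_def)
  obtain G where G: "G \<ge> 0" "\<And>F :: int set. finite F \<Longrightarrow> (\<Sum>m\<in>F. (1 + \<bar>real_of_int m\<bar>) powr (- q)) \<le> G"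
    using sum_int_powr_bounded[OF q(1)] by blast
  define b where "b = 2 + 1 / \<delta>"
  have b: "b \<ge> 2" using \<open>\<delta> > 0\<close> by (simp add: b_def)
  define B where "B = 2 powr p * (b powr q * G) ^ CARD('d)"
  have "(\<Sum>j<n. 1 / (1 + infnorm (s i - s j) powr p)) \<le> B" for n i
  proof -
    \<comment> \<open>The lattice cell of \<open>s j\<close>, relative to \<open>s i\<close>; the sign of the difference is immaterial.\<close>
    define m where "m = (\<lambda>j (k :: 'd). \<lfloor>vec_nth (s i - s j) k / \<delta>\<rfloor>)"
    define g where "g = (\<lambda>x :: int. b powr q * (1 + \<bar>real_of_int x\<bar>) powr (- q))"
    have inj: "inj m"
    proof (rule injI, rule ccontr)
      fix j j' assume eq: "m j = m j'" and ne: "j \<noteq> j'"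
      have "\<bar>vec_nth (s j - s j') k\<bar> < \<delta>" for k
      proof -
        have "\<lfloor>vec_nth (s i - s j) k / \<delta>\<rfloor> = \<lfloor>vec_nth (s i - s j') k / \<delta>\<rfloor>" using eq by (auto simp: m_def dest: fun_cong)
        then have "\<bar>vec_nth (s i - s j) k / \<delta> - vec_nth (s i - s j') k / \<delta>\<bar> < 1" by linarith
        then have "\<bar>(vec_nth (s i - s j) k - vec_nth (s i - s j') k) / \<delta>\<bar> < 1" by (simp add: diff_divide_distrib)
        then have "\<bar>vec_nth (s j') k - vec_nth (s j) k\<bar> < \<delta>" using \<open>\<delta> > 0\<close> by (simp add: abs_divide)
        then show ?thesis by (simp add: abs_minus_commute)
      qed
      moreover have "infnorm (s j - s j') = Max (range (\<lambda>k. \<bar>vec_nth (s j - s j') k\<bar>))"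
        unfolding infnorm_cart by (simp add: full_SetCompr_eq cSup_eq_Max)
      ultimately have "infnorm (s j - s j') < \<delta>" by auto
      then show False using sep[OF ne] by simp
    qed
    have term_le: "1 / (1 + infnorm (s i - s j) powr p) \<le> 2 powr p * (\<Prod>k\<in>UNIV. g (m j k))" for j
    proof -
      define r where "r = infnorm (s i - s j)"
      have r0: "r \<ge> 0" by (simp add: r_def infnorm_pos_le)
      have "(1 + r) powr p \<le> 2 powr p * (1 + r powr p)"
      proof -
        have "(1 + r) powr p \<le> (2 * max 1 r) powr p" using r0 p0 by (intro powr_mono2) auto
        also have "\<dots> = 2 powr p * (max 1 r) powr p" using r0 by (simp add: powr_mult)
        also have "(max 1 r) powr p \<le> 1 + r powr p" by (auto simp: max_def)
        finally show ?thesis by simp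
      qed
      then have "1 / (1 + r powr p) \<le> 2 powr p * (1 + r) powr (- p)"
        using r0 by (simp add: powr_minus field_simps add_pos_nonneg)
      also have "(1 + r) powr (- p) = (\<Prod>k\<in>(UNIV :: 'd set). (1 + r) powr (- q))"
        using r0 by (simp add: powr_powr flip: powr_realpow) (simp add: q(2)[symmetric] d_def)
      also have "\<dots> \<le> (\<Prod>k\<in>UNIV. g (m j k))"
      proof (intro prod_mono conjI)
        fix k :: 'd
        have "\<bar>vec_nth (s i - s j) k\<bar> \<le> r" unfolding r_def by (rule component_le_infnorm_cart)
        then have "\<bar>vec_nth (s i - s j) k / \<delta>\<bar> \<le> r / \<delta>" using \<open>\<delta> > 0\<close> by (simp add: abs_divide divide_right_mono)
        then have "1 + \<bar>real_of_int (m j k)\<bar> \<le> 2 + r / \<delta>" unfolding m_def by linarith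
        also have "\<dots> \<le> b * (1 + r)" using r0 \<open>\<delta> > 0\<close> by (simp add: b_def field_simps)
        finally have "(1 + \<bar>real_of_int (m j k)\<bar>) powr q \<le> (b * (1 + r)) powr q"
          using q by (intro powr_mono2) auto
        also have "\<dots> = b powr q * (1 + r) powr q" using b r0 by (simp add: powr_mult)
        finally show "(1 + r) powr (- q) \<le> g (m j k)"
          unfolding g_def powr_minus using r0 by (simp add: field_simps add_pos_nonneg)
      qed simp
      finally show ?thesis unfolding r_def by simp
    qed
    define F where "F = (\<Union>k\<in>(UNIV :: 'd set). (\<lambda>j. m j k) ` {..<n})"
    have F: "finite F" by (simp add: F_def)
    have g0: "g x \<ge> 0" for x by (simp add: g_def)
    have "(\<Sum>j<n. 1 / (1 + infnorm (s i - s j) powr p)) \<le> (\<Sum>j<n. 2 powr p * (\<Prod>k\<in>UNIV. g (m j k)))"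
      by (intro sum_mono term_le)
    also have "\<dots> = 2 powr p * (\<Sum>f\<in>m ` {..<n}. \<Prod>k\<in>UNIV. g (f k))"
      using inj by (subst sum.reindex) (auto simp: sum_distrib_left intro: inj_on_subset)
    also have "\<dots> \<le> 2 powr p * (\<Sum>f\<in>PiE UNIV (\<lambda>_ :: 'd. F). \<Prod>k\<in>UNIV. g (f k))"
      using F g0 by (intro mult_left_mono sum_mono2 finite_PiE) (auto simp: F_def intro!: prod_nonneg)
    also have "(\<Sum>f\<in>PiE UNIV (\<lambda>_ :: 'd. F). \<Prod>k\<in>UNIV. g (f k)) = (\<Prod>k\<in>(UNIV :: 'd set). \<Sum>x\<in>F. g x)"
      using F by (subst prod_sum_PiE) auto
    also have "\<dots> \<le> (b powr q * G) ^ CARD('d)"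
      using G(2)[OF F] g0 by (auto simp: g_def sum_distrib_left[symmetric] intro!: power_mono mult_left_mono mult_nonneg_nonneg sum_nonneg)
    finally show ?thesis unfolding B_def by simp
  qed
  moreover have "B \<ge> 0" using G by (simp add: B_def)
  ultimately show ?thesis unfolding p_def d_def by blast
qed

text \<open>Used to treat the covariance function in the same way as the weights.\<close>

lemma exp_decay_le_powr_decay:
  fixes r c p :: real
  assumes "r \<ge> 0" "c > 0" "p > 0"
  shows "exp (- c * r) \<le> (1 + (p / c) powr p) / (1 + r powr p)"
proof -
  have "r powr p \<le> exp (c * r) * (p / c) powr p"
  proof (cases "r = 0")
    case False
    then have r: "r > 0" using assms by simp
    have "c * r / p \<le> exp (c * r / p)" using exp_ge_add_one_self[of "c * r / p"] by linarith
    then have "(c * r / p) powr p \<le> exp (c * r / p) powr p" using assms r by (intro powr_mono2) auto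
    also have "\<dots> = exp (c * r)" using assms by (simp add: powr_def)
    finally have "(c * r / p) powr p * (p / c) powr p \<le> exp (c * r) * (p / c) powr p"
      by (rule mult_right_mono) simp
    also have "(c * r / p) powr p * (p / c) powr p = r powr p"
      using assms r by (simp add: powr_mult[symmetric])
    finally show ?thesis .
  qed (use assms in simp)
  moreover have "1 \<le> exp (c * r)" using assms by simp
  ultimately have "1 + r powr p \<le> exp (c * r) * (1 + (p / c) powr p)"
    unfolding distrib_left by linarith
  then have "exp (- c * r) * (1 + r powr p) \<le> 1 + (p / c) powr p"
    by (simp add: exp_minus field_simps)
  then show ?thesis by (simp add: field_simps add_pos_nonneg)
qed

section \<open>Comparison with Gaussian laws of bounded variance in a metric for weak convergence\<close>

lemma real_distribution_imp_borel_prob: "real_distribution \<mu> \<Longrightarrow> \<mu> \<in> borel_prob_measures"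
  unfolding borel_prob_measures_def real_distribution_def real_distribution_axioms_def by auto

text \<open>Convergence in a topology generated by a subbasis needs to be checked on the subbasic sets only, and
for those it is the convergence of integrals of bounded continuous functions.\<close>

lemma weak_conv_m_imp_limitin_weak_topology:
  assumes \<mu>: "\<And>n. real_distribution (\<mu> n)" and \<nu>: "real_distribution \<nu>" and conv: "weak_conv_m \<mu> \<nu>"
  shows "limitin weak_topology \<mu> \<nu> sequentially"
  unfolding limitin_def
proof (intro conjI allI impI)
  show "\<nu> \<in> topspace weak_topology"
    unfolding topspace_weak_topology by (rule real_distribution_imp_borel_prob[OF \<nu>])
  let ?S = "{{\<mu> \<in> borel_prob_measures. integral\<^sup>L \<mu> f \<in> U} | (f :: real \<Rightarrow> real) U.
        continuous_on UNIV f \<and> bounded (range f) \<and> open U}"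
  fix W assume W: "openin weak_topology W \<and> \<nu> \<in> W"
  then have "generate_topology_on ?S W" unfolding weak_topology_def openin_topology_generated_by_iff by blast
  then have "\<nu> \<in> W \<longrightarrow> (\<forall>\<^sub>F n in sequentially. \<mu> n \<in> W)"
  proof induction
    case (UN \<K>)
    show ?case
    proof
      assume "\<nu> \<in> \<Union>\<K>"
      then obtain V where "V \<in> \<K>" "\<nu> \<in> V" by blast
      then have "\<forall>\<^sub>F n in sequentially. \<mu> n \<in> V" using UN by blast
      then show "\<forall>\<^sub>F n in sequentially. \<mu> n \<in> \<Union>\<K>" by (rule eventually_mono) (use \<open>V \<in> \<K>\<close> in blast)
    qed
  next
    case (Basis B)
    then obtain f :: "real \<Rightarrow> real" and U where B: "B = {\<mu> \<in> borel_prob_measures. integral\<^sup>L \<mu> f \<in> U}"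
      and f: "continuous_on UNIV f" "bounded (range f)" and U: "open U" by blast
    obtain C where C: "\<And>x. norm (f x) \<le> C" using f(2) by (auto simp: bounded_iff)
    have "(\<lambda>n. integral\<^sup>L (\<mu> n) f) \<longlonglongrightarrow> integral\<^sup>L \<nu> f"
      using f(1) C by (intro weak_conv_imp_integral_bdd_continuous_conv[OF \<mu> \<nu> conv]) (auto simp: continuous_on_eq_continuous_at)
    then have "\<forall>\<^sub>F n in sequentially. integral\<^sup>L (\<mu> n) f \<in> U" if "\<nu> \<in> B"
      using that U by (auto simp: B topological_tendstoD)
    then show ?case using real_distribution_imp_borel_prob[OF \<mu>] by (auto simp: B elim: eventually_mono)
  qed (auto intro: eventually_conj)
  then show "\<forall>\<^sub>F n in sequentially. \<mu> n \<in> W" using W by blast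
qed

lemma metrizes_weak_convergence_tendsto:
  fixes dw :: "real measure \<Rightarrow> real measure \<Rightarrow> real"
  assumes dw: "metrizes_weak_convergence dw"
    and \<mu>: "\<And>n. real_distribution (\<mu> n)" and \<nu>: "real_distribution \<nu>"
    and conv: "\<And>t. (\<lambda>n. char (\<mu> n) t) \<longlonglongrightarrow> char \<nu> t"
  shows "(\<lambda>n. dw (\<mu> n) \<nu>) \<longlonglongrightarrow> 0"
proof -
  interpret Metric_space borel_prob_measures dw using dw by (simp add: metrizes_weak_convergence_def)
  have "limitin mtopology \<mu> \<nu> sequentially"
    using weak_conv_m_imp_limitin_weak_topology[OF \<mu> \<nu> levy_continuity[OF \<mu> \<nu> conv]] dw
    by (simp add: metrizes_weak_convergence_def)
  then show ?thesis by (simp add: limitin_metric_dist_null)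
qed

text \<open>The comparison laws need not converge. But if the distances stayed away from zero along a subsequence, a further subsequence would
have convergent variances, and along it both sequences would converge to the same Gaussian law.\<close>

lemma metrizes_weak_convergence_gaussian:
  fixes dw :: "real measure \<Rightarrow> real measure \<Rightarrow> real"
  assumes dw: "metrizes_weak_convergence dw"
    and \<mu>: "\<And>n. real_distribution (\<mu> n)" and v: "\<And>n. 0 \<le> v n" "\<And>n. v n \<le> B"
    and conv: "\<And>t. (\<lambda>n. char (\<mu> n) t - exp (- (v n * t\<^sup>2) / 2)) \<longlonglongrightarrow> 0"
  shows "(\<lambda>n. dw (\<mu> n) (gaussian 0 (v n))) \<longlonglongrightarrow> 0"
proof (rule ccontr)
  interpret Metric_space borel_prob_measures dw using dw by (simp add: metrizes_weak_convergence_def)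
  let ?d = "\<lambda>n. dw (\<mu> n) (gaussian 0 (v n))"
  assume "\<not> ?d \<longlonglongrightarrow> 0"
  then obtain e where e: "e > 0" "\<And>N. \<exists>n\<ge>N. ?d n \<ge> e"
    unfolding LIMSEQ_def dist_real_def by (fastforce simp: not_less abs_of_nonneg)
  then have "infinite {n. ?d n \<ge> e}" unfolding infinite_nat_iff_unbounded_le by auto
  then obtain r :: "nat \<Rightarrow> nat" where r: "strict_mono r" "\<And>n. ?d (r n) \<ge> e"
    using infinite_enumerate[of "{n. ?d n \<ge> e}"] by auto
  have "bounded (range (v \<circ> r))" using v by (auto simp: bounded_iff intro!: exI[of _ B])
  then obtain l r' where r': "strict_mono r'" "((v \<circ> r) \<circ> r') \<longlonglongrightarrow> l"
    using bounded_imp_convergent_subsequence by blast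
  define R where "R = r \<circ> r'"
  have R: "strict_mono R" unfolding R_def by (rule strict_mono_o[OF r(1) r'(1)])
  have vl: "(\<lambda>n. v (R n)) \<longlonglongrightarrow> l" using r'(2) by (simp add: R_def comp_def)
  have l0: "l \<ge> 0" using vl v(1) by (intro LIMSEQ_le_const[OF vl]) auto
  have G: "real_distribution (gaussian 0 (v n))" "real_distribution (gaussian 0 l)" for n
    using real_distribution_gaussian v l0 by auto
  have el: "(\<lambda>n. complex_of_real (exp (- (v (R n) * t\<^sup>2) / 2))) \<longlonglongrightarrow> complex_of_real (exp (- (l * t\<^sup>2) / 2))" for t
    by (intro tendsto_intros vl) auto
  have gl: "(\<lambda>n. char (gaussian 0 (v (R n))) t) \<longlonglongrightarrow> char (gaussian 0 l) t" for t
    unfolding char_gaussian[OF v(1)] char_gaussian[OF l0] by (rule el)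
  have "(\<lambda>n. char (\<mu> (R n)) t) \<longlonglongrightarrow> char (gaussian 0 l) t" for t
    unfolding char_gaussian[OF l0]
    using tendsto_add[OF LIMSEQ_subseq_LIMSEQ[OF conv[of t] R] el[of t]] by (simp add: comp_def)
  from metrizes_weak_convergence_tendsto[OF dw \<mu> G(2) this]
  have d1: "(\<lambda>n. dw (\<mu> (R n)) (gaussian 0 l)) \<longlonglongrightarrow> 0" .
  from metrizes_weak_convergence_tendsto[OF dw G(1) G(2) gl]
  have d2: "(\<lambda>n. dw (gaussian 0 (v (R n))) (gaussian 0 l)) \<longlonglongrightarrow> 0" .
  have "e \<le> dw (\<mu> (R n)) (gaussian 0 l) + dw (gaussian 0 (v (R n))) (gaussian 0 l)" for n
  proof -
    have "e \<le> ?d (R n)" using r(2)[of "r' n"] by (simp add: R_def)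
    also have "\<dots> \<le> dw (\<mu> (R n)) (gaussian 0 l) + dw (gaussian 0 l) (gaussian 0 (v (R n)))"
      using real_distribution_imp_borel_prob \<mu> G by (intro triangle) auto
    finally show ?thesis by (simp add: commute)
  qed
  then have "e \<le> 0 + 0" using tendsto_add[OF d1 d2] by (intro LIMSEQ_le_const) auto
  then show False using e(1) by simp
qed

section \<open>The central limit theorem for quadratic forms\<close>

lemma abs_exp_minus_diff_le:
  fixes a b :: real
  assumes "0 \<le> a" "0 \<le> b"
  shows "\<bar>exp (- a) - exp (- b)\<bar> \<le> \<bar>a - b\<bar>"
proof -
  have *: "\<bar>exp (- a) - exp (- b)\<bar> \<le> b - a" if "0 \<le> a" "a \<le> b" for a b :: real
  proof -
    have h: "1 - exp (- (b - a)) \<le> b - a" using exp_ge_add_one_self[of "- (b - a)"] by linarith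
    have "exp (- a) - exp (- b) = exp (- a) * (1 - exp (- (b - a)))"
      by (simp add: right_diff_distrib flip: exp_add)
    also have "\<dots> \<le> 1 * (b - a)"
      using that by (intro mult_mono h) auto
    finally show ?thesis using that by simp
  qed
  show ?thesis using *[of a b] *[of b a] assms by (cases "a \<le> b") (auto simp: abs_minus_commute)
qed

text \<open>The distance between the characteristic function of \<open>W\<close> and that of the Gaussian law with the same second moment
changes by \<open>O(\<theta>)\<close> if \<open>W\<close> moves by \<open>O(\<theta>)\<close> in \<open>L\<^sup>2\<close>: characteristic functions are Lipschitz, and so are second
moments on bounded sets.\<close>

lemma (in prob_space) l2_close_imp_gaussian_error_close:
  fixes W U :: "'a \<Rightarrow> real" and D V R \<theta> t :: real
  assumes meas: "W \<in> borel_measurable M" "U \<in> borel_measurable M"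
    and int: "integrable M (\<lambda>\<omega>. (W \<omega>)\<^sup>2)" "integrable M (\<lambda>\<omega>. (U \<omega>)\<^sup>2)"
    and close: "(\<integral>\<omega>. (W \<omega> - U \<omega>)\<^sup>2 \<partial>M) \<le> D * \<theta>\<^sup>2" and V: "(\<integral>\<omega>. (W \<omega>)\<^sup>2 \<partial>M) \<le> V"
    and \<theta>: "0 < \<theta>" "\<theta> \<le> 1" and D0: "0 \<le> D"
    and R: "norm ((\<integral>\<omega>. iexp (t * U \<omega>) \<partial>M) - exp (- ((\<integral>\<omega>. (U \<omega>)\<^sup>2 \<partial>M) * t\<^sup>2) / 2)) \<le> R"
  shows "norm ((\<integral>\<omega>. iexp (t * W \<omega>) \<partial>M) - exp (- ((\<integral>\<omega>. (W \<omega>)\<^sup>2 \<partial>M) * t\<^sup>2) / 2))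
    \<le> (\<bar>t\<bar> * (D + 1) + t\<^sup>2 * (2 * D + V)) * \<theta> + R"
proof -
  define d where "d = (\<lambda>\<omega>. W \<omega> - U \<omega>)"
  have dm: "d \<in> borel_measurable M" unfolding d_def using meas by simp
  have di: "integrable M (\<lambda>\<omega>. (d \<omega>)\<^sup>2)"
  proof (rule integrable_dominated)
    show "integrable M (\<lambda>\<omega>. 2 * (W \<omega>)\<^sup>2 + 2 * (U \<omega>)\<^sup>2)" using int by simp
    show "(d \<omega>)\<^sup>2 \<le> 2 * (W \<omega>)\<^sup>2 + 2 * (U \<omega>)\<^sup>2" for \<omega>
      using zero_le_power2[of "W \<omega> + U \<omega>"] by (simp add: d_def power2_sum power2_diff)
  qed (use dm in auto)
  have dE: "(\<integral>\<omega>. (d \<omega>)\<^sup>2 \<partial>M) \<le> D * \<theta>\<^sup>2" using close by (simp add: d_def)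
  have pd: "\<bar>d \<omega>\<bar> \<le> ((d \<omega>)\<^sup>2 / \<theta> + \<theta>) / 2" for \<omega>
  proof -
    have "0 \<le> (\<bar>d \<omega>\<bar> - \<theta>)\<^sup>2 / \<theta>" using \<theta> by simp
    also have "\<dots> = (d \<omega>)\<^sup>2 / \<theta> + \<theta> - 2 * \<bar>d \<omega>\<bar>" using \<theta> by (simp add: power2_diff field_simps power2_eq_square)
    finally show ?thesis by simp
  qed
  have bi: "integrable M (\<lambda>\<omega>. ((d \<omega>)\<^sup>2 / \<theta> + \<theta>) / 2)" using di by simp
  have ai: "integrable M (\<lambda>\<omega>. \<bar>d \<omega>\<bar>)"
    by (rule integrable_dominated[OF bi _ _ pd]) (use dm in auto)
  have "(\<integral>\<omega>. \<bar>d \<omega>\<bar> \<partial>M) \<le> (\<integral>\<omega>. ((d \<omega>)\<^sup>2 / \<theta> + \<theta>) / 2 \<partial>M)"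
    by (rule integral_mono[OF ai bi pd])
  also have "\<dots> = ((\<integral>\<omega>. (d \<omega>)\<^sup>2 \<partial>M) / \<theta> + \<theta>) / 2" using di by (simp add: prob_space)
  also have "\<dots> \<le> (D * \<theta>\<^sup>2 / \<theta> + \<theta>) / 2" using dE \<theta> by (intro divide_right_mono add_right_mono) auto
  also have "\<dots> = (D + 1) * \<theta> / 2" using \<theta> by (simp add: power2_eq_square algebra_simps)
  also have "\<dots> \<le> (D + 1) * \<theta>" using \<theta> D0 by simp
  finally have d1: "(\<integral>\<omega>. \<bar>d \<omega>\<bar> \<partial>M) \<le> (D + 1) * \<theta>" .
  have em: "(\<lambda>\<omega>. iexp (t * g \<omega>)) \<in> borel_measurable M" if "g \<in> borel_measurable M" for g :: "'a \<Rightarrow> real"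
    using measurable_compose[of "\<lambda>\<omega>. t * g \<omega>" M borel "\<lambda>x. iexp x" borel] that by simp
  have ei: "integrable M (\<lambda>\<omega>. iexp (t * g \<omega>))" if "g \<in> borel_measurable M" for g :: "'a \<Rightarrow> real"
    by (rule integrable_bounded[of _ 1], rule em[OF that]) simp
  have c1: "norm ((\<integral>\<omega>. iexp (t * W \<omega>) \<partial>M) - (\<integral>\<omega>. iexp (t * U \<omega>) \<partial>M)) \<le> \<bar>t\<bar> * ((D + 1) * \<theta>)"
  proof -
    have pw: "norm (iexp (t * W \<omega>) - iexp (t * U \<omega>)) \<le> \<bar>t\<bar> * \<bar>d \<omega>\<bar>" for \<omega>
    proof -
      have "iexp (t * W \<omega>) = iexp (t * U \<omega>) * iexp (t * d \<omega>)"
        by (simp add: d_def algebra_simps flip: exp_add)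
      then have "iexp (t * W \<omega>) - iexp (t * U \<omega>) = iexp (t * U \<omega>) * (iexp (t * d \<omega>) - 1)" by (simp add: algebra_simps)
      then have "norm (iexp (t * W \<omega>) - iexp (t * U \<omega>)) = norm (iexp (t * d \<omega>) - 1)"
        by (simp only: norm_mult norm_exp_i_times mult_1)
      also have "\<dots> \<le> \<bar>t * d \<omega>\<bar>" using iexp_approx1[of "t * d \<omega>" 0] by simp
      finally show ?thesis by (simp add: abs_mult)
    qed
    have "norm ((\<integral>\<omega>. iexp (t * W \<omega>) \<partial>M) - (\<integral>\<omega>. iexp (t * U \<omega>) \<partial>M)) = norm (\<integral>\<omega>. iexp (t * W \<omega>) - iexp (t * U \<omega>) \<partial>M)"
      using ei[OF meas(1)] ei[OF meas(2)] by simp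
    also have "\<dots> \<le> (\<integral>\<omega>. norm (iexp (t * W \<omega>) - iexp (t * U \<omega>)) \<partial>M)" by (rule integral_norm_bound)
    also have "\<dots> \<le> (\<integral>\<omega>. \<bar>t\<bar> * \<bar>d \<omega>\<bar> \<partial>M)"
      using ei[OF meas(1)] ei[OF meas(2)] ai by (intro integral_mono pw integrable_norm Bochner_Integration.integrable_diff) auto
    also have "\<dots> \<le> \<bar>t\<bar> * ((D + 1) * \<theta>)" using mult_left_mono[OF d1, of "\<bar>t\<bar>"] by simp
    finally show ?thesis .
  qed
  let ?vW = "\<integral>\<omega>. (W \<omega>)\<^sup>2 \<partial>M" and ?vU = "\<integral>\<omega>. (U \<omega>)\<^sup>2 \<partial>M"
  have c2: "\<bar>?vU - ?vW\<bar> \<le> (2 * D + V) * \<theta>"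
  proof -
    have pw: "\<bar>(U \<omega>)\<^sup>2 - (W \<omega>)\<^sup>2\<bar> \<le> (d \<omega>)\<^sup>2 + (d \<omega>)\<^sup>2 / \<theta> + \<theta> * (W \<omega>)\<^sup>2" for \<omega>
    proof -
      have "0 \<le> (\<bar>d \<omega>\<bar> - \<theta> * \<bar>W \<omega>\<bar>)\<^sup>2 / \<theta>" using \<theta> by simp
      also have "\<dots> = (d \<omega>)\<^sup>2 / \<theta> + \<theta> * (W \<omega>)\<^sup>2 - 2 * (\<bar>d \<omega>\<bar> * \<bar>W \<omega>\<bar>)"
        using \<theta> by (simp add: power2_diff power_mult_distrib field_simps power2_eq_square)
      finally have "2 * \<bar>d \<omega> * W \<omega>\<bar> \<le> (d \<omega>)\<^sup>2 / \<theta> + \<theta> * (W \<omega>)\<^sup>2" by (simp add: abs_mult)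
      moreover have "(U \<omega>)\<^sup>2 - (W \<omega>)\<^sup>2 = (d \<omega>)\<^sup>2 - 2 * (d \<omega> * W \<omega>)"
        by (simp add: d_def power2_eq_square algebra_simps)
      ultimately show ?thesis using zero_le_power2[of "d \<omega>"] by linarith
    qed
    have bi2: "integrable M (\<lambda>\<omega>. (d \<omega>)\<^sup>2 + (d \<omega>)\<^sup>2 / \<theta> + \<theta> * (W \<omega>)\<^sup>2)" using di int by simp
    have "\<bar>?vU - ?vW\<bar> = \<bar>\<integral>\<omega>. (U \<omega>)\<^sup>2 - (W \<omega>)\<^sup>2 \<partial>M\<bar>" using int by simp
    also have "\<dots> \<le> (\<integral>\<omega>. \<bar>(U \<omega>)\<^sup>2 - (W \<omega>)\<^sup>2\<bar> \<partial>M)" by (rule integral_abs_bound)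
    also have "\<dots> \<le> (\<integral>\<omega>. (d \<omega>)\<^sup>2 + (d \<omega>)\<^sup>2 / \<theta> + \<theta> * (W \<omega>)\<^sup>2 \<partial>M)"
      using int by (intro integral_mono pw bi2) auto
    also have "\<dots> = (\<integral>\<omega>. (d \<omega>)\<^sup>2 \<partial>M) + (\<integral>\<omega>. (d \<omega>)\<^sup>2 \<partial>M) / \<theta> + \<theta> * ?vW" using di int by simp
    also have "\<dots> \<le> D * \<theta>\<^sup>2 + D * \<theta>\<^sup>2 / \<theta> + \<theta> * V"
      using dE V \<theta> by (intro add_mono divide_right_mono mult_left_mono) auto
    also have "\<dots> \<le> (2 * D + V) * \<theta>"
    proof -
      have "D * \<theta>\<^sup>2 \<le> D * \<theta>" using \<theta> D0 by (intro mult_left_mono) (auto simp: power2_eq_square mult_le_one)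
      moreover have "D * \<theta>\<^sup>2 / \<theta> = D * \<theta>" using \<theta> by (simp add: power2_eq_square)
      ultimately show ?thesis by (simp add: algebra_simps)
    qed
    finally show ?thesis .
  qed
  have c3: "norm (complex_of_real (exp (- (?vU * t\<^sup>2) / 2)) - complex_of_real (exp (- (?vW * t\<^sup>2) / 2))) \<le> t\<^sup>2 * ((2 * D + V) * \<theta>)"
  proof -
    have "norm (complex_of_real (exp (- (?vU * t\<^sup>2) / 2)) - complex_of_real (exp (- (?vW * t\<^sup>2) / 2)))
      = \<bar>exp (- (?vU * t\<^sup>2 / 2)) - exp (- (?vW * t\<^sup>2 / 2))\<bar>"
      by (simp add: norm_of_real flip: of_real_diff)
    also have "\<dots> \<le> \<bar>?vU * t\<^sup>2 / 2 - ?vW * t\<^sup>2 / 2\<bar>" by (intro abs_exp_minus_diff_le) auto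
    also have "\<dots> = t\<^sup>2 / 2 * \<bar>?vU - ?vW\<bar>"
      by (simp add: abs_mult diff_divide_distrib[symmetric] left_diff_distrib[symmetric])
    also have "\<dots> \<le> t\<^sup>2 * ((2 * D + V) * \<theta>)" using c2 by (intro mult_mono) auto
    finally show ?thesis .
  qed
  have tri: "norm (x - w) \<le> A + B + C" if "norm (x - y) \<le> A" "norm (y - z) \<le> B" "norm (z - w) \<le> C" for x y z w :: complex and A B C
    using norm_triangle_mono[OF norm_triangle_mono[OF that(1,2)] that(3)] by simp
  have "norm ((\<integral>\<omega>. iexp (t * W \<omega>) \<partial>M) - exp (- (?vW * t\<^sup>2) / 2)) \<le> \<bar>t\<bar> * ((D + 1) * \<theta>) + R + t\<^sup>2 * ((2 * D + V) * \<theta>)"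
    using tri[OF c1 R c3] by simp
  then show ?thesis by (simp add: algebra_simps)
qed

lemma integral_power4_approx_le:
  fixes g h :: "real \<Rightarrow> real" and \<eta> m :: real
  assumes "prob_space \<mu>" "integrable \<mu> (\<lambda>x. g x ^ 4)" "integrable \<mu> (\<lambda>x. (g x - h x) ^ 4)" "(\<integral>x. (g x - h x)^4 \<partial>\<mu>) \<le> \<eta>"
    "integrable \<mu> (\<lambda>x. h x ^ 4)"
  shows "(\<integral>x. h x ^ 4 \<partial>\<mu>) \<le> 8 * ((\<integral>x. g x ^ 4 \<partial>\<mu>) + \<eta>)"
proof -
  have "(\<integral>x. h x ^ 4 \<partial>\<mu>) \<le> (\<integral>x. 8 * (g x ^ 4 + (g x - h x) ^ 4) \<partial>\<mu>)"
  proof (rule integral_mono)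
    fix x show "h x ^ 4 \<le> 8 * (g x ^ 4 + (g x - h x) ^ 4)"
      using power4_diff_le[of "g x" "g x - h x"] by simp
  qed (use assms in auto)
  also have "\<dots> = 8 * ((\<integral>x. g x ^ 4 \<partial>\<mu>) + (\<integral>x. (g x - h x) ^ 4 \<partial>\<mu>))" using assms by simp
  finally show ?thesis using assms by simp
qed

text \<open>For a trigonometric polynomial \<open>f\<close> in place of \<open>T\<close> the statement holds with a rate that depends on \<open>f\<close>. Replacing \<open>T\<close> by \<open>f\<close>
costs \<open>O(\<theta>)\<close> in \<open>L\<^sup>2\<close> uniformly in \<open>n\<close> when \<open>f\<close> is close to \<open>T\<close>, so first \<open>f\<close> is fixed and \<open>n\<close> tends to infinity, and then
\<open>\<theta>\<close> tends to zero. The index sets \<open>{..<n}\<close> share one vector \<open>X\<close>; only the weights \<open>A n\<close> change with \<open>n\<close>.\<close>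

theorem (in prob_space) gaussian_qform_clt:
  fixes X :: "nat \<Rightarrow> 'a \<Rightarrow> real" and K :: "nat \<Rightarrow> nat \<Rightarrow> real" and A :: "nat \<Rightarrow> nat \<Rightarrow> nat \<Rightarrow> real"
    and T T' :: "real \<Rightarrow> real" and \<kappa> \<alpha> v C :: real
  assumes gf: "\<And>n. gaussian_family M {..<n} X K" and v: "\<And>i. K i i = v" "0 \<le> v"
    and K: "\<And>n i. i < n \<Longrightarrow> (\<Sum>j<n. \<bar>K i j\<bar>) \<le> \<kappa>"
    and rows: "\<And>n i. i < n \<Longrightarrow> (\<Sum>j<n. \<bar>A n i j\<bar>) \<le> \<alpha>" and cols: "\<And>n i. i < n \<Longrightarrow> (\<Sum>j<n. \<bar>A n j i\<bar>) \<le> \<alpha>"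
    and pos: "0 \<le> \<kappa>" "0 \<le> \<alpha>"
    and T: "\<And>x. (T has_real_derivative T' x) (at x)" and cont: "continuous_on UNIV T'"
    and growth: "\<And>x. \<bar>T x\<bar> \<le> C * exp (C * \<bar>x\<bar>)" "\<And>x. \<bar>T' x\<bar> \<le> C * exp (C * \<bar>x\<bar>)"
  defines "q \<equiv> \<lambda>n f \<omega>. 1 / sqrt (real n) * qform {..<n} (A n) f (\<lambda>i. X i \<omega>)"
  defines "w \<equiv> \<lambda>n \<omega>. q n T \<omega> - (\<integral>\<omega>. q n T \<omega> \<partial>M)"
  shows "\<exists>V. \<forall>n\<ge>1. (\<integral>\<omega>. (w n \<omega>)\<^sup>2 \<partial>M) \<le> V"
    and "\<And>t. (\<lambda>n. (\<integral>\<omega>. iexp (t * w n \<omega>) \<partial>M) - exp (- ((\<integral>\<omega>. (w n \<omega>)\<^sup>2 \<partial>M) * t\<^sup>2) / 2)) \<longlonglongrightarrow> 0"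
proof -
  let ?\<gamma> = "gaussian 0 v"
  interpret G: real_distribution ?\<gamma> by (rule real_distribution_gaussian[OF v(2)])
  have gi: "integrable ?\<gamma> (\<lambda>x. exp (c * \<bar>x\<bar>))" for c by (rule integrable_exp_gaussian[OF v(2)])
  have contT: "continuous_on UNIV T" using T by (meson DERIV_isCont continuous_at_imp_continuous_on)
  have Tm [measurable]: "T \<in> borel_measurable borel" "T' \<in> borel_measurable borel"
    using contT cont by (auto intro: borel_measurable_continuous_onI)
  have i4: "integrable ?\<gamma> (\<lambda>x. g x ^ 4)" if "g \<in> borel_measurable borel" "\<And>x. \<bar>g x\<bar> \<le> C * exp (C * \<bar>x\<bar>)" for g and C :: real
    by (rule integrable_power4_exp_growth[OF G.real_distribution_axioms gi that])
  have T4: "integrable ?\<gamma> (\<lambda>x. T x ^ 4)" "integrable ?\<gamma> (\<lambda>x. T' x ^ 4)"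
    using i4[OF Tm(1) growth(1)] i4[OF Tm(2) growth(2)] .
  define \<tau> where "\<tau> = (\<integral>x. T x ^ 4 \<partial>?\<gamma>)"
  define \<tau>' where "\<tau>' = (\<integral>x. T' x ^ 4 \<partial>?\<gamma>)"
  have \<tau>: "0 \<le> \<tau>" "0 \<le> \<tau>'" by (simp_all add: \<tau>_def \<tau>'_def)
  \<comment> \<open>A bound for the fourth moments of \<open>T\<close>, of \<open>T'\<close> and of their approximants with error at most 1.\<close>
  define m where "m = 8 * (\<tau> + \<tau>' + 1)"
  have m: "0 \<le> m" "(\<integral>x. T x ^ 4 \<partial>?\<gamma>) \<le> m"
    unfolding \<tau>_def[symmetric] using \<tau> by (simp_all add: m_def)
  \<comment> \<open>\<open>appr \<eta> f f'\<close>: \<open>f\<close> has the calculus of a trigonometric polynomial with derivative \<open>f'\<close>, and both are within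
    \<open>\<eta>\<close> of \<open>T\<close> and \<open>T'\<close> in mean of order four.\<close>
  define appr where "appr = (\<lambda>\<eta> f f'. (\<exists>f''. trig_coord TYPE(nat) f f' \<and> trig_coord TYPE(nat) f' f''
      \<and> (\<exists>B. \<forall>x. \<bar>f x\<bar> \<le> B \<and> \<bar>f' x\<bar> \<le> B \<and> \<bar>f'' x\<bar> \<le> B)) \<and> f \<in> borel_measurable borel \<and> f' \<in> borel_measurable borel
      \<and> (\<integral>x. (T x - f x)^4 \<partial>?\<gamma>) \<le> \<eta> \<and> (\<integral>x. (T' x - f' x)^4 \<partial>?\<gamma>) \<le> \<eta>)"
  have ap: "f \<in> borel_measurable borel" "f' \<in> borel_measurable borel"
      "(\<integral>x. (T x - f x)^4 \<partial>?\<gamma>) \<le> \<eta>" "(\<integral>x. (T' x - f' x)^4 \<partial>?\<gamma>) \<le> \<eta>"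
      "trig_coord TYPE(nat) f f'" "\<exists>B. \<forall>x. \<bar>f x\<bar> \<le> B" "\<exists>B. \<forall>x. \<bar>f' x\<bar> \<le> B" "\<exists>B. \<forall>x. \<bar>f x\<bar> \<le> B \<and> \<bar>f' x\<bar> \<le> B"
    if "appr \<eta> f f'" for \<eta> f f' using that unfolding appr_def by blast+
  have ex_appr: "\<exists>f f'. appr \<eta> f f'" if eta: "\<eta> > 0" for \<eta> :: real
  proof -
    have "\<exists>f f'. trig_poly f \<and> trig_poly f' \<and> (\<forall>x. (f has_real_derivative f' x) (at x)) \<and>
        (\<integral>x. (T x - f x)^4 \<partial>?\<gamma>) \<le> \<eta> \<and> (\<integral>x. (T' x - f' x)^4 \<partial>?\<gamma>) \<le> \<eta>"
      by (rule trig_poly_L4_approx[OF G.real_distribution_axioms gi T cont growth eta]) blast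
    then obtain f f' where f: "trig_poly f" "trig_poly f'" "\<And>x. (f has_real_derivative f' x) (at x)"
      and c: "(\<integral>x. (T x - f x)^4 \<partial>?\<gamma>) \<le> \<eta>" "(\<integral>x. (T' x - f' x)^4 \<partial>?\<gamma>) \<le> \<eta>" by blast
    obtain f1 where f1: "\<And>x. (f has_real_derivative f1 x) (at x)" "trig_coord TYPE(nat) f f1"
      using trig_poly_deriv[OF f(1)] by blast
    have "f1 = f'" using f1(1) f(3) DERIV_unique by blast
    obtain f'' where f'': "trig_poly f''" "\<And>x. (f' has_real_derivative f'' x) (at x)" "trig_coord TYPE(nat) f' f''"
      using trig_poly_deriv[OF f(2)] by blast
    obtain B1 B2 B3 where B: "\<And>x. \<bar>f x\<bar> \<le> B1" "\<And>x. \<bar>f' x\<bar> \<le> B2" "\<And>x. \<bar>f'' x\<bar> \<le> B3"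
      using trig_poly_bounded[OF f(1)] trig_poly_bounded[OF f(2)] trig_poly_bounded[OF f''(1)] by blast
    have "\<bar>f x\<bar> \<le> max B1 (max B2 B3) \<and> \<bar>f' x\<bar> \<le> max B1 (max B2 B3) \<and> \<bar>f'' x\<bar> \<le> max B1 (max B2 B3)" for x
      using B(1)[of x] B(2)[of x] B(3)[of x] by (simp add: le_max_iff_disj)
    moreover have "f \<in> borel_measurable borel" "f' \<in> borel_measurable borel"
      using f(3) f''(2) by (auto intro!: borel_measurable_continuous_onI intro: continuous_at_imp_continuous_on DERIV_isCont)
    ultimately show ?thesis unfolding appr_def using f1(2) f''(3) c \<open>f1 = f'\<close> by blast
  qed
  have appr_mono: "appr \<eta>' f f'" if "appr \<eta> f f'" "\<eta> \<le> \<eta>'" for \<eta> \<eta>' f f'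
    using that unfolding appr_def by (auto intro: order.trans)
  have bounded4: "integrable ?\<gamma> (\<lambda>x. g x ^ 4)" if g: "g \<in> borel_measurable borel" "\<exists>B. \<forall>x. \<bar>g x\<bar> \<le> B" for g :: "real \<Rightarrow> real"
  proof -
    obtain B where B: "\<And>x. \<bar>g x\<bar> \<le> B" using g(2) by blast
    have "\<bar>g x\<bar> \<le> B * exp (B * \<bar>x\<bar>)" for x
    proof -
      have "B \<ge> 0" using B[of 0] by linarith
      then have "B * 1 \<le> B * exp (B * \<bar>x\<bar>)" by (intro mult_left_mono) auto
      then show ?thesis using B[of x] by linarith
    qed
    then show ?thesis by (rule i4[OF g(1)])
  qed
  have diff4: "integrable ?\<gamma> (\<lambda>x. (g x - h x) ^ 4)"
    if "g \<in> borel_measurable borel" "h \<in> borel_measurable borel" "integrable ?\<gamma> (\<lambda>x. g x ^ 4)" "integrable ?\<gamma> (\<lambda>x. h x ^ 4)" for g h :: "real \<Rightarrow> real"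
  proof (rule integrable_dominated)
    show "integrable ?\<gamma> (\<lambda>x. 8 * (g x ^ 4 + h x ^ 4))" using that by simp
    show "(g x - h x) ^ 4 \<le> 8 * (g x ^ 4 + h x ^ 4)" for x by (rule power4_diff_le)
  qed (use that in auto)
  have apprD: "integrable ?\<gamma> (\<lambda>x. f x ^ 4)" "integrable ?\<gamma> (\<lambda>x. f' x ^ 4)"
    "integrable ?\<gamma> (\<lambda>x. (T x - f x) ^ 4)" "integrable ?\<gamma> (\<lambda>x. (T' x - f' x) ^ 4)"
    "(\<integral>x. f x ^ 4 \<partial>?\<gamma>) \<le> m" "(\<integral>x. f' x ^ 4 \<partial>?\<gamma>) \<le> m" if "appr \<eta> f f'" "\<eta> \<le> 1" for \<eta> f f'
  proof -
    note a = ap[OF that(1)]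
    show 1: "integrable ?\<gamma> (\<lambda>x. f x ^ 4)" "integrable ?\<gamma> (\<lambda>x. f' x ^ 4)"
      by (rule bounded4[OF a(1,6)], rule bounded4[OF a(2,7)])
    show 2: "integrable ?\<gamma> (\<lambda>x. (T x - f x) ^ 4)" "integrable ?\<gamma> (\<lambda>x. (T' x - f' x) ^ 4)"
      by (rule diff4[OF Tm(1) a(1) T4(1) 1(1)], rule diff4[OF Tm(2) a(2) T4(2) 1(2)])
    have "(\<integral>x. f x ^ 4 \<partial>?\<gamma>) \<le> 8 * ((\<integral>x. T x ^ 4 \<partial>?\<gamma>) + 1)"
      by (rule integral_power4_approx_le[OF G.prob_space_axioms T4(1) 2(1) order.trans[OF a(3) that(2)] 1(1)])
    moreover have "(\<integral>x. f' x ^ 4 \<partial>?\<gamma>) \<le> 8 * ((\<integral>x. T' x ^ 4 \<partial>?\<gamma>) + 1)"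
      by (rule integral_power4_approx_le[OF G.prob_space_axioms T4(2) 2(2) order.trans[OF a(4) that(2)] 1(2)])
    ultimately show "(\<integral>x. f x ^ 4 \<partial>?\<gamma>) \<le> m" "(\<integral>x. f' x ^ 4 \<partial>?\<gamma>) \<le> m" using \<tau> by (simp_all add: m_def flip: \<tau>_def \<tau>'_def)
  qed
  have fX: "(\<lambda>\<omega>. g (X i \<omega>)) \<in> borel_measurable M" if "g \<in> borel_measurable borel" for g :: "real \<Rightarrow> real" and i
    using measurable_compose[OF gaussian_family.X_meas[OF gf[of "Suc i"], of i] that] by simp
  have qmeas: "q n g \<in> borel_measurable M" if "g \<in> borel_measurable borel" for n g
    unfolding q_def qform_def by (intro borel_measurable_times borel_measurable_sum borel_measurable_const fX that)
  have cn: "real n * (1 / sqrt (real n))\<^sup>2 = 1" if "n \<ge> 1" for n :: nat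
    using that by (simp add: power_divide)
  let ?S = "\<lambda>n. \<Sum>i<n. \<Sum>j<n. \<bar>A n i j\<bar>"
  have rough: "integrable M (\<lambda>\<omega>. (q n T \<omega> - q n h \<omega>)\<^sup>2)"
    "(\<integral>\<omega>. (q n T \<omega> - q n h \<omega>)\<^sup>2 \<partial>M) \<le> (1 / sqrt (real n))\<^sup>2 * ((?S n)\<^sup>2 * (2 * \<epsilon> * (1 + m)))"
    if "appr (\<epsilon>\<^sup>2) h h'" "0 < \<epsilon>" "\<epsilon> \<le> 1" for n h h' \<epsilon>
  proof -
    interpret F: gaussian_family M "{..<n}" X K by (rule gf)
    have e1: "\<epsilon>\<^sup>2 \<le> 1" using that by (simp add: power_le_one)
    note * = F.qform_diff_second_moment[where f=T and h=h and v=v and \<epsilon>=\<epsilon> and m=m and A="A n" and c="1 / sqrt (real n)",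
        OF v that(2) m(1) Tm(1) ap(1)[OF that(1)] T4(1) apprD(1,3)[OF that(1) e1] ap(3)[OF that(1)] m(2) apprD(5)[OF that(1) e1]]
    show "integrable M (\<lambda>\<omega>. (q n T \<omega> - q n h \<omega>)\<^sup>2)"
      "(\<integral>\<omega>. (q n T \<omega> - q n h \<omega>)\<^sup>2 \<partial>M) \<le> (1 / sqrt (real n))\<^sup>2 * ((?S n)\<^sup>2 * (2 * \<epsilon> * (1 + m)))"
      using * unfolding q_def right_diff_distrib by auto
  qed
  have q2: "integrable M (\<lambda>\<omega>. (q n f \<omega>)\<^sup>2)" if f: "appr \<eta> f f'" for n f f' \<eta>
  proof -
    obtain B where B: "\<And>x. \<bar>f x\<bar> \<le> B" using ap(6)[OF f] by blast
    have B0: "B \<ge> 0" using B[of 0] by linarith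
    have "\<bar>q n f \<omega>\<bar> \<le> 1 / sqrt (real n) * (\<Sum>i<n. \<Sum>j<n. \<bar>A n i j\<bar> * (B * B))" for \<omega>
      unfolding q_def qform_def abs_mult using B B0
      by (intro mult_mono order.trans[OF sum_abs] sum_mono) (auto simp: abs_mult intro!: mult_mono sum_nonneg)
    then have "(q n f \<omega>)\<^sup>2 \<le> (1 / sqrt (real n) * (\<Sum>i<n. \<Sum>j<n. \<bar>A n i j\<bar> * (B * B)))\<^sup>2" for \<omega>
      using power_mono[of "\<bar>q n f \<omega>\<bar>" _ 2] by simp
    then show ?thesis using qmeas[OF ap(1)[OF f], of n]
      by (intro integrable_bounded[of _ "(1 / sqrt (real n) * (\<Sum>i<n. \<Sum>j<n. \<bar>A n i j\<bar> * (B * B)))\<^sup>2"]) auto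
  qed
  have sq_int: "integrable M g" if "integrable M (\<lambda>\<omega>. (g \<omega>)\<^sup>2)" "g \<in> borel_measurable M" for g :: "'a \<Rightarrow> real"
    using square_integrable_imp_integrable[OF that(2,1)] .
  have shift2: "integrable M (\<lambda>\<omega>. (g \<omega> - c)\<^sup>2)"
    if "integrable M g" "integrable M (\<lambda>\<omega>. (g \<omega>)\<^sup>2)" for g :: "'a \<Rightarrow> real" and c
    unfolding power2_diff using that by simp
  obtain f0 f0' where f0: "appr 1 f0 f0'" using ex_appr[of 1] by auto
  have qT2: "integrable M (\<lambda>\<omega>. (q n T \<omega>)\<^sup>2)" for n
  proof (rule integrable_dominated)
    show "integrable M (\<lambda>\<omega>. 2 * (q n T \<omega> - q n f0 \<omega>)\<^sup>2 + 2 * (q n f0 \<omega>)\<^sup>2)"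
      using rough(1)[of 1 f0 f0' n] q2[OF f0, of n] f0 by simp
    show "(q n T \<omega>)\<^sup>2 \<le> 2 * (q n T \<omega> - q n f0 \<omega>)\<^sup>2 + 2 * (q n f0 \<omega>)\<^sup>2" for \<omega>
      using zero_le_power2[of "q n T \<omega> - 2 * q n f0 \<omega>"] by (simp add: power2_eq_square algebra_simps)
  qed (use qmeas[OF Tm(1)] in auto)
  have qT1: "integrable M (q n T)" for n by (rule sq_int[OF qT2 qmeas[OF Tm(1)]])
  have w2: "integrable M (\<lambda>\<omega>. (w n \<omega>)\<^sup>2)" for n
    unfolding w_def by (rule shift2[OF qT1 qT2])
  define D where "D = 2 + 16 * \<kappa> * \<alpha>\<^sup>2 * (1 + m)"
  have D0: "0 \<le> D" using pos m by (simp add: D_def)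
  define u where "u = (\<lambda>n f \<omega>. q n f \<omega> - (\<integral>\<omega>. q n f \<omega> \<partial>M))"
  have uw: "u n T = w n" for n by (simp add: u_def w_def)
  have u2: "integrable M (\<lambda>\<omega>. (u n f \<omega>)\<^sup>2)" if "appr \<eta> f f'" for n f f' \<eta>
    unfolding u_def by (rule shift2[OF sq_int[OF q2[OF that] qmeas[OF ap(1)[OF that]]] q2[OF that]])
  have close: "(\<integral>\<omega>. (w n \<omega> - u n f \<omega>)\<^sup>2 \<partial>M) \<le> D * \<theta>\<^sup>2"
    if n: "n \<ge> 1" and \<theta>: "0 < \<theta>" "\<theta> \<le> 1" and f: "appr (\<theta>^4 / 16) f f'" for n \<theta> f f'
  proof -
    define c where "c = (1 / sqrt (real n))\<^sup>2 * ((?S n)\<^sup>2 * (2 * (1 + m)))"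
    have c0: "0 \<le> c" using m by (simp add: c_def)
    \<comment> \<open>An approximant \<open>h\<close> adapted to \<open>n\<close>: so close to \<open>T\<close> that even the crude bound with the constant \<open>c\<close> is
      at most \<open>\<theta>\<^sup>2\<close>. The Poincare inequality then compares the two trigonometric polynomials \<open>h\<close> and \<open>f\<close>.\<close>
    define \<epsilon> where "\<epsilon> = min (\<theta>\<^sup>2 / 4) (\<theta>\<^sup>2 / (c + 1))"
    have t21: "\<theta>\<^sup>2 \<le> 1" using \<theta> by (simp add: power_le_one)
    have "0 < \<epsilon>" using \<theta> c0 by (simp add: \<epsilon>_def)
    moreover have "\<epsilon> \<le> \<theta>\<^sup>2 / 4" unfolding \<epsilon>_def by (rule min.cobounded1)
    moreover have "\<epsilon> \<le> \<theta>\<^sup>2 / (c + 1)" unfolding \<epsilon>_def by (rule min.cobounded2)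
    ultimately have \<epsilon>: "0 < \<epsilon>" "\<epsilon> \<le> \<theta>\<^sup>2 / 4" "\<epsilon> \<le> \<theta>\<^sup>2 / (c + 1)" .
    have \<epsilon>1: "\<epsilon> \<le> 1" using \<epsilon>(2) t21 by simp
    obtain h h' where h: "appr (\<epsilon>\<^sup>2) h h'" using ex_appr[of "\<epsilon>\<^sup>2"] \<epsilon> by auto
    have e2: "\<epsilon>\<^sup>2 \<le> \<theta>^4 / 16"
      using power_mono[OF \<epsilon>(2), of 2] \<epsilon>(1) by (simp add: power_divide flip: power_mult)
    have h': "appr (\<theta>^4 / 16) h h'" by (rule appr_mono[OF h e2])
    have t4: "\<theta>^4 / 16 \<le> 1" using \<theta> power_le_one[of \<theta> 4] by simp
    have mm: "f \<in> borel_measurable borel" "f' \<in> borel_measurable borel" "h \<in> borel_measurable borel" "h' \<in> borel_measurable borel"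
      using ap(1,2)[OF f] ap(1,2)[OF h] by auto
    have small: "(\<integral>x. (a x - b x)^4 \<partial>?\<gamma>) \<le> (\<theta>\<^sup>2)\<^sup>2"
      if "(\<integral>x. (g x - a x)^4 \<partial>?\<gamma>) \<le> \<theta>^4 / 16" "(\<integral>x. (g x - b x)^4 \<partial>?\<gamma>) \<le> \<theta>^4 / 16"
        "integrable ?\<gamma> (\<lambda>x. (g x - a x)^4)" "integrable ?\<gamma> (\<lambda>x. (g x - b x)^4)" "integrable ?\<gamma> (\<lambda>x. (a x - b x)^4)" for a b g :: "real \<Rightarrow> real"
    proof -
      have "(\<integral>x. (a x - b x)^4 \<partial>?\<gamma>) \<le> (\<integral>x. 8 * ((g x - a x)^4 + (g x - b x)^4) \<partial>?\<gamma>)"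
      proof (rule integral_mono)
        show "(a x - b x)^4 \<le> 8 * ((g x - a x)^4 + (g x - b x)^4)" for x
          using power4_diff_le[of "g x - b x" "g x - a x"] by simp
      qed (use that in auto)
      also have "\<dots> \<le> \<theta>^4" using that by simp
      finally show ?thesis by (simp flip: power_mult)
    qed
    note fD = apprD[OF f t4] and hD = apprD[OF h' t4]
    have sm: "(\<integral>x. (h x - f x)^4 \<partial>?\<gamma>) \<le> (\<theta>\<^sup>2)\<^sup>2" "(\<integral>x. (h' x - f' x)^4 \<partial>?\<gamma>) \<le> (\<theta>\<^sup>2)\<^sup>2"
      by (rule small[OF ap(3)[OF h'] ap(3)[OF f] hD(3) fD(3) diff4[OF mm(3,1) hD(1) fD(1)]],
          rule small[OF ap(4)[OF h'] ap(4)[OF f] hD(4) fD(4) diff4[OF mm(4,2) hD(2) fD(2)]])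
    interpret F: gaussian_family M "{..<n}" X K by (rule gf)
    obtain Bf where Bf: "\<And>x. \<bar>f x\<bar> \<le> Bf \<and> \<bar>f' x\<bar> \<le> Bf" using ap(8)[OF f] by blast
    obtain Bh where Bh: "\<And>x. \<bar>h x\<bar> \<le> Bh \<and> \<bar>h' x\<bar> \<le> Bh" using ap(8)[OF h] by blast
    have bd: "\<bar>h x\<bar> \<le> max Bf Bh" "\<bar>h' x\<bar> \<le> max Bf Bh" "\<bar>f x\<bar> \<le> max Bf Bh" "\<bar>f' x\<bar> \<le> max Bf Bh" for x
      using Bf[of x] Bh[of x] by (simp_all add: le_max_iff_disj)
    let ?d = "\<lambda>\<omega>. q n h \<omega> - q n f \<omega>"
    have "(\<integral>\<omega>. (?d \<omega>)\<^sup>2 \<partial>M) - (\<integral>\<omega>. ?d \<omega> \<partial>M)\<^sup>2 \<le> real n * \<kappa> * ((1 / sqrt (real n))\<^sup>2 * (8 * \<alpha>\<^sup>2 * \<theta>\<^sup>2 * (1 + m)))"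
    proof -
      have t2: "0 < \<theta>\<^sup>2" using \<theta> by simp
      have I: "(\<Sum>j<n. \<bar>K i j\<bar>) \<le> \<kappa>" "(\<Sum>j<n. \<bar>A n i j\<bar>) \<le> \<alpha>" "(\<Sum>j<n. \<bar>A n j i\<bar>) \<le> \<alpha>" if "i \<in> {..<n}" for i
        using K rows cols that by auto
      show ?thesis
        using F.qform_diff_variance[OF I pos ap(5)[OF h] ap(5)[OF f] v t2 m(1) mm(3,4,1,2) bd sm hD(5) fD(6), of "1 / sqrt (real n)"]
        by (simp add: q_def right_diff_distrib)
    qed
    also have "\<dots> = 8 * \<kappa> * \<alpha>\<^sup>2 * (1 + m) * \<theta>\<^sup>2 * (real n * (1 / sqrt (real n))\<^sup>2)" by (simp only: mult_ac)
    finally have v1: "(\<integral>\<omega>. (?d \<omega>)\<^sup>2 \<partial>M) - (\<integral>\<omega>. ?d \<omega> \<partial>M)\<^sup>2 \<le> 8 * \<kappa> * \<alpha>\<^sup>2 * (1 + m) * \<theta>\<^sup>2" unfolding cn[OF n] by simp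
    have hi: "integrable M (q n h)" "integrable M (q n f)"
      using sq_int[OF q2[OF h, of n] qmeas[OF mm(3)]] sq_int[OF q2[OF f, of n] qmeas[OF mm(1)]] .
    let ?e = "\<lambda>\<omega>. q n T \<omega> - q n h \<omega>"
    have "(\<integral>\<omega>. (?e \<omega>)\<^sup>2 \<partial>M) \<le> \<epsilon> * c" using rough(2)[OF h \<epsilon>(1) \<epsilon>1, of n] by (simp add: c_def mult_ac)
    also have "\<dots> \<le> \<theta>\<^sup>2 / (c + 1) * (c + 1)" using \<epsilon> c0 by (intro mult_mono) auto
    also have "\<dots> = \<theta>\<^sup>2" using c0 by simp
    finally have v2: "(\<integral>\<omega>. (?e \<omega>)\<^sup>2 \<partial>M) \<le> \<theta>\<^sup>2" .
    have ei: "integrable M ?e" "integrable M ?d" using hi qT1 by auto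
    have ei2: "integrable M (\<lambda>\<omega>. (?e \<omega>)\<^sup>2)" by (rule rough(1)[OF h \<epsilon>(1) \<epsilon>1])
    have di2: "integrable M (\<lambda>\<omega>. (?d \<omega>)\<^sup>2)"
    proof (rule integrable_dominated)
      show "integrable M (\<lambda>\<omega>. 2 * (q n h \<omega>)\<^sup>2 + 2 * (q n f \<omega>)\<^sup>2)" using q2[OF h, of n] q2[OF f, of n] by simp
      show "(?d \<omega>)\<^sup>2 \<le> 2 * (q n h \<omega>)\<^sup>2 + 2 * (q n f \<omega>)\<^sup>2" for \<omega>
        using zero_le_power2[of "q n h \<omega> + q n f \<omega>"] by (simp add: power2_sum power2_diff)
    qed (use qmeas[OF mm(3)] qmeas[OF mm(1)] in auto)
    \<comment> \<open>Only variances enter: \<open>w n - u n f\<close> is the sum of the centred versions of \<open>T - h\<close> and \<open>h - f\<close>.\<close>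
    define a where "a = (\<lambda>\<omega>. ?e \<omega> - (\<integral>\<omega>. ?e \<omega> \<partial>M))"
    define b where "b = (\<lambda>\<omega>. ?d \<omega> - (\<integral>\<omega>. ?d \<omega> \<partial>M))"
    have ab: "w n \<omega> - u n f \<omega> = a \<omega> + b \<omega>" for \<omega>
      unfolding a_def b_def w_def u_def using hi qT1[of n] by simp
    have va: "(\<integral>\<omega>. (a \<omega>)\<^sup>2 \<partial>M) = (\<integral>\<omega>. (?e \<omega>)\<^sup>2 \<partial>M) - (\<integral>\<omega>. ?e \<omega> \<partial>M)\<^sup>2" unfolding a_def by (rule variance_eq[OF ei(1) ei2])
    have vb: "(\<integral>\<omega>. (b \<omega>)\<^sup>2 \<partial>M) = (\<integral>\<omega>. (?d \<omega>)\<^sup>2 \<partial>M) - (\<integral>\<omega>. ?d \<omega> \<partial>M)\<^sup>2" unfolding b_def by (rule variance_eq[OF ei(2) di2])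
    have abm: "a \<in> borel_measurable M" "b \<in> borel_measurable M"
      unfolding a_def b_def using qmeas[OF Tm(1)] qmeas[OF mm(1)] qmeas[OF mm(3)] by simp_all
    have abi: "integrable M (\<lambda>\<omega>. (a \<omega>)\<^sup>2)" "integrable M (\<lambda>\<omega>. (b \<omega>)\<^sup>2)"
      unfolding a_def b_def by (rule shift2[OF ei(1) ei2], rule shift2[OF ei(2) di2])
    have "(\<integral>\<omega>. (w n \<omega> - u n f \<omega>)\<^sup>2 \<partial>M) \<le> (\<integral>\<omega>. 2 * (a \<omega>)\<^sup>2 + 2 * (b \<omega>)\<^sup>2 \<partial>M)"
      unfolding ab
    proof (rule integral_mono)
      show pw: "(a \<omega> + b \<omega>)\<^sup>2 \<le> 2 * (a \<omega>)\<^sup>2 + 2 * (b \<omega>)\<^sup>2" for \<omega>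
        using zero_le_power2[of "a \<omega> - b \<omega>"] by (simp add: power2_sum power2_diff)
      show i: "integrable M (\<lambda>\<omega>. 2 * (a \<omega>)\<^sup>2 + 2 * (b \<omega>)\<^sup>2)" using abi by simp
      show "integrable M (\<lambda>\<omega>. (a \<omega> + b \<omega>)\<^sup>2)"
        by (rule integrable_dominated[OF i _ _ pw]) (use abm in auto)
    qed
    also have "\<dots> = 2 * (\<integral>\<omega>. (a \<omega>)\<^sup>2 \<partial>M) + 2 * (\<integral>\<omega>. (b \<omega>)\<^sup>2 \<partial>M)" using abi by simp
    also have "\<dots> \<le> 2 * \<theta>\<^sup>2 + 2 * (8 * \<kappa> * \<alpha>\<^sup>2 * (1 + m) * \<theta>\<^sup>2)"
    proof (intro add_mono mult_left_mono)
      have "(\<integral>\<omega>. (a \<omega>)\<^sup>2 \<partial>M) \<le> (\<integral>\<omega>. (?e \<omega>)\<^sup>2 \<partial>M)" unfolding va by simp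
      then show "(\<integral>\<omega>. (a \<omega>)\<^sup>2 \<partial>M) \<le> \<theta>\<^sup>2" using v2 by (rule order.trans)
      show "(\<integral>\<omega>. (b \<omega>)\<^sup>2 \<partial>M) \<le> 8 * \<kappa> * \<alpha>\<^sup>2 * (1 + m) * \<theta>\<^sup>2"
        unfolding vb by (rule v1)
    qed auto
    also have "\<dots> = D * \<theta>\<^sup>2" by (simp add: D_def algebra_simps)
    finally show ?thesis .
  qed
  have um: "u n f \<in> borel_measurable M" if "f \<in> borel_measurable borel" for n f
    unfolding u_def using qmeas[OF that] by simp
  have wm: "w n \<in> borel_measurable M" for n using um[OF Tm(1)] by (simp add: uw)
  have smooth: "\<exists>b\<ge>0. \<forall>n\<ge>1. (\<integral>\<omega>. (u n f \<omega>)\<^sup>2 \<partial>M) \<le> \<kappa> * b\<^sup>2 \<and>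
      (\<forall>t. norm ((\<integral>\<omega>. iexp (t * u n f \<omega>) \<partial>M) - exp (- ((\<integral>\<omega>. (u n f \<omega>)\<^sup>2 \<partial>M) * t\<^sup>2) / 2))
        \<le> (4 * \<kappa>\<^sup>2 * b^3 * \<bar>t\<bar>^3) * (1 / sqrt (real n)))" if f: "appr \<eta> f f'" for f f' \<eta>
  proof -
    obtain f'' B where tc: "trig_coord TYPE(nat) f f'" "trig_coord TYPE(nat) f' f''"
      and B: "\<And>x. \<bar>f x\<bar> \<le> B" "\<And>x. \<bar>f' x\<bar> \<le> B" "\<And>x. \<bar>f'' x\<bar> \<le> B" using f unfolding appr_def by blast
    define b where "b = 4 * \<alpha> * B\<^sup>2"
    have "b \<ge> 0" using pos by (simp add: b_def)
    moreover have "(\<integral>\<omega>. (u n f \<omega>)\<^sup>2 \<partial>M) \<le> \<kappa> * b\<^sup>2 \<and>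
      (\<forall>t. norm ((\<integral>\<omega>. iexp (t * u n f \<omega>) \<partial>M) - exp (- ((\<integral>\<omega>. (u n f \<omega>)\<^sup>2 \<partial>M) * t\<^sup>2) / 2))
        \<le> (4 * \<kappa>\<^sup>2 * b^3 * \<bar>t\<bar>^3) * (1 / sqrt (real n)))" if n: "n \<ge> 1" for n
    proof -
      interpret F: gaussian_family M "{..<n}" X K by (rule gf)
      let ?c = "1 / sqrt (real n)"
      let ?Q = "\<lambda>\<omega>. qform {..<n} (A n) f (\<lambda>i. X i \<omega>)"
      have ueq: "u n f = (\<lambda>\<omega>. ?c * (?Q \<omega> - (\<integral>\<omega>. ?Q \<omega> \<partial>M)))"
        unfolding u_def q_def by (simp add: right_diff_distrib)
      have I: "(\<Sum>j<n. \<bar>K i j\<bar>) \<le> \<kappa>" "(\<Sum>j<n. \<bar>A n i j\<bar>) \<le> \<alpha>" "(\<Sum>j<n. \<bar>A n j i\<bar>) \<le> \<alpha>" if "i \<in> {..<n}" for i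
        using K rows cols that by auto
      have cp: "0 \<le> ?c" by simp
      have R: "norm ((\<integral>\<omega>. iexp (t * u n f \<omega>) \<partial>M) - exp (- ((\<integral>\<omega>. (u n f \<omega>)\<^sup>2 \<partial>M) * t\<^sup>2) / 2))
         \<le> real (4 * card {..<n}) * \<kappa>\<^sup>2 * (?c * b)^3 * \<bar>t\<bar>^3" for t
        unfolding ueq b_def
        by (rule F.qform_clt_rate(1)[OF I pos tc B cp refl])
      have Vr: "(\<integral>\<omega>. (u n f \<omega>)\<^sup>2 \<partial>M) \<le> real (card {..<n}) * \<kappa> * (?c * b)\<^sup>2"
        unfolding ueq b_def
        by (rule F.qform_clt_rate(2)[OF I pos tc B cp refl])
      have e1: "real (4 * card {..<n}) * \<kappa>\<^sup>2 * (?c * b)^3 * \<bar>t\<bar>^3 = (4 * \<kappa>\<^sup>2 * b^3 * \<bar>t\<bar>^3) * ((real n * ?c\<^sup>2) * ?c)" for t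
        by (simp add: power_mult_distrib power2_eq_square power3_eq_cube mult_ac)
      have e2: "real (card {..<n}) * \<kappa> * (?c * b)\<^sup>2 = (real n * ?c\<^sup>2) * (\<kappa> * b\<^sup>2)"
        by (simp only: power_mult_distrib card_lessThan mult_ac)
      show ?thesis using R Vr unfolding e1 e2 cn[OF n] mult_1 by blast
    qed
    ultimately show ?thesis by blast
  qed
  obtain f1 f1' where f1: "appr (1^4 / 16) f1 f1'" using ex_appr[of "1^4 / 16"] by auto
  obtain b1 where b1: "\<And>n. n \<ge> 1 \<Longrightarrow> (\<integral>\<omega>. (u n f1 \<omega>)\<^sup>2 \<partial>M) \<le> \<kappa> * b1\<^sup>2" using smooth[OF f1] by blast
  define V where "V = 2 * D + 2 * (\<kappa> * b1\<^sup>2)"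
  have V: "(\<integral>\<omega>. (w n \<omega>)\<^sup>2 \<partial>M) \<le> V" if n: "n \<ge> 1" for n
  proof -
    have m1: "f1 \<in> borel_measurable borel" by (rule ap(1)[OF f1])
    let ?d = "\<lambda>\<omega>. w n \<omega> - u n f1 \<omega>"
    have di2: "integrable M (\<lambda>\<omega>. (?d \<omega>)\<^sup>2)"
    proof (rule integrable_dominated)
      show "integrable M (\<lambda>\<omega>. 2 * (w n \<omega>)\<^sup>2 + 2 * (u n f1 \<omega>)\<^sup>2)" using w2[of n] u2[OF f1, of n] by simp
      show "(?d \<omega>)\<^sup>2 \<le> 2 * (w n \<omega>)\<^sup>2 + 2 * (u n f1 \<omega>)\<^sup>2" for \<omega>
        using zero_le_power2[of "w n \<omega> + u n f1 \<omega>"] by (simp add: power2_sum power2_diff)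
    qed (use wm um[OF m1] in auto)
    have "(\<integral>\<omega>. (w n \<omega>)\<^sup>2 \<partial>M) \<le> (\<integral>\<omega>. 2 * (?d \<omega>)\<^sup>2 + 2 * (u n f1 \<omega>)\<^sup>2 \<partial>M)"
    proof (rule integral_mono[OF w2])
      show "(w n \<omega>)\<^sup>2 \<le> 2 * (?d \<omega>)\<^sup>2 + 2 * (u n f1 \<omega>)\<^sup>2" for \<omega>
        using zero_le_power2[of "w n \<omega> - 2 * u n f1 \<omega>"] by (simp add: power2_eq_square algebra_simps)
    qed (use di2 u2[OF f1, of n] in auto)
    also have "\<dots> = 2 * (\<integral>\<omega>. (?d \<omega>)\<^sup>2 \<partial>M) + 2 * (\<integral>\<omega>. (u n f1 \<omega>)\<^sup>2 \<partial>M)" using di2 u2[OF f1, of n] by simp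
    also have "\<dots> \<le> V" unfolding V_def using close[OF n _ _ f1] b1[OF n] by simp
    finally show ?thesis .
  qed
  then show "\<exists>V. \<forall>n\<ge>1. (\<integral>\<omega>. (w n \<omega>)\<^sup>2 \<partial>M) \<le> V" by blast
  have V0: "0 \<le> V" using D0 pos by (simp add: V_def)
  fix t :: real
  show "(\<lambda>n. (\<integral>\<omega>. iexp (t * w n \<omega>) \<partial>M) - exp (- ((\<integral>\<omega>. (w n \<omega>)\<^sup>2 \<partial>M) * t\<^sup>2) / 2)) \<longlonglongrightarrow> 0"
  proof (rule LIMSEQ_I)
    fix e :: real assume e: "e > 0"
    let ?P = "\<bar>t\<bar> * (D + 1) + t\<^sup>2 * (2 * D + V)"
    have P0: "0 \<le> ?P" using D0 V0 by simp
    define \<theta> where "\<theta> = min 1 (e / (2 * (?P + 1)))"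
    have \<theta>: "0 < \<theta>" "\<theta> \<le> 1" "\<theta> \<le> e / (2 * (?P + 1))" using e P0 by (auto simp: \<theta>_def)
    have "?P * \<theta> \<le> ?P * (e / (2 * (?P + 1)))" using \<theta>(3) P0 by (rule mult_left_mono)
    also have "\<dots> \<le> e / 2" using P0 e by (simp add: field_simps)
    finally have Pe: "?P * \<theta> \<le> e / 2" .
    obtain f f' where f: "appr (\<theta>^4 / 16) f f'" using ex_appr[of "\<theta>^4 / 16"] \<theta> by auto
    have fm: "f \<in> borel_measurable borel" by (rule ap(1)[OF f])
    obtain b where R: "\<And>n. n \<ge> 1 \<Longrightarrow> norm ((\<integral>\<omega>. iexp (t * u n f \<omega>) \<partial>M) - exp (- ((\<integral>\<omega>. (u n f \<omega>)\<^sup>2 \<partial>M) * t\<^sup>2) / 2))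
        \<le> (4 * \<kappa>\<^sup>2 * b^3 * \<bar>t\<bar>^3) * (1 / sqrt (real n))" using smooth[OF f] by blast
    let ?r = "\<lambda>n. (4 * \<kappa>\<^sup>2 * b^3 * \<bar>t\<bar>^3) * (1 / sqrt (real n))"
    have "(\<lambda>n. 1 / sqrt (real n)) \<longlonglongrightarrow> 0"
      using tendsto_real_sqrt[OF lim_inverse_n'] by (simp add: real_sqrt_divide)
    from tendsto_mult_right_zero[OF this, of "4 * \<kappa>\<^sup>2 * b^3 * \<bar>t\<bar>^3"] have "?r \<longlonglongrightarrow> 0" .
    then have "\<forall>\<^sub>F n in sequentially. ?r n < e / 2" using order_tendstoD(2) e by (metis half_gt_zero)
    then obtain N where N: "\<And>n. n \<ge> N \<Longrightarrow> ?r n < e / 2" by (auto simp: eventually_sequentially)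
    show "\<exists>no. \<forall>n\<ge>no. norm ((\<integral>\<omega>. iexp (t * w n \<omega>) \<partial>M) - exp (- ((\<integral>\<omega>. (w n \<omega>)\<^sup>2 \<partial>M) * t\<^sup>2) / 2) - 0) < e"
    proof (intro exI[of _ "max 1 N"] allI impI)
      fix n assume "max 1 N \<le> n"
      then have n: "n \<ge> 1" "n \<ge> N" by auto
      have "norm ((\<integral>\<omega>. iexp (t * w n \<omega>) \<partial>M) - exp (- ((\<integral>\<omega>. (w n \<omega>)\<^sup>2 \<partial>M) * t\<^sup>2) / 2)) \<le> ?P * \<theta> + ?r n"
        by (rule l2_close_imp_gaussian_error_close[OF wm um[OF fm] w2 u2[OF f] close[OF n(1) \<theta>(1,2) f] V[OF n(1)] \<theta>(1,2) D0 R[OF n(1)]])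
      also have "\<dots> < e" using Pe N[OF n(2)] by linarith
      finally show "norm ((\<integral>\<omega>. iexp (t * w n \<omega>) \<partial>M) - exp (- ((\<integral>\<omega>. (w n \<omega>)\<^sup>2 \<partial>M) * t\<^sup>2) / 2) - 0) < e" by simp
    qed
  qed
qed

section \<open>Gaussian processes observed at well-separated points\<close>

text \<open>The law of a linear combination is known to be Gaussian, so its characteristic function is determined by
its mean and variance, which are computed from the covariances.\<close>

lemma gaussian_process_gaussian_family:
  fixes Z :: "'t \<Rightarrow> 'a \<Rightarrow> real"
  assumes "prob_space M" and gp: "gaussian_process M Z"
    and mean: "\<And>x. (\<integral>\<omega>. Z x \<omega> \<partial>M) = 0" and inj: "inj_on s I" and I: "finite I"
  shows "gaussian_family M I (\<lambda>i. Z (s i)) (\<lambda>i j. covariance M (Z (s i)) (Z (s j)))"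
proof -
  interpret prob_space M by fact
  have Zm [measurable]: "Z x \<in> borel_measurable M" for x using gp by (simp add: gaussian_process_def)
  have law: "\<exists>m v. v \<ge> 0 \<and> distr M borel (\<lambda>\<omega>. \<Sum>t\<in>J. a t * Z t \<omega>) = gaussian m v" if "finite J" for J a
    using gp that unfolding gaussian_process_def by blast
  have Z2: "integrable M (Z x)" "integrable M (\<lambda>\<omega>. (Z x \<omega>)\<^sup>2)" for x
  proof -
    obtain m v where v: "v \<ge> 0" "distr M borel (Z x) = gaussian m v"
      using law[of "{x}" "\<lambda>_. 1"] by auto
    show "integrable M (Z x)" "integrable M (\<lambda>\<omega>. (Z x \<omega>)\<^sup>2)"
      using gaussian_moments(1,3)[OF v(1), of m] unfolding v(2)[symmetric] by (simp_all add: integrable_distr_eq)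
  qed
  have Zp: "integrable M (\<lambda>\<omega>. Z x \<omega> * Z y \<omega>)" for x y
  proof (rule Bochner_Integration.integrable_bound)
    show "integrable M (\<lambda>\<omega>. (Z x \<omega>)\<^sup>2 + (Z y \<omega>)\<^sup>2)" using Z2 by simp
    have "norm (a * b) \<le> norm (a\<^sup>2 + b\<^sup>2)" for a b :: real
    proof -
      have "0 \<le> (\<bar>a\<bar> - \<bar>b\<bar>)\<^sup>2" by simp
      then have "2 * \<bar>a * b\<bar> \<le> a\<^sup>2 + b\<^sup>2" by (simp add: power2_diff abs_mult)
      then show ?thesis by simp
    qed
    then show "AE \<omega> in M. norm (Z x \<omega> * Z y \<omega>) \<le> norm ((Z x \<omega>)\<^sup>2 + (Z y \<omega>)\<^sup>2)" by simp
  qed simp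
  have cov: "covariance M (Z x) (Z y) = (\<integral>\<omega>. Z x \<omega> * Z y \<omega> \<partial>M)" for x y
    by (simp add: covariance_def mean)
  show ?thesis
  proof
    show "covariance M (Z (s i)) (Z (s j)) = covariance M (Z (s j)) (Z (s i))" for i j
      by (simp add: cov mult.commute)
    fix a :: "_ \<Rightarrow> real"
    define S where "S = (\<lambda>\<omega>. \<Sum>i\<in>I. a i * Z (s i) \<omega>)"
    have Sm [measurable]: "S \<in> borel_measurable M" by (simp add: S_def)
    have "(\<lambda>\<omega>. \<Sum>t\<in>s ` I. a (the_inv_into I s t) * Z t \<omega>) = S"
      using inj by (auto simp: S_def sum.reindex the_inv_into_f_f intro!: ext sum.cong)
    then obtain m v where v: "v \<ge> 0" "distr M borel S = gaussian m v"
      using law[of "s ` I" "\<lambda>t. a (the_inv_into I s t)"] I by auto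
    have ES: "(\<integral>\<omega>. S \<omega> \<partial>M) = 0" unfolding S_def using Z2(1) mean by simp
    have "(\<integral>x. x \<partial>distr M borel S) = (\<integral>\<omega>. S \<omega> \<partial>M)" by (rule integral_distr) simp_all
    then have m: "m = 0" using gaussian_moments(2)[OF v(1), of m] v(2) ES by simp
    have "(\<integral>x. x\<^sup>2 \<partial>distr M borel S) = (\<integral>\<omega>. (S \<omega>)\<^sup>2 \<partial>M)" by (rule integral_distr) simp_all
    then have "v = (\<integral>\<omega>. (S \<omega>)\<^sup>2 \<partial>M)" using gaussian_moments(4)[OF v(1), of m] v(2) m by simp
    also have "(\<lambda>\<omega>. (S \<omega>)\<^sup>2) = (\<lambda>\<omega>. \<Sum>i\<in>I. \<Sum>j\<in>I. a i * a j * (Z (s i) \<omega> * Z (s j) \<omega>))"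
      unfolding S_def power2_eq_square sum_product by (simp add: mult_ac)
    also have "(\<integral>\<omega>. (\<Sum>i\<in>I. \<Sum>j\<in>I. a i * a j * (Z (s i) \<omega> * Z (s j) \<omega>)) \<partial>M)
      = bilin I (\<lambda>i j. covariance M (Z (s i)) (Z (s j))) a a"
      unfolding bilin_def cov using Zp by simp
    finally have v': "v = bilin I (\<lambda>i j. covariance M (Z (s i)) (Z (s j))) a a" .
    have "(\<integral>\<omega>. iexp (S \<omega>) \<partial>M) = char (distr M borel S) 1"
      unfolding char_def by (subst integral_distr) simp_all
    also have "\<dots> = complex_of_real (exp (- bilin I (\<lambda>i j. covariance M (Z (s i)) (Z (s j))) a a / 2))"
      unfolding v(2) m using char_gaussian[OF v(1), of 1] by (simp add: v')
    finally show "(\<integral>\<omega>. iexp (\<Sum>i\<in>I. a i * Z (s i) \<omega>) \<partial>M)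
       = complex_of_real (exp (- bilin I (\<lambda>i j. covariance M (Z (s i)) (Z (s j))) a a / 2))"
      unfolding S_def .
  qed (use I Zm in auto)
qed

text \<open>It remains to translate: the hypotheses on \<open>k\<^sub>Z\<close>, \<open>A\<close> and the points become bounds on row sums, and
\<open>sqrt n * (V\<^sub>n - E V\<^sub>n)\<close> becomes the centred quadratic form, scaled by \<open>1 / sqrt n\<close>, of the general theorem.\<close>

theorem theorem2:
  fixes M :: "'a measure"
    and Z Y :: "real^'d \<Rightarrow> 'a \<Rightarrow> real"
    and k\<^sub>Z :: "real^'d \<Rightarrow> real"
    and T :: "real \<Rightarrow> real"
    and s :: "nat \<Rightarrow> real^'d"
    and y :: "nat \<Rightarrow> 'a \<Rightarrow> real Matrix.vec"
    and A :: "nat \<Rightarrow> real mat"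
    and V :: "nat \<Rightarrow> 'a \<Rightarrow> real"
    and L :: "nat \<Rightarrow> real measure"
    and d\<^sub>w :: "real measure \<Rightarrow> real measure \<Rightarrow> real"
  assumes "metrizes_weak_convergence d\<^sub>w"
    and "prob_space M"
    and "gaussian_process M Z"
    and "\<And>x. prob_space.expectation M (Z x) = 0"
    and "\<And>x x'. covariance M (Z x) (Z x') = k\<^sub>Z (x - x')"
    and "subexponential_asymptotically_positive k\<^sub>Z"
    and "subexponential_nondecreasing T"
    and "\<And>x \<omega>. Y x \<omega> = T (Z x \<omega>)"
    and "\<And>x. prob_space.expectation M (Y x) = 0"
    and "asymptotically_well_separated s"
    and "\<And>n \<omega>. y n \<omega> = Matrix.vec n (\<lambda>i. Y (s i) \<omega>)"
    and "\<And>n. n \<ge> 1 \<Longrightarrow> A n \<in> carrier_mat n n"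
    and "\<exists>C c. c > 0 \<and> (\<forall>n\<ge>1. \<forall>i<n. \<forall>j<n.
           \<bar>A n $$ (i, j)\<bar> \<le> C / (1 + infnorm (s i - s j) powr (real CARD('d) + c)))"
    and "\<And>n \<omega>. V n \<omega> = 1 / real n * scalar_prod (y n \<omega>) (A n *\<^sub>v y n \<omega>)"
    and "\<And>n. L n = distr M borel (\<lambda>\<omega>. sqrt (real n) * (V n \<omega> - prob_space.expectation M (V n)))"
  shows "((\<lambda>n. d\<^sub>w (L n) (gaussian 0 (real n * prob_space.variance M (V n)))) \<longlonglongrightarrow> 0) \<and>
         bounded ((\<lambda>n. real n * prob_space.variance M (V n)) ` {1..})"
proof -
  interpret prob_space M by fact
  note mean = assms(4) and cov = assms(5)
  define \<delta> where "\<delta> = (INF (i, j)\<in>{(i, j). i \<noteq> j}. infnorm (s i - s j))"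
  have \<delta>: "\<delta> > 0" using assms(10) by (simp add: asymptotically_well_separated_def \<delta>_def)
  have sep: "\<delta> \<le> infnorm (s i - s j)" if "i \<noteq> j" for i j
  proof -
    have "bdd_below ((\<lambda>(i, j). infnorm (s i - s j)) ` {(i, j). i \<noteq> j})"
      by (rule bdd_belowI[of _ 0]) (auto simp: infnorm_pos_le)
    from cINF_lower[OF this, of "(i, j)"] that show ?thesis by (simp add: \<delta>_def)
  qed
  have inj: "inj s"
  proof (rule injI, rule ccontr)
    fix i j assume "s i = s j" "i \<noteq> j"
    then show False using sep[of i j] \<delta> by (simp add: infnorm_0)
  qed
  define X where "X = (\<lambda>i. Z (s i))"
  define K where "K = (\<lambda>i j. k\<^sub>Z (s i - s j))"
  have gf: "gaussian_family M {..<n} X K" for n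
    using gaussian_process_gaussian_family[OF assms(2,3) mean inj_on_subset[OF inj], of "{..<n}"]
    unfolding X_def K_def cov by simp
  have Kii: "K i i = k\<^sub>Z 0" for i by (simp add: K_def)
  have k0: "0 \<le> k\<^sub>Z 0"
  proof -
    have "k\<^sub>Z 0 = covariance M (Z 0) (Z 0)" using cov[of 0 0] by simp
    also have "\<dots> \<ge> 0" unfolding covariance_def by (intro integral_nonneg_AE) simp
    finally show ?thesis .
  qed
  have K_rows: "\<exists>\<kappa>\<ge>0. \<forall>n i. i < n \<longrightarrow> (\<Sum>j<n. \<bar>K i j\<bar>) \<le> \<kappa>"
  proof -
    obtain C c where c: "c > 0" "\<And>x. \<bar>k\<^sub>Z x\<bar> \<le> C * exp (- c * infnorm x)"
      using assms(6) unfolding subexponential_asymptotically_positive_def by blast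
    define p where "p = real CARD('d) + 1"
    have p: "p > 0" by (simp add: p_def add_nonneg_pos)
    obtain B where B: "B \<ge> 0" "\<And>n i. (\<Sum>j<n. 1 / (1 + infnorm (s i - s j) powr p)) \<le> B"
      using well_separated_row_sums[where s=s and \<delta>=\<delta> and c=1, OF sep \<delta>] unfolding p_def by auto
    let ?C = "\<bar>C\<bar> * (1 + (p / c) powr p)"
    have C0: "0 \<le> ?C" by (intro mult_nonneg_nonneg add_nonneg_nonneg) auto
    have "(\<Sum>j<n. \<bar>K i j\<bar>) \<le> ?C * B" for n i
    proof -
      have "\<bar>K i j\<bar> \<le> ?C * (1 / (1 + infnorm (s i - s j) powr p))" for j
      proof -
        have "\<bar>K i j\<bar> \<le> C * exp (- c * infnorm (s i - s j))" unfolding K_def by (rule c(2))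
        also have "\<dots> \<le> \<bar>C\<bar> * ((1 + (p / c) powr p) / (1 + infnorm (s i - s j) powr p))"
          using exp_decay_le_powr_decay[OF infnorm_pos_le c(1) p, of "s i - s j"]
          by (intro mult_mono) auto
        finally show ?thesis by simp
      qed
      then have "(\<Sum>j<n. \<bar>K i j\<bar>) \<le> (\<Sum>j<n. ?C * (1 / (1 + infnorm (s i - s j) powr p)))" by (rule sum_mono)
      also have "\<dots> = ?C * (\<Sum>j<n. 1 / (1 + infnorm (s i - s j) powr p))" by (rule sum_distrib_left[symmetric])
      also have "\<dots> \<le> ?C * B" by (rule mult_left_mono[OF B(2) C0])
      finally show ?thesis .
    qed
    then show ?thesis using C0 B(1) by (intro exI[of _ "?C * B"]) auto
  qed
  then obtain \<kappa> where \<kappa>: "\<kappa> \<ge> 0" "\<And>n i. i < n \<Longrightarrow> (\<Sum>j<n. \<bar>K i j\<bar>) \<le> \<kappa>" by blast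
  define A' where "A' = (\<lambda>n i j. A n $$ (i, j))"
  have A_rows: "\<exists>\<alpha>\<ge>0. \<forall>n i. i < n \<longrightarrow> (\<Sum>j<n. \<bar>A' n i j\<bar>) \<le> \<alpha> \<and> (\<Sum>j<n. \<bar>A' n j i\<bar>) \<le> \<alpha>"
  proof -
    obtain C c where c: "c > 0" and A: "\<And>n i j. n \<ge> 1 \<Longrightarrow> i < n \<Longrightarrow> j < n \<Longrightarrow>
        \<bar>A n $$ (i, j)\<bar> \<le> C / (1 + infnorm (s i - s j) powr (real CARD('d) + c))"
      using assms(13) by blast
    define p where "p = real CARD('d) + c"
    obtain B where B: "B \<ge> 0" "\<And>n i. (\<Sum>j<n. 1 / (1 + infnorm (s i - s j) powr p)) \<le> B"
      using well_separated_row_sums[where s=s and \<delta>=\<delta>, OF sep \<delta> c] unfolding p_def by auto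
    have pw: "\<bar>A' n i j\<bar> \<le> \<bar>C\<bar> * (1 / (1 + infnorm (s i - s j) powr p))" if "i < n" "j < n" for n i j
    proof -
      have "\<bar>A' n i j\<bar> \<le> C / (1 + infnorm (s i - s j) powr p)"
        unfolding A'_def p_def using A[of n i j] that by simp
      also have "\<dots> \<le> \<bar>C\<bar> / (1 + infnorm (s i - s j) powr p)"
        by (intro divide_right_mono) (auto simp: add_nonneg_nonneg)
      finally show ?thesis by simp
    qed
    have sums: "(\<Sum>j<n. \<bar>C\<bar> * (1 / (1 + infnorm (s i - s j) powr p))) \<le> \<bar>C\<bar> * B" for n i
      unfolding sum_distrib_left[symmetric] by (intro mult_left_mono B(2)) simp
    have "(\<Sum>j<n. \<bar>A' n i j\<bar>) \<le> \<bar>C\<bar> * B \<and> (\<Sum>j<n. \<bar>A' n j i\<bar>) \<le> \<bar>C\<bar> * B" if "i < n" for n i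
    proof
      show "(\<Sum>j<n. \<bar>A' n i j\<bar>) \<le> \<bar>C\<bar> * B"
        by (rule order.trans[OF sum_mono sums]) (use pw that in auto)
      show "(\<Sum>j<n. \<bar>A' n j i\<bar>) \<le> \<bar>C\<bar> * B"
        by (rule order.trans[OF sum_mono sums[of i]])
           (use pw[OF _ that] infnorm_sub[of "s i"] in auto)
    qed
    then show ?thesis using B(1) by (intro exI[of _ "\<bar>C\<bar> * B"]) auto
  qed
  then obtain \<alpha> where \<alpha>: "\<alpha> \<ge> 0" "\<And>n i. i < n \<Longrightarrow> (\<Sum>j<n. \<bar>A' n i j\<bar>) \<le> \<alpha>" "\<And>n i. i < n \<Longrightarrow> (\<Sum>j<n. \<bar>A' n j i\<bar>) \<le> \<alpha>"
    by blast
  obtain T' where T': "\<And>x. (T has_real_derivative T' x) (at x)" "continuous_on UNIV T'"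
    using assms(7) unfolding subexponential_nondecreasing_def C1_differentiable_on_def
    by (auto simp: has_real_derivative_iff_has_vector_derivative)
  obtain C where C: "\<And>x. \<bar>T x\<bar> \<le> C * exp (C * \<bar>x\<bar>)" "\<And>x. \<bar>T' x\<bar> \<le> C * exp (C * \<bar>x\<bar>)"
    using assms(7) DERIV_imp_deriv[OF T'(1)] unfolding subexponential_nondecreasing_def by auto
  define q where "q = (\<lambda>n \<omega>. 1 / sqrt (real n) * qform {..<n} (A' n) T (\<lambda>i. X i \<omega>))"
  define w where "w = (\<lambda>n \<omega>. q n \<omega> - (\<integral>\<omega>. q n \<omega> \<partial>M))"
  have var_bdd: "\<exists>U. \<forall>n\<ge>1. (\<integral>\<omega>. (w n \<omega>)\<^sup>2 \<partial>M) \<le> U"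
    unfolding w_def q_def
    by (rule gaussian_qform_clt(1)[OF gf Kii k0 _ _ _ \<kappa>(1) \<alpha>(1) T' C]; rule \<kappa>(2) \<alpha>(2,3); assumption)
  have char_lim: "(\<lambda>n. (\<integral>\<omega>. iexp (t * w n \<omega>) \<partial>M) - exp (- ((\<integral>\<omega>. (w n \<omega>)\<^sup>2 \<partial>M) * t\<^sup>2) / 2)) \<longlonglongrightarrow> 0" for t
    unfolding w_def q_def
    by (rule gaussian_qform_clt(2)[OF gf Kii k0 _ _ _ \<kappa>(1) \<alpha>(1) T' C]; rule \<kappa>(2) \<alpha>(2,3); assumption)
  have V_eq: "V n \<omega> = 1 / sqrt (real n) * q n \<omega>" if "n \<ge> 1" for n \<omega>
  proof -
    have "scalar_prod (y n \<omega>) (A n *\<^sub>v y n \<omega>) = qform {..<n} (A' n) T (\<lambda>i. X i \<omega>)"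
      using assms(12)[OF that] unfolding assms(11) qform_def A'_def X_def
      by (auto simp: scalar_prod_def assms(8) sum_distrib_left lessThan_atLeast0 mult_ac intro!: sum.cong)
    then show ?thesis unfolding assms(14) q_def by simp
  qed
  have w_eq: "sqrt (real n) * (V n \<omega> - (\<integral>\<omega>. V n \<omega> \<partial>M)) = w n \<omega>" for n \<omega>
  proof (cases "n = 0")
    case True
    then show ?thesis by (simp add: w_def q_def qform_def)
  next
    case False
    then show ?thesis by (simp add: V_eq w_def field_simps)
  qed
  have var_eq: "real n * prob_space.variance M (V n) = (\<integral>\<omega>. (w n \<omega>)\<^sup>2 \<partial>M)" for n
    unfolding w_eq[symmetric] power_mult_distrib by simp
  obtain U where U: "\<And>n. n \<ge> 1 \<Longrightarrow> (\<integral>\<omega>. (w n \<omega>)\<^sup>2 \<partial>M) \<le> U" using var_bdd by blast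
  have Tm: "T \<in> borel_measurable borel"
    using T'(1) by (intro borel_measurable_continuous_onI) (meson DERIV_isCont continuous_at_imp_continuous_on)
  have wm: "w n \<in> borel_measurable M" for n
  proof -
    have "(\<lambda>\<omega>. T (X i \<omega>)) \<in> borel_measurable M" for i
      using assms(3) Tm unfolding X_def gaussian_process_def by (intro measurable_compose[OF _ Tm]) auto
    then show ?thesis unfolding w_def q_def qform_def
      by (intro borel_measurable_diff borel_measurable_times borel_measurable_sum borel_measurable_const) auto
  qed
  have L: "L n = distr M borel (w n)" for n unfolding assms(15) w_eq ..
  \<comment> \<open>For \<open>n = 0\<close> everything vanishes because \<open>1 / 0 = 0\<close>, so no index has to be excluded.\<close>
  have w0: "w 0 = (\<lambda>_. 0)" by (simp add: w_def q_def qform_def)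
  have vb: "(\<integral>\<omega>. (w n \<omega>)\<^sup>2 \<partial>M) \<le> max 0 U" for n
    using U[of n] by (cases "n = 0") (auto simp: w0 le_max_iff_disj)
  have "(\<lambda>n. d\<^sub>w (L n) (gaussian 0 (\<integral>\<omega>. (w n \<omega>)\<^sup>2 \<partial>M))) \<longlonglongrightarrow> 0"
  proof (rule metrizes_weak_convergence_gaussian[OF assms(1) _ _ vb])
    show "real_distribution (L n)" for n unfolding L by (rule real_distribution_distr[OF wm])
    have "char (L n) t = (\<integral>\<omega>. iexp (t * w n \<omega>) \<partial>M)" for n t
      unfolding L char_def using wm by (intro integral_distr) auto
    then show "(\<lambda>n. char (L n) t - exp (- ((\<integral>\<omega>. (w n \<omega>)\<^sup>2 \<partial>M) * t\<^sup>2) / 2)) \<longlonglongrightarrow> 0" for t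
      using char_lim[of t] by simp
  qed simp
  moreover have "bounded ((\<lambda>n. \<integral>\<omega>. (w n \<omega>)\<^sup>2 \<partial>M) ` {1..})"
    unfolding bounded_iff using vb by (auto intro!: exI[of _ "max 0 U"])
  ultimately show ?thesis unfolding var_eq by blast
qed

end
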